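(* Let $\alpha>-1$ with $\alpha\neq-1/2$, and let $\rho>1$. There are constants $C_n>0$ ($n\ge1$), depending only on $n,\alpha,\rho$, with $C_n=1+O(n^{-1})$ as $n\to\infty$ (for fixed $\alpha,\rho$), such that for every $u\in\mathcal A_\rho$, with $M=\max_{z\in\mathcal E_\rho}|u(z)|$, and every $n\ge1$, the Gegenbauer-Gauss quadrature remainder satisfies $$ \big|E_n^{GG}[u]\big|\le\frac{C_nM\sqrt{\pi}}{\rho^{2n}}\bigg(\frac{\sqrt{\pi}}{2^{2\alpha}}+\frac{\Gamma(\alpha+1)}{\sqrt{\Gamma(2\alpha+2)}}\,\frac{2\sqrt2}{\rho^2-1}\bigg) \begin{cases}(1+\rho^{-2})^{\alpha+1/2},&\alpha>-1/2,\\(1-\rho^{-2})^{\alpha+1/2},&\alpha<-1/2.\end{cases} $$ In particular, for the Legendre case ($\alpha=0$), writing $E_n^{LG}$ for the corresponding remainder (Legendre-Gauss quadrature), there are constants $C_n>0$, depending only on $n,\rho$, with $C_n=1+O(n^{-1})$ as $n\to\infty$ (for fixed $\rho$), such that for every $u\in\mathcal A_\rho$ and $n\ge1$, $$ \big|E_n^{LG}[u]\big|\le\frac{C_nM\pi\sqrt{1+\rho^{-2}}}{\rho^{2n}}\Big(1+\frac{1}{2(\rho^2-1)}\Big). $$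
   Context: For $\rho>1$, the Bernstein ellipse is $\mathcal E_\rho=\{z\in\mathbb C: z=\tfrac12(w+w^{-1}),\ w=\rho e^{\mathrm i\theta},\ \theta\in[0,2\pi]\}$, and $\mathcal A_\rho$ is the set of functions analytic on and within $\mathcal E_\rho$. For $\alpha>-1$, let $\omega^{\alpha,\alpha}(x)=(1-x^2)^\alpha$ on $(-1,1)$, and let $J_n^{\alpha,\alpha}$ be the degree-$n$ Jacobi (Gegenbauer) polynomial, orthogonal on $(-1,1)$ with respect to $\omega^{\alpha,\alpha}$. The Gegenbauer-Gauss quadrature remainder is $E_n^{GG}[u]=\int_{-1}^1u(x)\omega^{\alpha,\alpha}(x)\,dx-\sum_{j=1}^nu(x_j)\omega_j$, where $x_1,\dots,x_n$ are the zeros of $J_n^{\alpha,\alpha}$ and $\omega_1,\dots,\omega_n$ are the corresponding Gauss quadrature weights (so the rule is exact for polynomials of degree at most $2n-1$ with weight $\omega^{\alpha,\alpha}$). *)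

theory Defs
  imports
    "HOL-Analysis.Analysis"
    "HOL-Computational_Algebra.Polynomial"
    "HOL-Library.Landau_Symbols"
begin

subsection \<open>Functions analytic on and within a Bernstein ellipse\<close>

definition bernstein_ellipse :: "real \<Rightarrow> complex set" where
  "bernstein_ellipse \<rho> =
     {z. \<exists>w \<theta>. \<theta> \<in> {0..2 * pi} \<and> w = of_real \<rho> * exp (\<i> * of_real \<theta>) \<and> z = (w + inverse w) / 2}"

definition analytic_in_ellipse :: "real \<Rightarrow> (complex \<Rightarrow> complex) set" where
  "analytic_in_ellipse \<rho> =
     {u. u analytic_on (bernstein_ellipse \<rho> \<union> inside (bernstein_ellipse \<rho>))}"

definition ellipse_max :: "real \<Rightarrow> (complex \<Rightarrow> complex) \<Rightarrow> real" where
  "ellipse_max \<rho> u = (SUP z \<in> bernstein_ellipse \<rho>. cmod (u z))"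

text \<open>The supremum in \<^const>\<open>ellipse_max\<close> is attained, so it is the maximum on the ellipse.\<close>

lemma compact_bernstein_ellipse:
  assumes "\<rho> > 1"
  shows "compact (bernstein_ellipse \<rho>)"
proof -
  have "bernstein_ellipse \<rho> =
      (\<lambda>\<theta>. (of_real \<rho> * exp (\<i> * of_real \<theta>) + inverse (of_real \<rho> * exp (\<i> * of_real \<theta>))) / 2) ` {0..2 * pi}"
    by (auto simp: bernstein_ellipse_def)
  also have "compact \<dots>"
    using assms by (intro compact_continuous_image continuous_intros) auto
  finally show ?thesis .
qed

lemma ellipse_max_attained:
  assumes "\<rho> > 1" "u \<in> analytic_in_ellipse \<rho>"
  shows "\<exists>z \<in> bernstein_ellipse \<rho>. cmod (u z) = ellipse_max \<rho> u"
    and "\<And>z. z \<in> bernstein_ellipse \<rho> \<Longrightarrow> cmod (u z) \<le> ellipse_max \<rho> u"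
proof -
  have cont: "continuous_on (bernstein_ellipse \<rho>) (\<lambda>z. cmod (u z))"
    using assms(2) unfolding analytic_in_ellipse_def
    by (intro continuous_intros holomorphic_on_imp_continuous_on analytic_imp_holomorphic)
       (auto elim: analytic_on_subset)
  have ne: "bernstein_ellipse \<rho> \<noteq> {}"
    unfolding bernstein_ellipse_def using pi_ge_zero by (fastforce intro: exI[of _ "0::real"])
  obtain z where z: "z \<in> bernstein_ellipse \<rho>"
      "\<And>y. y \<in> bernstein_ellipse \<rho> \<Longrightarrow> cmod (u y) \<le> cmod (u z)"
    using continuous_attains_sup[OF compact_bernstein_ellipse[OF assms(1)] ne cont] by auto
  have eq: "ellipse_max \<rho> u = cmod (u z)"
    unfolding ellipse_max_def by (rule cSup_eq_maximum) (use z in auto)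
  show "\<exists>z \<in> bernstein_ellipse \<rho>. cmod (u z) = ellipse_max \<rho> u"
    using z eq by auto
  show "\<And>z. z \<in> bernstein_ellipse \<rho> \<Longrightarrow> cmod (u z) \<le> ellipse_max \<rho> u"
    using z eq by auto
qed


subsection \<open>Gegenbauer polynomials\<close>

definition gegenbauer_weight :: "real \<Rightarrow> real \<Rightarrow> real" where
  "gegenbauer_weight \<alpha> x = (1 - x\<^sup>2) powr \<alpha>"

definition gegenbauer_orthogonal :: "real \<Rightarrow> real poly \<Rightarrow> real poly \<Rightarrow> bool" where
  "gegenbauer_orthogonal \<alpha> p q \<longleftrightarrow>
     (LINT x:{-1<..<1}|lborel. poly p x * poly q x * gegenbauer_weight \<alpha> x) = 0"

text \<open>
  The leading coefficient is that of the classical Jacobi polynomial with both parameters \<open>\<alpha>\<close>; it only fixes the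
  scaling, on which the quadrature rule below does not depend. The lemma
  \<open>jacobi_poly_ex1\<close> justifies the definite description.
\<close>

definition jacobi_poly :: "real \<Rightarrow> nat \<Rightarrow> real poly" where
  "jacobi_poly \<alpha> n =
     (THE p. degree p = n \<and> lead_coeff p = ((2 * real n + 2 * \<alpha>) gchoose n) / 2 ^ n \<and>
             (\<forall>q. degree q < n \<longrightarrow> gegenbauer_orthogonal \<alpha> p q))"

lemma set_integrable_gegenbauer_weight:
  assumes "\<alpha> > -1"
  shows "set_integrable lborel {-1<..<1} (gegenbauer_weight \<alpha>)"
proof -
  define f where "f = (\<lambda>t::real. t powr \<alpha> * (1 - t) powr \<alpha>)"
  have "(f has_integral Beta (\<alpha> + 1) (\<alpha> + 1)) {0<..<1}"
    using has_integral_Beta_real[of "\<alpha> + 1" "\<alpha> + 1"] assms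
    by (simp add: has_integral_Icc_iff_Ioo f_def)
  then have "f absolutely_integrable_on {0<..<1}"
    by (intro nonnegative_absolutely_integrable_1) (auto simp: f_def has_integral_integrable)
  then have "integrable lebesgue (\<lambda>t. indicator {0<..<1} t *\<^sub>R f t)"
    by (simp add: set_integrable_def)
  then have "integrable lborel (\<lambda>t. indicator {0<..<1} t *\<^sub>R f t)"
    by (subst (asm) integrable_completion) (auto simp: f_def)
  then have "integrable lborel (\<lambda>x. indicator {0<..<1} (1/2 + 1/2 * x) *\<^sub>R f (1/2 + 1/2 * x))"
    by (rule lborel_integrable_real_affine) simp
  then have "integrable lborel (\<lambda>x. 4 powr \<alpha> * (indicator {0<..<1} (1/2 + 1/2 * x) *\<^sub>R f (1/2 + 1/2 * x)))"
    by (rule integrable_mult_right)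
  also have "(\<lambda>x. 4 powr \<alpha> * (indicator {0<..<1} (1/2 + 1/2 * x) *\<^sub>R f (1/2 + 1/2 * x))) =
             (\<lambda>x. indicator {-1<..<1} x *\<^sub>R gegenbauer_weight \<alpha> x)"
  proof
    fix x :: real
    show "4 powr \<alpha> * (indicator {0<..<1} (1/2 + 1/2 * x) *\<^sub>R f (1/2 + 1/2 * x)) =
          indicator {-1<..<1} x *\<^sub>R gegenbauer_weight \<alpha> x"
    proof (cases "x \<in> {-1<..<1}")
      case True
      have "1 - x\<^sup>2 = 4 * ((1/2 + 1/2 * x) * (1 - (1/2 + 1/2 * x)))"
        by (simp add: field_simps power2_eq_square)
      then have "(1 - x\<^sup>2) powr \<alpha> = 4 powr \<alpha> * f (1/2 + 1/2 * x)"
        using True by (simp only: f_def powr_mult)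
      then show ?thesis
        using True by (simp add: gegenbauer_weight_def indicator_def)
    next
      case False
      then show ?thesis by (auto simp: indicator_def)
    qed
  qed
  finally show ?thesis by (simp add: set_integrable_def)
qed

lemma set_integrable_poly_gegenbauer_weight:
  assumes "\<alpha> > -1"
  shows "set_integrable lborel {-1<..<1} (\<lambda>x. poly p x * gegenbauer_weight \<alpha> x)"
proof -
  have "bounded (poly p ` {-1..1})"
    by (intro compact_imp_bounded compact_continuous_image continuous_intros) auto
  then obtain B where B: "\<And>x. x \<in> {-1..1} \<Longrightarrow> \<bar>poly p x\<bar> \<le> B"
    unfolding bounded_iff by (metis imageI real_norm_def)
  have B0: "B \<ge> 0"
    using B[of 0] by auto
  have "set_integrable lborel {-1<..<1} (\<lambda>x. B * gegenbauer_weight \<alpha> x)"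
    using set_integrable_gegenbauer_weight[OF assms] by (rule set_integrable_mult_right)
  then show ?thesis
  proof (rule set_integrable_bound)
    show "set_borel_measurable lborel {-1<..<1} (\<lambda>x. poly p x * gegenbauer_weight \<alpha> x)"
    proof -
      have [measurable]: "poly p \<in> borel_measurable borel"
        by (intro borel_measurable_continuous_onI continuous_intros)
      show ?thesis
        unfolding set_borel_measurable_def gegenbauer_weight_def by measurable
    qed
    show "AE x in lborel. x \<in> {-1<..<1} \<longrightarrow>
        norm (poly p x * gegenbauer_weight \<alpha> x) \<le> norm (B * gegenbauer_weight \<alpha> x)"
      using B B0 by (auto simp: abs_mult gegenbauer_weight_def intro!: mult_right_mono)
  qed
qed

definition gegenbauer_inner :: "real \<Rightarrow> real poly \<Rightarrow> real poly \<Rightarrow> real" where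
  "gegenbauer_inner \<alpha> p q = (LINT x:{-1<..<1}|lborel. poly (p * q) x * gegenbauer_weight \<alpha> x)"

lemma gegenbauer_orthogonal_iff: "gegenbauer_orthogonal \<alpha> p q \<longleftrightarrow> gegenbauer_inner \<alpha> p q = 0"
  by (simp add: gegenbauer_orthogonal_def gegenbauer_inner_def)

lemma gegenbauer_inner_commute: "gegenbauer_inner \<alpha> p q = gegenbauer_inner \<alpha> q p"
  by (simp add: gegenbauer_inner_def mult.commute)

lemma gegenbauer_inner_add:
  assumes "\<alpha> > -1"
  shows "gegenbauer_inner \<alpha> (p + q) r = gegenbauer_inner \<alpha> p r + gegenbauer_inner \<alpha> q r"
  unfolding gegenbauer_inner_def
  using set_integral_add(2)[OF set_integrable_poly_gegenbauer_weight[OF assms, of "p * r"]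
    set_integrable_poly_gegenbauer_weight[OF assms, of "q * r"]]
  by (simp add: distrib_right)

lemma gegenbauer_inner_smult:
  "gegenbauer_inner \<alpha> (smult c p) r = c * gegenbauer_inner \<alpha> p r"
  unfolding gegenbauer_inner_def by (simp add: mult.assoc)

lemma gegenbauer_inner_diff:
  assumes "\<alpha> > -1"
  shows "gegenbauer_inner \<alpha> (p - q) r = gegenbauer_inner \<alpha> p r - gegenbauer_inner \<alpha> q r"
  using gegenbauer_inner_add[OF assms, of "p - q" q r] by simp

lemma gegenbauer_inner_sum:
  assumes "\<alpha> > -1"
  shows "gegenbauer_inner \<alpha> (\<Sum>k\<in>A. f k) r = (\<Sum>k\<in>A. gegenbauer_inner \<alpha> (f k) r)"
proof (induction A rule: infinite_finite_induct)
  case (insert x F)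
  then show ?case by (simp add: gegenbauer_inner_add[OF assms])
qed (simp_all add: gegenbauer_inner_def)

lemma gegenbauer_integral_nonneg_eq_0:
  assumes "\<alpha> > -1" "\<And>x. x \<in> {-1<..<1} \<Longrightarrow> poly p x \<ge> 0"
    and "(LINT x:{-1<..<1}|lborel. poly p x * gegenbauer_weight \<alpha> x) = 0"
  shows "p = 0"
proof (rule ccontr)
  assume "p \<noteq> 0"
  define f where "f = (\<lambda>x. indicator {-1<..<1} x *\<^sub>R (poly p x * gegenbauer_weight \<alpha> x))"
  have "integrable lborel f"
    using set_integrable_poly_gegenbauer_weight[OF assms(1), of p]
    by (simp add: set_integrable_def f_def)
  moreover have "integral\<^sup>L lborel f = 0"
    using assms(3) by (simp add: set_lebesgue_integral_def f_def)
  moreover have "AE x in lborel. 0 \<le> f x"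
    using assms(2) by (auto simp: f_def gegenbauer_weight_def indicator_def)
  ultimately have "AE x in lborel. f x = 0"
    using integral_nonneg_eq_0_iff_AE by blast
  moreover have "AE x in lborel. x \<notin> {x. poly p x = 0}"
    using \<open>p \<noteq> 0\<close>
    by (intro AE_not_in countable_imp_null_set_lborel countable_finite poly_roots_finite)
  ultimately have "AE x in lborel. x \<notin> {-1<..<(1::real)}"
  proof eventually_elim
    case (elim x)
    show ?case
    proof
      assume x: "x \<in> {-1<..<1}"
      then have "x\<^sup>2 < 1"
        by (simp add: abs_square_less_1 abs_less_iff)
      then show False
        using elim x by (auto simp: f_def gegenbauer_weight_def)
    qed
  qed
  then have "{-1<..<(1::real)} \<in> null_sets lborel"
    by (subst (asm) AE_iff_null_sets[symmetric]) auto
  then show False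
    by (simp add: null_sets_def)
qed

lemma gegenbauer_inner_self_eq_0:
  assumes "\<alpha> > -1" "gegenbauer_inner \<alpha> p p = 0"
  shows "p = 0"
  using gegenbauer_integral_nonneg_eq_0[OF assms(1), of "p * p"] assms(2)
  by (simp add: gegenbauer_inner_def)

lemma jacobi_poly_ex1:
  assumes \<alpha>: "\<alpha> > -1"
  shows "\<exists>!p. degree p = n \<and> lead_coeff p = ((2 * real n + 2 * \<alpha>) gchoose n) / 2 ^ n \<and>
              (\<forall>q. degree q < n \<longrightarrow> gegenbauer_orthogonal \<alpha> p q)"
proof -
  have "\<exists>p. degree p = n \<and> lead_coeff p = 1 \<and> (\<forall>q. degree q < n \<longrightarrow> gegenbauer_inner \<alpha> p q = 0)"
  proof (induction n rule: less_induct)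
    case (less n)
    then obtain P where P: "\<And>k. k < n \<Longrightarrow> degree (P k) = k \<and> lead_coeff (P k) = 1 \<and>
        (\<forall>q. degree q < k \<longrightarrow> gegenbauer_inner \<alpha> (P k) q = 0)"
      by metis
    define c where "c = (\<lambda>k. gegenbauer_inner \<alpha> (monom 1 n) (P k) / gegenbauer_inner \<alpha> (P k) (P k))"
    define s where "s = (\<Sum>k<n. smult (c k) (P k))"
    define p where "p = monom 1 n - s"
    have cs: "coeff s m = 0" if "m \<ge> n" for m
      using that P by (auto simp: s_def coeff_sum coeff_eq_0 intro!: sum.neutral)
    have deg: "degree p = n"
    proof (rule antisym)
      show "degree p \<le> n"
        by (rule degree_le) (auto simp: p_def cs)
      show "n \<le> degree p"
        by (rule le_degree) (simp add: p_def cs)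
    qed
    have lead: "lead_coeff p = 1"
      unfolding deg by (simp add: p_def cs)
    have ortP: "gegenbauer_inner \<alpha> p (P j) = 0" if j: "j < n" for j
    proof -
      have nz: "gegenbauer_inner \<alpha> (P j) (P j) \<noteq> 0"
        using gegenbauer_inner_self_eq_0[OF \<alpha>, of "P j"] P[OF j] by auto
      have PP: "gegenbauer_inner \<alpha> (P k) (P j) = 0" if "k < n" "k \<noteq> j" for k
        using P[OF j] P[OF that(1)] that(2) gegenbauer_inner_commute[of \<alpha> "P k" "P j"]
        by (metis nat_neq_iff)
      have "gegenbauer_inner \<alpha> s (P j) = (\<Sum>k<n. c k * gegenbauer_inner \<alpha> (P k) (P j))"
        by (simp add: s_def gegenbauer_inner_sum[OF \<alpha>] gegenbauer_inner_smult)
      also have "\<dots> = (\<Sum>k<n. if k = j then c j * gegenbauer_inner \<alpha> (P j) (P j) else 0)"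
        by (rule sum.cong) (auto simp: PP)
      also have "\<dots> = gegenbauer_inner \<alpha> (monom 1 n) (P j)"
        using j nz by (simp add: c_def)
      finally show ?thesis
        by (simp add: p_def gegenbauer_inner_diff[OF \<alpha>])
    qed
    have ort: "degree q < m \<Longrightarrow> m \<le> n \<Longrightarrow> gegenbauer_inner \<alpha> p q = 0" for q m
    proof (induction m arbitrary: q)
      case (Suc m)
      define r where "r = q - smult (coeff q m) (P m)"
      have Pm: "degree (P m) = m" "coeff (P m) m = 1"
        using P[of m] Suc.prems by auto
      have r0: "coeff r i = 0" if "i \<ge> m" for i
        using that Pm Suc.prems by (cases "i = m") (auto simp: r_def coeff_eq_0)
      have "gegenbauer_inner \<alpha> p r = 0"
      proof (cases "r = 0")
        case True
        then show ?thesis by (simp add: gegenbauer_inner_def)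
      next
        case False
        then have "degree r < m"
          using r0[of "degree r"] by (metis leading_coeff_0_iff not_le_imp_less)
        then show ?thesis using Suc by simp
      qed
      then have "gegenbauer_inner \<alpha> r p = 0" "gegenbauer_inner \<alpha> (P m) p = 0"
        using ortP[of m] Suc.prems by (simp_all add: gegenbauer_inner_commute[of \<alpha> _ p])
      then have "gegenbauer_inner \<alpha> q p = 0"
        by (simp add: r_def gegenbauer_inner_diff[OF \<alpha>] gegenbauer_inner_smult)
      then show ?case by (simp add: gegenbauer_inner_commute)
    qed simp
    show ?case
      using deg lead ort[of _ n] by blast
  qed
  then obtain p where p: "degree p = n" "lead_coeff p = 1"
      "\<And>q. degree q < n \<Longrightarrow> gegenbauer_inner \<alpha> p q = 0"
    by blast
  define k where "k = ((2 * real n + 2 * \<alpha>) gchoose n) / 2 ^ n"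
  have "(\<Prod>i = 0..<n. 2 * real n + 2 * \<alpha> - real i) \<noteq> 0"
    using \<alpha> by auto
  then have k: "k \<noteq> 0"
    by (simp add: k_def gbinomial_prod_rev)
  show ?thesis
    unfolding k_def[symmetric] gegenbauer_orthogonal_iff
  proof (rule ex1I[of _ "smult k p"])
    show "degree (smult k p) = n \<and> lead_coeff (smult k p) = k \<and>
        (\<forall>q. degree q < n \<longrightarrow> gegenbauer_inner \<alpha> (smult k p) q = 0)"
      using p k by (simp add: gegenbauer_inner_smult)
  next
    fix p' assume p': "degree p' = n \<and> lead_coeff p' = k \<and>
        (\<forall>q. degree q < n \<longrightarrow> gegenbauer_inner \<alpha> p' q = 0)"
    define d where "d = p' - smult k p"
    have d0: "coeff d i = 0" if "i \<ge> n" for i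
      using that p p' by (cases "i = n") (auto simp: d_def coeff_eq_0)
    show "p' = smult k p"
    proof (rule ccontr)
      assume "p' \<noteq> smult k p"
      then have "d \<noteq> 0" by (simp add: d_def)
      then have "degree d < n"
        using d0[of "degree d"] by (metis leading_coeff_0_iff not_le_imp_less)
      then have "gegenbauer_inner \<alpha> d d = 0"
        using p p' by (subst (1) d_def) (simp add: gegenbauer_inner_diff[OF \<alpha>] gegenbauer_inner_smult)
      then show False
        using gegenbauer_inner_self_eq_0[OF \<alpha>] \<open>d \<noteq> 0\<close> by blast
    qed
  qed
qed

lemma jacobi_poly:
  assumes "\<alpha> > -1"
  shows "degree (jacobi_poly \<alpha> n) = n"
    and "lead_coeff (jacobi_poly \<alpha> n) = ((2 * real n + 2 * \<alpha>) gchoose n) / 2 ^ n"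
    and "\<And>q. degree q < n \<Longrightarrow> gegenbauer_orthogonal \<alpha> (jacobi_poly \<alpha> n) q"
  using theI'[OF jacobi_poly_ex1[OF assms, of n]] unfolding jacobi_poly_def[symmetric] by auto


subsection \<open>Gauss quadrature\<close>

definition gauss_nodes :: "real \<Rightarrow> nat \<Rightarrow> real set" where
  "gauss_nodes \<alpha> n = {x. poly (jacobi_poly \<alpha> n) x = 0}"

text \<open>
  The weighted integral of the Lagrange cardinal polynomial of the node \<open>x\<close>. The nodes are \<open>n\<close>
  distinct points of \<open>(-1, 1)\<close> (\<open>gauss_nodes\<close> below), and these weights make the rule exact up to
  degree \<open>2 n - 1\<close> (\<open>gauss_quadrature_exact\<close> below).
\<close>

definition gauss_weight :: "real \<Rightarrow> nat \<Rightarrow> real \<Rightarrow> real" where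
  "gauss_weight \<alpha> n x =
     (LINT t:{-1<..<1}|lborel.
        (\<Prod>y \<in> gauss_nodes \<alpha> n - {x}. (t - y) / (x - y)) * gegenbauer_weight \<alpha> t)"

lemma poly_even_roots_sign:
  fixes p :: "real poly"
  assumes "p \<noteq> 0" "\<And>x. x \<in> {a<..<b} \<Longrightarrow> even (order x p)"
  shows "(\<forall>x\<in>{a<..<b}. poly p x \<ge> 0) \<or> (\<forall>x\<in>{a<..<b}. poly p x \<le> 0)"
  using assms
proof (induction "degree p" arbitrary: p rule: less_induct)
  case less
  show ?case
  proof (cases "\<exists>c\<in>{a<..<b}. poly p c = 0")
    case True
    then obtain c where c: "c \<in> {a<..<b}" "poly p c = 0" by blast
    have "order c p \<noteq> 0"
      using c less.prems by (simp add: order_root)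
    with less.prems(2)[OF c(1)] have "2 \<le> order c p"
      by (cases "order c p") (auto elim: oddE)
    then have "[:-c, 1:] ^ 2 dvd p"
      using order_1 power_le_dvd by blast
    then obtain s where s: "p = [:-c, 1:] ^ 2 * s" by (auto elim: dvdE)
    have s0: "s \<noteq> 0" using s less.prems by auto
    have "degree p = degree s + 2"
      using s0 unfolding s by (subst degree_mult_eq) (auto simp: degree_power_eq)
    moreover have "even (order x s)" if "x \<in> {a<..<b}" for x
    proof -
      have "order x p = 2 * order x [:-c, 1:] + order x s"
      proof -
        have "order x p = order x ([:-c, 1:] ^ 2) + order x s"
          using s0 unfolding s by (intro order_mult) auto
        also have "order x ([:-c, 1:] ^ 2) = order x [:-c, 1:] + order x [:-c, 1:]"
          unfolding power2_eq_square by (intro order_mult) (simp del: mult_pCons_left mult_pCons_right)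
        finally show ?thesis by simp
      qed
      then show ?thesis using less.prems(2)[OF that] by simp
    qed
    ultimately have "(\<forall>x\<in>{a<..<b}. poly s x \<ge> 0) \<or> (\<forall>x\<in>{a<..<b}. poly s x \<le> 0)"
      using less.hyps[of s] s0 by simp
    then show ?thesis
      by (auto simp: s intro: mult_nonneg_nonpos)
  next
    case False
    show ?thesis
    proof (rule ccontr)
      assume "\<not> ?thesis"
      then obtain x y where xy: "x \<in> {a<..<b}" "y \<in> {a<..<b}" "poly p x < 0" "poly p y > 0"
        by (auto simp: not_le)
      then have "x \<noteq> y" by auto
      then consider "x < y" | "y < x" by linarith
      then show False
      proof cases
        case 1
        then show False
          using poly_IVT_pos[of x y p] xy False by force
      next
        case 2
        then show False
          using poly_IVT_neg[of y x p] xy False by force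
      qed
    qed
  qed
qed

lemma gauss_nodes:
  assumes \<alpha>: "\<alpha> > -1"
  shows "finite (gauss_nodes \<alpha> n)" "card (gauss_nodes \<alpha> n) = n" "gauss_nodes \<alpha> n \<subseteq> {-1<..<1}"
proof -
  define J where "J = jacobi_poly \<alpha> n"
  have deg: "degree J = n"
    using jacobi_poly[OF \<alpha>] by (simp add: J_def)
  have J0: "J \<noteq> 0"
  proof
    assume "J = 0"
    then have "(\<Prod>i = 0..<n. 2 * real n + 2 * \<alpha> - real i) = 0"
      using jacobi_poly(2)[OF \<alpha>, of n] by (simp add: J_def gbinomial_prod_rev)
    then show False using \<alpha> by auto
  qed
  have fin: "finite {x. poly J x = 0}"
    using J0 by (rule poly_roots_finite)
  have card_le: "card {x. poly J x = 0} \<le> n"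
    using card_poly_roots_bound[OF J0] deg by simp
  define R where "R = {x \<in> {-1<..<1}. odd (order x J)}"
  have Rsub: "R \<subseteq> {x. poly J x = 0}"
    using J0 by (auto simp: R_def order_root elim: oddE)
  have finR: "finite R"
    using Rsub fin by (rule finite_subset)
  define r where "r = (\<Prod>y\<in>R. [:-y, 1:])"
  have r0: "r \<noteq> 0"
    by (auto simp: r_def finR)
  have degr: "degree r = card R"
    by (simp add: r_def degree_prod_eq_sum_degree)
  have ordr: "order x r = (if x \<in> R then 1 else 0)" for x
  proof -
    have "order x r = (\<Sum>y\<in>R. order x [:-y, 1:])"
      unfolding r_def using finR
    proof (induction R rule: finite_induct)
      case (insert y F)
      have "(\<Prod>y\<in>F. [:-y, 1:]) \<noteq> 0"
        using insert by auto
      then show ?case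
        using insert by (simp add: order_mult del: mult_pCons_left mult_pCons_right)
    qed (simp add: order_0I)
    also have "\<dots> = (\<Sum>y\<in>R. if x = y then 1 else 0)"
    proof (intro sum.cong refl)
      show "order x [:-y, 1:] = (if x = y then 1 else 0)" for y
        using order_power_n_n[of y 1] order_0I[of "[:-y, 1:]" x] by (cases "x = y") simp_all
    qed
    finally show ?thesis using finR by simp
  qed
  have sgn: "(\<forall>x\<in>{-1<..<1}. poly (J * r) x \<ge> 0) \<or> (\<forall>x\<in>{-1<..<1}. poly (J * r) x \<le> 0)"
    using J0 r0 by (intro poly_even_roots_sign) (auto simp: order_mult ordr R_def)
  have "n \<le> card R"
  proof (rule ccontr)
    assume "\<not> n \<le> card R"
    then have "degree r < n"
      using degr by simp
    then have int0: "(LINT x:{-1<..<1}|lborel. poly (J * r) x * gegenbauer_weight \<alpha> x) = 0"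
      using jacobi_poly(3)[OF \<alpha>, of r n] by (simp add: J_def gegenbauer_orthogonal_def)
    then have "(LINT x:{-1<..<1}|lborel. poly (- (J * r)) x * gegenbauer_weight \<alpha> x) = 0"
      by (simp add: set_lebesgue_integral_def)
    with int0 have "J * r = 0 \<or> - (J * r) = 0"
      using sgn gegenbauer_integral_nonneg_eq_0[OF \<alpha>, of "J * r"]
        gegenbauer_integral_nonneg_eq_0[OF \<alpha>, of "- (J * r)"] by auto
    then show False using J0 r0 by simp
  qed
  then have cards: "card R = n" "card R = card {x. poly J x = 0}"
    using card_mono[OF fin Rsub] card_le by linarith+
  have eq: "gauss_nodes \<alpha> n = R"
    using card_subset_eq[OF fin Rsub cards(2)] by (simp add: gauss_nodes_def J_def)
  show "finite (gauss_nodes \<alpha> n)" "card (gauss_nodes \<alpha> n) = n"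
    unfolding eq by (rule finR, rule cards(1))
  show "gauss_nodes \<alpha> n \<subseteq> {-1<..<1}"
    unfolding eq R_def by blast
qed

lemma gauss_quadrature_exact:
  assumes \<alpha>: "\<alpha> > -1" and p: "degree p < 2 * n"
  shows "(LINT x:{-1<..<1}|lborel. poly p x * gegenbauer_weight \<alpha> x) =
         (\<Sum>x \<in> gauss_nodes \<alpha> n. poly p x * gauss_weight \<alpha> n x)"
proof -
  define J where "J = jacobi_poly \<alpha> n"
  define N where "N = gauss_nodes \<alpha> n"
  have deg: "degree J = n"
    using jacobi_poly[OF \<alpha>] by (simp add: J_def)
  have n: "n > 0" using p by simp
  have J0: "J \<noteq> 0" using deg n by auto
  have N: "finite N" "card N = n" "\<And>x. x \<in> N \<Longrightarrow> poly J x = 0"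
    using gauss_nodes[OF \<alpha>, of n] by (auto simp: N_def J_def gauss_nodes_def)
  define q where "q = p div J"
  define s where "s = p mod J"
  have pqs: "p = J * q + s" by (simp add: q_def s_def)
  have degs: "degree s < n"
    using degree_mod_less[OF J0, of p] n deg by (auto simp: s_def)
  have degq: "degree q < n"
  proof (cases "q = 0")
    case False
    then have "degree (J * q) = n + degree q"
      using J0 deg by (simp add: degree_mult_eq)
    then have "degree p = n + degree q"
      unfolding pqs using degs by (subst degree_add_eq_left) auto
    then show ?thesis using p by simp
  qed (use n in simp)
  define L where "L = (\<lambda>x. \<Prod>y \<in> N - {x}. smult (1 / (x - y)) [:-y, 1:])"
  have Lval: "poly (L x) t = (\<Prod>y \<in> N - {x}. (t - y) / (x - y))" for x t
    by (simp add: L_def poly_prod diff_divide_distrib)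
  have Ldeg: "degree (L x) < n" if "x \<in> N" for x
  proof -
    have "degree (L x) \<le> (\<Sum>y\<in>N - {x}. degree (smult (1 / (x - y)) [:-y, 1:]))"
      unfolding L_def by (rule degree_prod_sum_le[unfolded o_def]) (use N(1) in blast)
    also have "\<dots> \<le> (\<Sum>y\<in>N - {x}. 1)" by (intro sum_mono) auto
    also have "\<dots> < n" using that N n by simp
    finally show ?thesis .
  qed
  have Lnode: "poly (L x) z = (if z = x then 1 else 0)" if "x \<in> N" "z \<in> N" for x z
    using that N(1) by (auto simp: Lval intro!: prod.neutral)
  have s_eq: "s = (\<Sum>x\<in>N. smult (poly s x) (L x))"
  proof (rule ccontr)
    define d where "d = s - (\<Sum>x\<in>N. smult (poly s x) (L x))"
    assume "s \<noteq> (\<Sum>x\<in>N. smult (poly s x) (L x))"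
    then have d0: "d \<noteq> 0" by (simp add: d_def)
    have "degree d < n"
      unfolding d_def using n degs Ldeg
      by (intro degree_diff_less degree_sum_less) (auto intro: le_less_trans[OF degree_smult_le])
    moreover have "poly d z = 0" if "z \<in> N" for z
    proof -
      have "(\<Sum>x\<in>N. poly s x * poly (L x) z) = (\<Sum>x\<in>N. if z = x then poly s x else 0)"
        using that by (intro sum.cong) (auto simp: Lnode)
      then show ?thesis
        using that N(1) by (simp add: d_def poly_sum)
    qed
    then have "N \<subseteq> {x. poly d x = 0}" by blast
    then have "n \<le> card {x. poly d x = 0}"
      using card_mono[OF poly_roots_finite[OF d0]] N(2) by blast
    ultimately show False
      using card_poly_roots_bound[OF d0] by simp
  qed
  have G: "gegenbauer_inner \<alpha> f 1 = (LINT x:{-1<..<1}|lborel. poly f x * gegenbauer_weight \<alpha> x)" for f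
    by (simp add: gegenbauer_inner_def)
  have "gegenbauer_inner \<alpha> p 1 = gegenbauer_inner \<alpha> (J * q) 1 + gegenbauer_inner \<alpha> s 1"
    unfolding pqs by (rule gegenbauer_inner_add[OF \<alpha>])
  also have "gegenbauer_inner \<alpha> (J * q) 1 = 0"
    using jacobi_poly(3)[OF \<alpha> degq] by (simp add: gegenbauer_orthogonal_iff J_def gegenbauer_inner_def)
  also have "gegenbauer_inner \<alpha> s 1 = (\<Sum>x\<in>N. poly s x * gegenbauer_inner \<alpha> (L x) 1)"
    by (subst s_eq) (simp add: gegenbauer_inner_sum[OF \<alpha>] gegenbauer_inner_smult)
  also have "\<dots> = (\<Sum>x\<in>N. poly p x * gauss_weight \<alpha> n x)"
    by (intro sum.cong) (simp_all add: pqs N G Lval gauss_weight_def N_def[symmetric])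
  finally show ?thesis by (simp add: G N_def)
qed

definition gegenbauer_gauss_remainder :: "real \<Rightarrow> nat \<Rightarrow> (complex \<Rightarrow> complex) \<Rightarrow> complex" where
  "gegenbauer_gauss_remainder \<alpha> n u =
     (LINT x:{-1<..<1}|lborel. u (of_real x) * of_real (gegenbauer_weight \<alpha> x)) -
     (\<Sum>x \<in> gauss_nodes \<alpha> n. u (of_real x) * of_real (gauss_weight \<alpha> n x))"

definition legendre_gauss_remainder :: "nat \<Rightarrow> (complex \<Rightarrow> complex) \<Rightarrow> complex" where
  "legendre_gauss_remainder = gegenbauer_gauss_remainder 0"

end

theory Submission
  imports
    Defs
    "HOL-Complex_Analysis.Complex_Analysis"
    "HOL-Real_Asymp.Real_Asymp"
begin

text \<open>
  An analytic \<open>u\<close> has a Chebyshev expansion \<open>u = (\<Sum>k. a\<^sub>k T\<^sub>k)\<close> with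
  \<open>\<bar>a\<^sub>k\<bar> \<le> 2 M / \<rho>\<^sup>k\<close>, by Cauchy's formula on the ellipse and the substitution \<open>z = (w + 1/w) / 2\<close>.
  The Gauss rule is exact up to degree \<open>2 n - 1\<close>, so
  \<open>\<rho>\<^bsup>2n\<^esup> \<bar>E\<^sub>n[u]\<bar> / M\<close> is at most \<open>2 (\<Sum>i. \<bar>E\<^sub>n[T\<^bsub>2n+i\<^esub>]\<bar> / \<rho>\<^sup>i)\<close>.

  The second order differential equation of the Gegenbauer polynomial gives two-term recursions for its
  Chebyshev coefficients and for its inner products with the \<open>T\<^sub>m\<close>. With \<open>\<lambda> = \<alpha> + 1/2\<close>, their
  limits as \<open>n \<rightarrow> \<infinity>\<close> are, up to factors, the coefficients of \<open>(1 - y\<^sup>2)\<close> to the powers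
  \<open>- \<lambda>\<close> and \<open>\<lambda>\<close>. Hence \<open>E\<^sub>n[T\<^bsub>2n+i\<^esub>]\<close> tends to \<open>\<pi> / 2\<^bsup>2 \<lambda>\<^esup>\<close> times the coefficient of
  \<open>y\<^sup>i\<close> in the quotient \<open>(1 - y\<^sup>2)\<^bsup>2 \<lambda>\<^esup>\<close>, where the factor comes from the norms of the orthogonal
  polynomials. By dominated convergence the bound above tends to a binomial series in \<open>1/\<rho>\<^sup>2\<close>,
  which is strictly smaller than the claimed constant; so \<open>C\<^sub>n = 1\<close> works for all large \<open>n\<close>.
\<close>

subsection \<open>Absolute binomial series\<close>

text \<open>Because the claimed constant is strictly larger than the limiting one, plain convergence
  suffices and no rate in \<open>n\<close> has to be extracted from the recursions. With t =
  1/\<rho>^2 and r = \<alpha> + 1/2, both constants have the same value at t = 0, so the comparison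
  depends on their growth in t. For r > 0 the claimed constant is a multiple of (1 + t)^r times a
  linear function of t / (1 - t) whose slope is a Gamma quotient, awkward to compare with binomial
  coefficients for all \<alpha>. That slope is therefore replaced by the smaller
  \<open>powr_slope\<close>. The gap between \<open>4/5 * powr_slope r\<close> and
  \<open>powr_slope r\<close> pays for the tail of the series, which does not terminate when 2 r is
  not an integer. The Legendre constant is smaller than the general one at \<alpha> = 0 and needs a
  comparison of its own. Dominated convergence rests on the positivity of the Gauss weights, which
  bounds the error on T_k uniformly in k and n.\<close>

lemma one_add_powr_le:
  fixes t s :: real
  assumes "t \<ge> 0" "0 \<le> s" "s \<le> 1"
  shows "(1 + t) powr s \<le> 1 + s * t"
proof -
  \<comment> \<open>Convexity of \<open>exp\<close> between ln (1 + t) and 0, with weights s and 1 -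
    s.\<close>
  have "exp (s * ln (1 + t) + (1 - s) * 0) \<le> s * exp (ln (1 + t)) + (1 - s) * exp 0"
    using convex_onD[OF exp_convex, of "1 - s" "ln (1 + t)" 0] assms by (simp add: algebra_simps)
  then show ?thesis
    using assms by (simp add: powr_def algebra_simps)
qed

text \<open>Bernoulli's inequality for exponent r is the previous bound for exponent 1 / r, applied
  to r t and raised to the power r.\<close>

lemma one_add_powr_ge:
  fixes t r :: real
  assumes "t \<ge> 0" "r \<ge> 1"
  shows "1 + r * t \<le> (1 + t) powr r"
proof -
  have "(1 + r * t) powr (1 / r) \<le> 1 + t"
    using one_add_powr_le[of "r * t" "1 / r"] assms by simp
  then have "((1 + r * t) powr (1 / r)) powr r \<le> (1 + t) powr r"
    using assms by (intro powr_mono2) auto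
  then show ?thesis
    using assms by (simp add: powr_powr)
qed

text \<open>\<open>exp\<close> dominates its quadratic Taylor polynomial and ln 2 is at least
  69/100; 238/1000 is (69/100)^2 / 2 rounded down. The quadratic turns the pointwise lower bounds on
  \<open>powr_slope\<close> into polynomial inequalities.\<close>

lemma two_powr_ge:
  fixes r :: real
  assumes "r \<ge> 0"
  shows "1 + 69/100 * r + 238/1000 * r\<^sup>2 \<le> 2 powr r"
proof -
  have "69/100 \<le> ln (2::real)"
    using ln_approx_bounds[of 2 2, simplified, simplified eval_nat_numeral, simplified] by simp
  then have l: "69/100 * r \<le> r * ln 2"
    using mult_left_mono[of "69/100" "ln 2" r] assms by (simp add: mult.commute)
  have "1 + 69/100 * r + 238/1000 * r\<^sup>2 \<le> 1 + 69/100 * r + (69/100 * r)\<^sup>2 / 2"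
    by (simp add: power_mult_distrib field_simps power2_eq_square)
  also have "\<dots> \<le> exp (69/100 * r)"
    using exp_lower_Taylor_quadratic[of "69/100 * r"] assms by simp
  also have "\<dots> \<le> 2 powr r"
    using l by (simp add: powr_def)
  finally show ?thesis .
qed

text \<open>
  A lower bound for the Gamma quotient of the theorem (\<open>powr_slope_le_Gamma\<close> below) that is elementary,
  yet large enough for the recursion \<open>powr_slope_step\<close>.
\<close>

definition powr_slope :: "real \<Rightarrow> real" where
  "powr_slope r = 7 * 2 powr r / (r + 13/2)"

text \<open>The tangent of (1 - t) (1 + t)^r at t = 0 has slope r - 1; this allows
  \<open>4/5 * powr_slope r - 1\<close> to take its place.\<close>

lemma le_powr_slope:
  assumes "r \<ge> 0"
  shows "r \<le> 4/5 * powr_slope r"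
proof -
  \<comment> \<open>Completes the square: the difference of the two quadratics compared below has
    its vertex at 6590/1664 and is positive there.\<close>
  have sq: "0 \<le> (1664 * r - 6590)\<^sup>2"
    by simp
  have "r * (r + 13/2) = r\<^sup>2 + 13/2 * r"
    by (simp add: power2_eq_square algebra_simps)
  also have "\<dots> \<le> 28/5 * (1 + 69/100 * r + 238/1000 * r\<^sup>2)"
    using sq assms by (simp add: field_simps power2_eq_square)
  also have "\<dots> \<le> 28/5 * 2 powr r"
    using two_powr_ge[OF assms] by simp
  finally show ?thesis
    using assms by (simp add: powr_slope_def field_simps)
qed

lemma powr_slope_gt_1:
  assumes "r \<ge> 0"
  shows "1 < powr_slope r"
proof -
  have "r + 13/2 < 7 * (1 + 69/100 * r + 238/1000 * r\<^sup>2)"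
    using assms by (simp add: field_simps) (use zero_le_power2[of r] assms in linarith)
  also have "\<dots> \<le> 7 * 2 powr r"
    using two_powr_ge[OF assms] by simp
  finally show ?thesis
    using assms by (simp add: powr_slope_def)
qed

text \<open>The value 5/4 is the threshold above which the reserved fifth of the slope outweighs the
  tail terms in \<open>abs_gbinomial_series_less\<close>.\<close>

lemma powr_slope_gt_5_4:
  assumes "r \<ge> 1/2"
  shows "5/4 < powr_slope r"
proof -
  have "5/4 * (r + 13/2) < 7 * (1 + 69/100 * r + 238/1000 * r\<^sup>2)"
    using assms by (simp add: field_simps) (use zero_le_power2[of r] assms in linarith)
  also have "\<dots> \<le> 7 * 2 powr r"
    using two_powr_ge[of r] assms by simp
  finally show ?thesis
    using assms by (simp add: powr_slope_def less_divide_eq)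
qed

text \<open>The right side is what the linear bound on (1 - t) (1 + t)^r gains in its slope when r
  grows by one; the left side is what \<open>one_minus_times_powr_le\<close> charges for that
  step.\<close>

lemma powr_slope_step:
  assumes "r \<ge> 2"
  shows "2 * 2 powr r / (r + 2) \<le> 4/5 * (powr_slope (r + 1) - powr_slope r)"
proof -
  have "2 / (r + 2) \<le> 28/5 * (2 / (r + 15/2) - 1 / (r + 13/2))"
  proof -
    have "2 * ((r + 15/2) * (r + 13/2)) \<le> 28/5 * ((r + 11/2) * (r + 2))"
    proof -
      have "0 \<le> (r - 2) * (r - 2)" by simp
      then have "0 \<le> r\<^sup>2 - 4 * r + 4" by (simp add: power2_eq_square algebra_simps)
      moreover have "(r + 15/2) * (r + 13/2) = r\<^sup>2 + 14 * r + 195/4"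
        "(r + 11/2) * (r + 2) = r\<^sup>2 + 15/2 * r + 11"
        by (simp_all add: power2_eq_square field_simps)
      ultimately show ?thesis using assms by (simp only:) (simp add: field_simps)
    qed
    then have "2 / (r + 2) \<le> 28/5 * ((r + 11/2) / ((r + 15/2) * (r + 13/2)))"
      using assms by (simp add: field_simps)
    also have "(r + 11/2) / ((r + 15/2) * (r + 13/2)) = 2 / (r + 15/2) - 1 / (r + 13/2)"
    proof -
      have "2 / (r + 15/2) - 1 / (r + 13/2) = (2 * (r + 13/2) - (r + 15/2)) / ((r + 15/2) * (r + 13/2))"
        using assms by (subst diff_frac_eq) auto
      then show ?thesis by simp
    qed
    finally show ?thesis .
  qed
  then have "2 powr r * (2 / (r + 2)) \<le> 2 powr r * (28/5 * (2 / (r + 15/2) - 1 / (r + 13/2)))"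
    by (intro mult_left_mono) auto
  then show ?thesis
    by (simp add: powr_slope_def powr_add algebra_simps)
qed

section \<open>Linear bounds for (1 - t) (1 + t)^r on the unit interval\<close>

lemma one_minus_times_powr_le:
  fixes t r :: real
  assumes t: "0 \<le> t" "t \<le> 1" and r: "r \<ge> 1"
  shows "(1 - t) * (1 + t) powr r \<le> 2 * 2 powr r / (r + 2)"
proof -
  \<comment> \<open>Bernoulli at the increment (1 - t) / 2. Since (1 - t)^2 is nonnegative, 1 + (1 -
    t) / 2 is at most 2 / (1 + t), which turns this lower bound into an upper bound for (1 +
    t)^r.\<close>
  have "1 + r * ((1 - t) / 2) \<le> (1 + (1 - t) / 2) powr r"
    using t r by (intro one_add_powr_ge) auto
  also have "\<dots> \<le> (2 / (1 + t)) powr r"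
    using t r zero_le_power2[of "1 - t"]
    by (intro powr_mono2) (auto simp: divide_simps algebra_simps power2_eq_square)
  also have "\<dots> = 2 powr r / (1 + t) powr r"
    using t by (simp add: powr_divide)
  finally have le: "(1 + t) powr r * (1 + r * ((1 - t) / 2)) \<le> 2 powr r"
    using t by (simp add: pos_le_divide_eq mult.commute)
  have "(1 - t) * (r + 2) / 2 \<le> 1 + r * ((1 - t) / 2)"
    using t by (simp add: field_simps)
  then have "(1 + t) powr r * ((1 - t) * (r + 2) / 2) \<le> (1 + t) powr r * (1 + r * ((1 - t) / 2))"
    by (intro mult_left_mono) auto
  also note le
  finally show ?thesis
    using r by (simp add: field_simps)
qed

text \<open>The right side is the tangent at t = 0. The second derivative there is r (r - 3), which
  is why the range ends at 3. Whole powers of 1 + t are split off until an exponent between 0 and 1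
  remains, to which \<open>one_add_powr_le\<close> applies.\<close>

lemma one_minus_times_powr_le_linear:
  fixes t r :: real
  assumes t: "0 \<le> t" "t \<le> 1" and r: "0 \<le> r" "r \<le> 3"
  shows "(1 - t) * (1 + t) powr r \<le> 1 + (r - 1) * t"
proof -
  have t2: "t * t \<le> t" using t mult_left_mono[of t 1 t] by simp
  consider "r \<le> 1" | "1 < r" "r \<le> 2" | "2 < r" by linarith
  then show ?thesis
  proof cases
    case 1
    have "(1 - t) * (1 + t) powr r \<le> (1 - t) * (1 + r * t)"
      using one_add_powr_le[of t r] 1 r t by (intro mult_left_mono) auto
    also have "\<dots> \<le> 1 + (r - 1) * t"
      using r by (simp add: algebra_simps mult_nonneg_nonneg)
    finally show ?thesis .
  next
    case 2
    have "(1 - t) * (1 + t) powr r = (1 - t\<^sup>2) * (1 + t) powr (r - 1)"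
      using t by (simp add: powr_diff divide_simps power2_eq_square algebra_simps)
    also have "\<dots> \<le> 1 * (1 + (r - 1) * t)"
      using one_add_powr_le[of t "r - 1"] 2 t
      by (intro mult_mono) (auto simp: power2_eq_square mult_le_one)
    finally show ?thesis by simp
  next
    case 3
    have "(1 - t) * (1 + t) powr r = (1 - t) * (1 + t)^2 * (1 + t) powr (r - 2)"
      using t by (simp add: powr_diff divide_simps)
    also have "\<dots> \<le> (1 - t) * (1 + t)^2 * (1 + (r - 2) * t)"
      using one_add_powr_le[of t "r - 2"] 3 r t by (intro mult_left_mono) auto
    also have "\<dots> = 1 + (r - 1) * t - (3 - r) * t^2 - (r - 1) * t^3 - (r - 2) * t^4"
      by (simp add: power2_eq_square power3_eq_cube power4_eq_xxxx algebra_simps)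
    also have "\<dots> \<le> 1 + (r - 1) * t"
    proof -
      have "0 \<le> (3 - r) * t^2" "0 \<le> (r - 1) * t^3" "0 \<le> (r - 2) * t^4"
        using 3 r t by auto
      then show ?thesis by linarith
    qed
    finally show ?thesis .
  qed
qed

text \<open>Up to r = 3 the tangent bound is stronger. Beyond, r is lowered by one at a time through
  (1 + t)^(q + 1) = (1 + t)^q + t (1 + t)^q, and the growth of \<open>powr_slope\<close> pays for
  the second summand.\<close>

lemma one_minus_times_powr_le_slope:
  fixes t r :: real
  assumes t: "0 \<le> t" "t \<le> 1" and r: "0 \<le> r"
  shows "(1 - t) * (1 + t) powr r \<le> 1 + (4/5 * powr_slope r - 1) * t"
proof -
  have "(1 - t) * (1 + t) powr r \<le> 1 + (4/5 * powr_slope r - 1) * t"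
    if "0 \<le> r" "r \<le> 3 + real n" for n r
    using that
  proof (induction n arbitrary: r)
    case 0
    have "(1 - t) * (1 + t) powr r \<le> 1 + (r - 1) * t"
      using 0 t by (intro one_minus_times_powr_le_linear) auto
    also have "\<dots> \<le> 1 + (4/5 * powr_slope r - 1) * t"
      using le_powr_slope[OF \<open>0 \<le> r\<close>] t by (intro add_left_mono mult_right_mono) auto
    finally show ?case .
  next
    case (Suc n)
    show ?case
    proof (cases "r \<le> 3 + real n")
      case True
      then show ?thesis using Suc by simp
    next
      case False
      define q where "q = r - 1"
      have q: "q \<ge> 2" "q \<le> 3 + real n" "r = q + 1"
        using False Suc.prems by (auto simp: q_def)
      have "(1 - t) * (1 + t) powr r = (1 - t) * (1 + t) powr q + t * ((1 - t) * (1 + t) powr q)"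
        using t by (simp add: q(3) powr_add algebra_simps)
      also have "\<dots> \<le> 1 + (4/5 * powr_slope q - 1) * t + t * (2 * 2 powr q / (q + 2))"
        using Suc.IH[of q] q t one_minus_times_powr_le[of t q]
        by (intro add_mono mult_left_mono) auto
      also have "\<dots> \<le> 1 + (4/5 * powr_slope q - 1) * t + t * (4/5 * (powr_slope r - powr_slope q))"
        using powr_slope_step[OF q(1)] t unfolding q(3) by (intro add_left_mono mult_left_mono) auto
      also have "\<dots> = 1 + (4/5 * powr_slope r - 1) * t"
        by (simp add: field_simps)
      finally show ?thesis .
    qed
  qed
  moreover have "r \<le> 3 + real (nat \<lceil>r\<rceil>)"
    using real_nat_ceiling_ge[of r] by linarith
  ultimately show ?thesis
    using r by blast
qed

text \<open>After multiplication by the complementary power (1 + t)^(1 - s), the left side is at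
  most (1 + s t) (1 + (1 - s) t) = 1 + t + s (1 - s) t^2. The 1/8 comes from s (1 - s) <= 1/4 and
  t^2 <= t.\<close>

lemma one_add_mult_le_powr:
  fixes s t :: real
  assumes "0 \<le> s" "s \<le> 1" "0 \<le> t" "t \<le> 1"
  shows "1 + s * t \<le> (1 + t) powr s * (1 + t / 8)"
proof -
  have "(1 + t) powr (1 - s) \<le> 1 + (1 - s) * t"
    using assms by (intro one_add_powr_le) auto
  then have "(1 + s * t) * (1 + t) powr (1 - s) \<le> (1 + s * t) * (1 + (1 - s) * t)"
    using assms by (intro mult_left_mono) auto
  also have "\<dots> = 1 + t + s * (1 - s) * t\<^sup>2"
    by (simp add: algebra_simps power2_eq_square)
  also have "\<dots> \<le> 1 + t + 1/4 * t\<^sup>2"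
  proof -
    have "s * (1 - s) \<le> 1/4"
      using zero_le_power2[of "s - 1/2"] by (simp add: power2_eq_square algebra_simps)
    then show ?thesis
      by (intro add_left_mono mult_right_mono) auto
  qed
  also have "\<dots> \<le> (1 + t) * (1 + t / 8)"
    using assms mult_left_mono[of t 1 t] by (simp add: algebra_simps power2_eq_square)
  finally have "(1 + s * t) * ((1 + t) / (1 + t) powr s) \<le> (1 + t) * (1 + t / 8)"
    using assms by (simp add: powr_diff)
  then have "(1 + t) * (1 + s * t) \<le> (1 + t) * ((1 + t) powr s * (1 + t / 8))"
    using assms by (simp add: divide_simps mult_ac)
  then show ?thesis
    using assms by simp
qed

section \<open>Binomial coefficients whose upper argument lies between two integers\<close>

lemma gbinomial_frac_tail:
  fixes s :: real
  assumes s: "0 \<le> s" "s \<le> 1"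
  shows "(real j + s) gchoose (j + 2) \<le> 0" "\<bar>(real j + s) gchoose (j + 2)\<bar> \<le> 1/8"
proof -
  \<comment> \<open>Among the factors j + s, ..., s, s - 1 of the numerator only s - 1 can be
    negative. The modulus is at most 1/8 at j = 0, and each step multiplies it by a ratio of at most
    one.\<close>
  have "(real j + s) gchoose (j + 2) \<le> 0 \<and> \<bar>(real j + s) gchoose (j + 2)\<bar> \<le> 1/8"
  proof (induction j)
    case 0
    have "s gchoose 2 = s * (s - 1) / 2"
      by (simp add: numeral_2_eq_2 gbinomial_Suc_rec gbinomial_absorption')
    moreover have "s * (1 - s) \<le> 1/4"
      using zero_le_power2[of "s - 1/2"] by (simp add: power2_eq_square algebra_simps)
    moreover have "s * (1 - s) \<ge> 0" using s by simp
    ultimately show ?case by (simp add: numeral_2_eq_2 algebra_simps)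
  next
    case (Suc j)
    have eq: "(real (Suc j) + s) gchoose (Suc j + 2) =
        (real (Suc j) + s) / (real j + 3) * ((real j + s) gchoose (j + 2))"
      using gbinomial_absorption'[of "Suc j + 2" "real (Suc j) + s"] by (simp add: add_ac)
    have f: "0 \<le> (real (Suc j) + s) / (real j + 3)" "(real (Suc j) + s) / (real j + 3) \<le> 1"
      using s by auto
    have "(real (Suc j) + s) / (real j + 3) * \<bar>(real j + s) gchoose (j + 2)\<bar> \<le> 1 * (1/8)"
      using f Suc by (intro mult_mono) auto
    then show ?case
      unfolding eq abs_mult using Suc f by (metis abs_of_nonneg mult_1 mult_nonneg_nonpos)
  qed
  then show "(real j + s) gchoose (j + 2) \<le> 0" "\<bar>(real j + s) gchoose (j + 2)\<bar> \<le> 1/8"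
    by auto
qed

lemma abs_gbinomial_frac_tail:
  fixes s :: real
  assumes s: "0 \<le> s" "s \<le> 1" and k: "k \<ge> j + 2"
  shows "\<bar>(real j + s) gchoose k\<bar> \<le> 1/8"
  using k
proof (induction k rule: dec_induct)
  case base
  then show ?case using gbinomial_frac_tail(2)[OF s] .
next
  case (step k)
  have "(real j + s) gchoose (Suc k) = ((real j + s) gchoose k) * ((real j + s - real k) / real (Suc k))"
    using gbinomial_mult_1[of "real j + s" k] by (simp add: field_simps)
  moreover have "\<bar>(real j + s - real k) / real (Suc k)\<bar> \<le> 1"
    using step s by (auto simp: abs_le_iff divide_simps)
  ultimately show ?case
    using step.IH mult_mono[of "\<bar>(real j + s) gchoose k\<bar>" "1/8" "\<bar>(real j + s - real k) / real (Suc k)\<bar>" 1]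
    by (simp add: abs_mult del: of_nat_Suc)
qed

text \<open>The right side is the k-th coefficient of (1 + t)^j (1 + s t), and both sides obey
  Pascal's rule. At k = j + 2 the right side is 0 and the claim is the sign of
  \<open>gbinomial_frac_tail\<close>.\<close>

lemma gbinomial_frac_le:
  fixes s :: real
  assumes s: "0 \<le> s" "s \<le> 1"
  shows "k \<le> j + 2 \<Longrightarrow> (real j + s) gchoose k \<le> real (j choose k) + s * (if k = 0 then 0 else real (j choose (k - 1)))"
proof (induction j arbitrary: k)
  case 0
  then consider "k = 0" | "k = 1" | "k = 2" by fastforce
  then show ?case using gbinomial_frac_tail(1)[OF s, of 0] by cases (auto simp: numeral_2_eq_2)
next
  case (Suc j)
  show ?case
  proof (cases k)
    case 0
    then show ?thesis by simp
  next
    case (Suc i)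
    have eq: "(real (Suc j) + s) gchoose k = ((real j + s) gchoose i) + ((real j + s) gchoose (Suc i))"
      using gbinomial_Suc_Suc[of "real j + s" i] Suc by (simp add: add_ac)
    show ?thesis
    proof (cases "Suc i \<le> j + 2")
      case True
      then show ?thesis
        unfolding eq using Suc.IH[of i] Suc.IH[of "Suc i"] Suc
        by (cases i) (auto simp: algebra_simps)
    next
      case False
      then have "k = Suc j + 2" using Suc.prems Suc by simp
      then show ?thesis using gbinomial_frac_tail(1)[OF s, of "Suc j"]
        by (simp add: binomial_eq_0)
    qed
  qed
qed

lemma gbinomial_nonneg_of_le:
  fixes a :: real
  assumes "real k \<le> a + 1"
  shows "0 \<le> a gchoose k"
proof -
  have "0 \<le> (\<Prod>i = 0..<k. a - real i)"
    using assms by (intro prod_nonneg) auto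
  then show ?thesis by (simp add: gbinomial_prod_rev)
qed

text \<open>Up to k = j + 1 the coefficient is nonnegative and the modulus drops out; the summand
  1/8 covers all later coefficients.\<close>

lemma abs_gbinomial_le:
  fixes s :: real
  assumes s: "0 \<le> s" "s \<le> 1"
  shows "\<bar>(real j + s) gchoose k\<bar> \<le>
    real (j choose k) + s * (if k = 0 then 0 else real (j choose (k - 1))) + (if k = 0 then 0 else 1/8)"
proof (cases "k \<le> j + 1")
  case True
  then have "0 \<le> (real j + s) gchoose k"
    using s by (intro gbinomial_nonneg_of_le) auto
  then show ?thesis
    using gbinomial_frac_le[OF s, of k j] True by auto
next
  case False
  then show ?thesis
    using abs_gbinomial_frac_tail[OF s, of j k] s by (auto intro: add_increasing)
qed

lemma binomial_sums:
  fixes t :: real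
  shows "(\<lambda>k. real (j choose k) * t ^ k) sums (1 + t) ^ j"
proof -
  have "(1 + t) ^ j = (\<Sum>k\<le>j. real (j choose k) * t ^ k)"
    using binomial_ring[of t 1 j] by (simp add: add.commute)
  then show ?thesis
    using sums_finite[of "{..j}" "\<lambda>k. real (j choose k) * t ^ k"] by (simp add: binomial_eq_0)
qed

lemma sums_shift_mult:
  fixes t :: real
  assumes "(\<lambda>k. f k * t ^ k) sums S"
  shows "(\<lambda>k. (if k = 0 then 0 else f (k - 1)) * t ^ k) sums (t * S)"
proof -
  have "(\<lambda>k. t * (f k * t ^ k)) sums (t * S)"
    using assms by (rule sums_mult)
  then show ?thesis
    by (subst sums_Suc_iff[symmetric, where f = "\<lambda>k. (if k = 0 then 0 else f (k - 1)) * t ^ k", simplified])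
      (simp add: mult_ac)
qed

text \<open>
  Write \<open>2 * r = j + s\<close> with \<open>s\<close> the fractional part: up to a tail with coefficients at most
  \<open>1/8\<close>, the series is dominated by the interpolant \<open>(1 + t) ^ j * (1 + s * t)\<close>.
\<close>

lemma abs_gbinomial_series_less:
  fixes t r :: real
  assumes t: "0 < t" "t < 1" and r: "r > 0"
  shows "(\<Sum>k. \<bar>(2 * r) gchoose k\<bar> * t ^ k) < (1 + t) powr r * (1 + powr_slope r * (t / (1 - t)))"
proof -
  define j where "j = nat \<lfloor>2 * r\<rfloor>"
  define s where "s = 2 * r - real j"
  have s: "0 \<le> s" "s \<le> 1"
    using r unfolding s_def j_def by linarith+
  have rs: "2 * r = real j + s" by (simp add: s_def)
  let ?f = "\<lambda>k. \<bar>(2 * r) gchoose k\<bar> * t ^ k"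
  let ?g = "\<lambda>k. real (j choose k) * t ^ k + s * ((if k = 0 then 0 else real (j choose (k - 1))) * t ^ k)
      + 1/8 * ((if k = 0 then 0 else 1) * t ^ k)"
  have geo: "(\<lambda>k. 1 * t ^ k) sums (1 / (1 - t))"
    using geometric_sums[of t] t by simp
  have g: "?g sums ((1 + t) ^ j + s * (t * (1 + t) ^ j) + 1/8 * (t * (1 / (1 - t))))"
    by (intro sums_add sums_mult binomial_sums sums_shift_mult geo)
  have fg: "?f k \<le> ?g k" for k
    using mult_right_mono[OF abs_gbinomial_le[OF s, of j k], of "t ^ k"] t
    by (simp only: rs) (auto simp: algebra_simps)
  have sf: "summable ?f"
    by (rule summable_comparison_test'[OF sums_summable[OF g], of 0]) (use fg t in auto)
  have le: "(\<Sum>k. ?f k) \<le> (1 + t) ^ j * (1 + s * t) + t / (8 * (1 - t))"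
    using sums_le[OF fg summable_sums[OF sf] g] by (simp add: algebra_simps)
  have p1: "1 < (1 + t) powr r"
    using t r by simp
  show "(\<Sum>k. ?f k) < (1 + t) powr r * (1 + powr_slope r * (t / (1 - t)))"
  \<comment> \<open>For j = 0 the slope may lie below 5/4, where the estimate of the other case
    breaks down. There 2 r is at most 1, all coefficients have modulus at most 1, and the geometric
    series suffices.\<close>
  proof (cases "j = 0")
    case True
    have "(\<Sum>k. ?f k) \<le> (\<Sum>k. t ^ k)"
    proof (intro suminf_le sf summable_geometric)
      fix k show "?f k \<le> t ^ k"
      proof -
        consider "k = 0" | "k = 1" | "k \<ge> 2" by linarith
        then have "\<bar>(2 * r) gchoose k\<bar> \<le> 1"
          using abs_gbinomial_frac_tail[OF s, of j k] s r True rs by cases auto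
        then show ?thesis
          using t mult_right_mono[of _ 1 "t ^ k"] by fastforce
      qed
    qed (use t in auto)
    also have "\<dots> = 1 + t / (1 - t)"
      using t by (simp add: suminf_geometric divide_simps)
    also have "\<dots> < 1 + powr_slope r * (t / (1 - t))"
      using powr_slope_gt_1[of r] r t by (simp add: divide_simps)
    also have "\<dots> \<le> (1 + t) powr r * (1 + powr_slope r * (t / (1 - t)))"
      using mult_right_mono[of 1 "(1 + t) powr r" "1 + powr_slope r * (t / (1 - t))"]
        p1 powr_slope_gt_1[of r] r t by simp
    finally show ?thesis .
  next
    case False
    then have "r \<ge> 1/2" using rs s by (cases j) auto
    define q where "q = powr_slope r"
    have q: "5/4 < q" using powr_slope_gt_5_4[OF \<open>r \<ge> 1/2\<close>] by (simp add: q_def)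
    define x where "x = (1 + t) powr r"
    \<comment> \<open>One factor x stays in front as the x of the claim; the other is joined to 1 -
      t and replaced by the bound of \<open>one_minus_times_powr_le_slope\<close>.\<close>
    have xx: "x * x = (1 + t) ^ j * (1 + t) powr s"
      using t rs by (simp add: x_def powr_add[symmetric] powr_realpow[symmetric] mult_2[symmetric])
    have "(1 + t) ^ j * (1 + s * t) \<le> (1 + t) ^ j * ((1 + t) powr s * (1 + t / 8))"
      using one_add_mult_le_powr[OF s, of t] t by (intro mult_left_mono) auto
    also have "\<dots> = x * x * (1 + t / 8)"
      by (simp add: xx)
    finally have "(1 - t) * (\<Sum>k. ?f k) \<le> (1 - t) * (x * x * (1 + t / 8) + t / (8 * (1 - t)))"
      using le t by (intro mult_left_mono) auto
    also have "\<dots> = x * (((1 - t) * x) * (1 + t / 8)) + t / 8"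
      using t by (simp add: field_simps)
    also have "\<dots> \<le> x * ((1 + (4/5 * q - 1) * t) * (1 + t / 8)) + x * (t / 8)"
      using one_minus_times_powr_le_slope[of t r] t r less_imp_le[OF p1]
      by (intro add_mono mult_left_mono mult_right_mono) (auto simp: x_def q_def)
    also have "\<dots> = x * (1 + (4/5 * q - 3/4) * t + (4/5 * q - 1) * (t * t) / 8)"
      by (simp add: field_simps)
    also have "\<dots> < x * (1 + (q - 1) * t)"
    proof -
      \<comment> \<open>Once t^2 is replaced by t, the remaining condition is 9/10 q - 7/8 < q - 1,
        that is q > 5/4.\<close>
      have "(4/5 * q - 1) * (t * t) / 8 \<le> (4/5 * q - 1) * t / 8"
        using q t mult_left_mono[of "t * t" t "4/5 * q - 1"] mult_left_mono[of t 1 t] by simp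
      moreover have "(4/5 * q - 3/4 + (4/5 * q - 1) / 8) * t < (q - 1) * t"
        using q t by (intro mult_strict_right_mono) (auto simp: field_simps)
      ultimately have "(4/5 * q - 3/4) * t + (4/5 * q - 1) * (t * t) / 8 < (q - 1) * t"
        by (simp add: field_simps)
      then show ?thesis
        using p1 by (intro mult_strict_left_mono) (auto simp: x_def)
    qed
    also have "\<dots> = (1 - t) * (x * (1 + q * (t / (1 - t))))"
      using t by (simp add: field_simps)
    finally show ?thesis
      using t by (simp add: x_def q_def)
  qed
qed

text \<open>For a <= 0 the k-th coefficient has the sign of (-1)^k or vanishes, so taking moduli
  amounts to evaluating the binomial series at - t.\<close>

lemma abs_gbinomial_series_neg:
  fixes t a :: real
  assumes t: "0 \<le> t" "t < 1" and a: "a \<le> 0"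
  shows "(\<lambda>k. \<bar>a gchoose k\<bar> * t ^ k) sums (1 - t) powr a"
proof -
  have "\<bar>a gchoose k\<bar> = (a gchoose k) * (- 1) ^ k" for k
  proof -
    have "(a gchoose k) * (- 1) ^ k = (real k - a - 1) gchoose k"
      using gbinomial_negated_upper[of a k] by (simp add: power_mult_distrib[symmetric])
    moreover have "0 \<le> (real k - a - 1) gchoose k"
      using a by (intro gbinomial_nonneg_of_le) auto
    ultimately show ?thesis
      by (metis abs_mult abs_of_nonneg abs_power_minus abs_one mult.right_neutral power_one)
  qed
  then show ?thesis
    using gen_binomial_real[of "-t" a] t by (simp add: power_minus[of t] mult_ac)
qed

section \<open>Gamma function estimates\<close>

lemma Gamma_duplication_real:
  fixes z :: real
  assumes "z > 0"
  shows "Gamma z * Gamma (z + 1/2) = 2 powr (1 - 2 * z) * sqrt pi * Gamma (2 * z)"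
proof -
  have notin: "of_real x \<notin> (\<int>\<^sub>\<le>\<^sub>0 :: complex set)" if "x > 0" for x :: real
    using that by (metis nonpos_Ints_nonpos of_real_in_nonpos_Ints_iff not_less)
  have "Gamma (of_real z :: complex) * Gamma (of_real z + 1/2) =
      exp ((1 - 2 * of_real z) * of_real (ln 2)) * of_real (sqrt pi) * Gamma (2 * of_real z)"
    using notin[of z] notin[of "z + 1/2"] assms by (intro Gamma_legendre_duplication) auto
  then have "of_real (Gamma z * Gamma (z + 1/2)) =
      (of_real (exp ((1 - 2 * z) * ln 2) * sqrt pi * Gamma (2 * z)) :: complex)"
    by (simp add: Gamma_complex_of_real[symmetric] exp_of_real[symmetric])
  then show ?thesis
    unfolding of_real_eq_iff by (simp add: powr_def)
qed

text \<open>Midpoint log-convexity of Gamma between x and x + 1, combined with Gamma (x + 1) = x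
  Gamma x.\<close>

lemma Gamma_sq_le:
  fixes x :: real
  assumes "x > 0"
  shows "(Gamma (x + 1/2))\<^sup>2 \<le> x * (Gamma x)\<^sup>2"
proof -
  have "(ln \<circ> Gamma) (x + 1/2) \<le> 1/2 * (ln \<circ> Gamma) x + 1/2 * (ln \<circ> Gamma) (x + 1)"
    using convex_onD[OF log_convex_Gamma_real, of "1/2" x "x + 1"] assms by (simp add: field_simps)
  then have "2 * ln (Gamma (x + 1/2)) \<le> ln (Gamma x) + ln (x * Gamma x)"
    using Gamma_plus1[of x] assms by (auto simp: nonpos_Ints_def)
  also have "\<dots> = ln (x * (Gamma x)\<^sup>2)"
    using assms Gamma_real_pos[of x] by (simp add: ln_mult power2_eq_square)
  finally have "ln ((Gamma (x + 1/2))\<^sup>2) \<le> ln (x * (Gamma x)\<^sup>2)"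
    using assms Gamma_real_pos[of "x + 1/2"] by (simp add: ln_realpow)
  then show ?thesis
    using assms Gamma_real_pos[of x] Gamma_real_pos[of "x + 1/2"]
    by (subst (asm) ln_le_cancel_iff) (auto simp: less_imp_neq[symmetric] intro!: mult_pos_pos)
qed

text \<open>With x = \<alpha> + 1, g = Gamma x and h = Gamma (x + 1/2), duplication turns Gamma (2
  x) into g h up to elementary factors. Squaring reduces the claim to 49 sqrt pi h <= 2 g (x + 6)^2,
  and h <= sqrt x g reduces this to the inequality \<open>poly\<close>.\<close>

lemma powr_slope_le_Gamma:
  fixes \<alpha> :: real
  assumes "\<alpha> > -1"
  shows "sqrt pi / 2 powr (2 * \<alpha>) * powr_slope (\<alpha> + 1/2)
    \<le> Gamma (\<alpha> + 1) / sqrt (Gamma (2 * \<alpha> + 2)) * (2 * sqrt 2)"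
proof -
  define x where "x = \<alpha> + 1"
  have x: "x > 0" using assms by (simp add: x_def)
  define P where "P = (2::real) powr \<alpha>"
  have P: "P > 0" by (simp add: P_def)
  have P2: "2 powr (2 * \<alpha>) = P\<^sup>2" by (simp add: P_def power2_eq_square powr_add[symmetric])
  define g h where "g = Gamma x" and "h = Gamma (x + 1/2)"
  have gh: "g > 0" "h > 0" using x by (simp_all add: g_def h_def Gamma_real_pos)
  have "g * h = 2 powr (1 - 2 * x) * sqrt pi * Gamma (2 * x)"
    using Gamma_duplication_real[OF x] by (simp add: g_def h_def)
  also have "2 powr (1 - 2 * x) = 1 / (2 * P\<^sup>2)"
    by (simp add: P2[symmetric] x_def powr_diff powr_add algebra_simps)
  finally have dup: "Gamma (2 * x) = 2 * P\<^sup>2 * g * h / sqrt pi"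
    using P by (simp add: field_simps)
  have sq: "h\<^sup>2 \<le> x * g\<^sup>2"
    using Gamma_sq_le[OF x] by (simp add: g_def h_def)
  have poly: "pi * x \<le> 4 * (x + 6)^4 / 2401"
  proof -
    have "0 \<le> (x - 2)\<^sup>2 * (x\<^sup>2 + 28 * x + 324)"
      using x by (intro mult_nonneg_nonneg add_nonneg_nonneg) auto
    also have "\<dots> = (x + 6)^4 - 2048 * x"
      by (simp add: power2_eq_square power4_eq_xxxx algebra_simps)
    finally have "8192 * x / 2401 \<le> 4 * (x + 6)^4 / 2401" by simp
    moreover have "pi * x \<le> 8192 / 2401 * x"
      using pi_approx(2) x by (intro mult_right_mono) auto
    ultimately show ?thesis by simp
  qed
  have "sqrt (pi * x) \<le> 2 * (x + 6)\<^sup>2 / 49"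
    by (rule real_le_lsqrt) (use poly x in \<open>auto simp: power_divide power_mult_distrib power2_eq_square power4_eq_xxxx\<close>)
  then have s: "sqrt pi * sqrt x \<le> 2 * (x + 6)\<^sup>2 / 49"
    by (simp add: real_sqrt_mult)
  have hg: "h \<le> sqrt x * g"
    using sq gh x real_le_rsqrt[of h "x * g\<^sup>2"] by (simp add: real_sqrt_mult)
  have "sqrt pi / P\<^sup>2 * (7 * (P * sqrt 2) / (x + 6)) \<le> g / sqrt (Gamma (2 * x)) * (2 * sqrt 2)"
  proof (rule power2_le_imp_le)
    have "(sqrt pi / P\<^sup>2 * (7 * (P * sqrt 2) / (x + 6)))\<^sup>2 = 98 * pi / (P\<^sup>2 * (x + 6)\<^sup>2)"
    proof -
      have "(sqrt pi / P\<^sup>2 * (7 * (P * sqrt 2) / (x + 6))) = 7 * sqrt pi * sqrt 2 / (P * (x + 6))"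
        using P by (simp add: power2_eq_square)
      then show ?thesis by (simp add: power_mult_distrib power_divide)
    qed
    also have "\<dots> \<le> 4 * g * sqrt pi / (P\<^sup>2 * h)"
    proof -
      have "49 * sqrt pi * h \<le> 49 * sqrt pi * (sqrt x * g)"
        using hg by (intro mult_left_mono) auto
      also have "\<dots> = 49 * g * (sqrt pi * sqrt x)" by simp
      also have "\<dots> \<le> 49 * g * (2 * (x + 6)\<^sup>2 / 49)"
        using s gh by (intro mult_left_mono) auto
      finally have "49 * sqrt pi * h \<le> 2 * g * (x + 6)\<^sup>2" by simp
      then have "2 * sqrt pi * (49 * sqrt pi * h) \<le> 2 * sqrt pi * (2 * g * (x + 6)\<^sup>2)"
        by (intro mult_left_mono) auto
      moreover have "2 * sqrt pi * (49 * sqrt pi * h) = 98 * pi * h"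
        by simp
      ultimately have "98 * pi * h \<le> 4 * g * sqrt pi * (x + 6)\<^sup>2"
        by simp
      then show ?thesis
        using P gh x by (simp add: divide_simps mult_ac)
    qed
    also have "\<dots> = (g / sqrt (Gamma (2 * x)) * (2 * sqrt 2))\<^sup>2"
    proof -
      have "(g / sqrt (Gamma (2 * x)) * (2 * sqrt 2))\<^sup>2 = 8 * g\<^sup>2 / Gamma (2 * x)"
        using x by (simp add: power_mult_distrib power_divide Gamma_real_nonneg)
      also have "\<dots> = 4 * g * sqrt pi / (P\<^sup>2 * h)"
        unfolding dup using P gh by (simp add: field_simps power2_eq_square)
      finally show ?thesis by simp
    qed
    finally show "(sqrt pi / P\<^sup>2 * (7 * (P * sqrt 2) / (x + 6)))\<^sup>2 \<le> (g / sqrt (Gamma (2 * x)) * (2 * sqrt 2))\<^sup>2" .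
  qed (use gh x in \<open>auto intro!: mult_nonneg_nonneg divide_nonneg_nonneg Gamma_real_nonneg\<close>)
  moreover have "2 powr (\<alpha> + 1/2) = P * sqrt 2"
    by (simp add: P_def powr_add powr_half_sqrt)
  moreover have "\<alpha> + 1/2 + 13/2 = x + 6" "2 * \<alpha> + 2 = 2 * x" "\<alpha> + 1 = x"
    by (simp_all add: x_def)
  ultimately show ?thesis
    unfolding P2 powr_slope_def g_def by (simp only: mult.assoc)
qed

text \<open>
  The limit of \<open>\<rho> ^ (2 * n)\<close> times the bound on the remainder obtained from the Chebyshev expansion,
  for \<open>ellipse_max = 1\<close> and \<open>t = 1 / \<rho>\<^sup>2\<close>.
\<close>

definition gegenbauer_series :: "real \<Rightarrow> real \<Rightarrow> real" where
  "gegenbauer_series \<alpha> t = pi / 2 powr (2 * \<alpha>) * (\<Sum>k. \<bar>(2 * \<alpha> + 1) gchoose k\<bar> * t ^ k)"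

text \<open>Once the factor \<open>w\<close> is split off, a linear function of t / (1 - t) with
  slope \<open>powr_slope r\<close> separates the two sides; \<open>powr_slope_le_Gamma\<close> then
  replaces that slope by the Gamma quotient.\<close>

lemma gegenbauer_series_less:
  fixes \<alpha> \<rho> :: real
  assumes \<alpha>: "\<alpha> > -1" "\<alpha> \<noteq> -1/2" and \<rho>: "\<rho> > 1"
  shows "gegenbauer_series \<alpha> (1 / \<rho>\<^sup>2) <
     sqrt pi * (sqrt pi / 2 powr (2 * \<alpha>) +
                Gamma (\<alpha> + 1) / sqrt (Gamma (2 * \<alpha> + 2)) * (2 * sqrt 2 / (\<rho>\<^sup>2 - 1))) *
               (if \<alpha> > -1/2 then (1 + 1 / \<rho>\<^sup>2) powr (\<alpha> + 1/2)
                else (1 - 1 / \<rho>\<^sup>2) powr (\<alpha> + 1/2))"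
proof -
  define t where "t = 1 / \<rho>\<^sup>2"
  define r where "r = \<alpha> + 1/2"
  define S where "S = (\<Sum>k. \<bar>(2 * r) gchoose k\<bar> * t ^ k)"
  have \<rho>2: "\<rho>\<^sup>2 > 1" using \<rho> by (simp add: one_less_power)
  have "\<rho>\<^sup>2 > 0" using \<rho>2 by linarith
  then have t: "0 < t" "t < 1"
    unfolding t_def using \<rho>2 by (simp_all only: zero_less_divide_1_iff divide_less_eq_1_pos)
  have frac: "1 / (\<rho>\<^sup>2 - 1) = t / (1 - t)"
    using \<rho>2 \<open>\<rho>\<^sup>2 > 0\<close> by (auto simp: t_def field_simps)
  have e: "2 * sqrt 2 / (\<rho>\<^sup>2 - 1) = 2 * sqrt 2 * (t / (1 - t))"
    unfolding frac[symmetric] by simp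
  define w where "w = (if \<alpha> > -1/2 then (1 + t) powr r else (1 - t) powr r)"
  have w: "w > 0" using t by (simp add: w_def)
  have S: "S < w * (1 + powr_slope r * (t / (1 - t)))"
  proof (cases "\<alpha> > -1/2")
    case True
    then show ?thesis
      using abs_gbinomial_series_less[OF t, of r] by (simp add: S_def w_def r_def)
  next
    \<comment> \<open>Here r is negative and the series is the square of w. The second factor w is
      at most 1 - r t / (1 - t), and - r < 1/2 < \<open>powr_slope r\<close>.\<close>
    case False
    then have r: "-1/2 < r" "r < 0" using \<alpha> by (auto simp: r_def)
    have slope: "1/2 < powr_slope r"
    proof -
      have "2 powr (-1) \<le> (2::real) powr r" using r by (intro powr_mono) auto
      then show ?thesis using r by (simp add: powr_slope_def less_divide_eq)
    qed
    have "S = (1 - t) powr (2 * r)"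
      using abs_gbinomial_series_neg[of t "2 * r"] t r by (simp add: S_def sums_iff)
    also have "\<dots> = w * (1 - t) powr r"
      using False by (simp add: w_def powr_add[symmetric])
    also have "(1 - t) powr r = (1 + t / (1 - t)) powr (- r)"
    proof -
      have "1 + t / (1 - t) = inverse (1 - t)" using t by (simp add: field_simps)
      then show ?thesis using t by (simp add: powr_minus inverse_powr)
    qed
    also have "\<dots> \<le> 1 + (- r) * (t / (1 - t))"
      using r t by (intro one_add_powr_le) auto
    also have "w * (1 + (- r) * (t / (1 - t))) < w * (1 + powr_slope r * (t / (1 - t)))"
    proof -
      have "- r * (t / (1 - t)) < powr_slope r * (t / (1 - t))"
        using r slope t by (intro mult_strict_right_mono) auto
      then show ?thesis using w by simp
    qed
    finally show ?thesis using w by simp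
  qed
  have "gegenbauer_series \<alpha> t = pi / 2 powr (2 * \<alpha>) * S"
    by (simp add: gegenbauer_series_def S_def r_def algebra_simps)
  also have "\<dots> < pi / 2 powr (2 * \<alpha>) * (w * (1 + powr_slope r * (t / (1 - t))))"
    using S by (intro mult_strict_left_mono) auto
  also have "\<dots> = sqrt pi * (sqrt pi / 2 powr (2 * \<alpha>) +
      (sqrt pi / 2 powr (2 * \<alpha>) * powr_slope r) * (t / (1 - t))) * w"
    by (simp add: algebra_simps add_divide_distrib)
  also have "\<dots> \<le> sqrt pi * (sqrt pi / 2 powr (2 * \<alpha>) +
      (Gamma (\<alpha> + 1) / sqrt (Gamma (2 * \<alpha> + 2)) * (2 * sqrt 2)) * (t / (1 - t))) * w"
    using powr_slope_le_Gamma[OF \<alpha>(1)] t w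
    by (intro mult_right_mono mult_left_mono add_left_mono) (auto simp: r_def)
  finally show ?thesis
    unfolding e t_def[symmetric] r_def[symmetric] w_def[symmetric] by (simp only: mult.assoc)
qed

text \<open>At \<alpha> = 0 the binomial series is just 1 + t, so only sqrt (1 + t) has to be
  estimated. The slope 1/2 is smaller than the one in \<open>gegenbauer_series_less\<close>, so the
  bound does not follow from there.\<close>

lemma legendre_series_less:
  fixes \<rho> :: real
  assumes \<rho>: "\<rho> > 1"
  shows "gegenbauer_series 0 (1 / \<rho>\<^sup>2) < pi * sqrt (1 + 1 / \<rho>\<^sup>2) * (1 + 1 / (2 * (\<rho>\<^sup>2 - 1)))"
proof -
  define t where "t = 1 / \<rho>\<^sup>2"
  have \<rho>2: "\<rho>\<^sup>2 > 1" using \<rho> by (simp add: one_less_power)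
  have "\<rho>\<^sup>2 > 0" using \<rho>2 by linarith
  then have t: "0 < t" "t < 1"
    unfolding t_def using \<rho>2 by (simp_all only: zero_less_divide_1_iff divide_less_eq_1_pos)
  have frac: "1 / (2 * (\<rho>\<^sup>2 - 1)) = t / (2 * (1 - t))"
    using \<rho>2 \<open>\<rho>\<^sup>2 > 0\<close> by (auto simp: t_def field_simps)
  have "(\<lambda>k. \<bar>real (1 choose k)\<bar> * t ^ k) sums (1 + t) ^ 1"
    using binomial_sums[of 1 t] by simp
  moreover have "real (1 choose k) = 1 gchoose k" for k
    using binomial_gbinomial[of 1 k, where ?'a = real] by simp
  ultimately have "gegenbauer_series 0 t = pi * (1 + t)"
    by (simp only: gegenbauer_series_def sums_iff) simp
  also have "\<dots> = pi * (sqrt (1 + t) * sqrt (1 + t))"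
    using t by simp
  also have "\<dots> < pi * (sqrt (1 + t) * (1 + t / (2 * (1 - t))))"
  proof -
    have "sqrt (1 + t) \<le> 1 + 1/2 * t"
      using one_add_powr_le[of t "1/2"] t by (simp add: powr_half_sqrt)
    also have "\<dots> < 1 + t / (2 * (1 - t))"
      using t by (simp add: field_simps)
    finally show ?thesis using t by (intro mult_strict_left_mono) auto
  qed
  finally show ?thesis
    unfolding frac t_def[symmetric] by (simp only: mult.assoc)
qed

subsection \<open>Chebyshev polynomials\<close>

fun chebT :: "nat \<Rightarrow> real poly" where
  "chebT 0 = 1"
| "chebT (Suc 0) = [:0, 1:]"
| "chebT (Suc (Suc n)) = [:0, 2:] * chebT (Suc n) - chebT n"

fun chebU :: "nat \<Rightarrow> real poly" where
  "chebU 0 = 1"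
| "chebU (Suc 0) = [:0, 2:]"
| "chebU (Suc (Suc n)) = [:0, 2:] * chebU (Suc n) - chebU n"

lemma poly_chebT_Suc_Suc:
  "poly (chebT (Suc (Suc n))) x = 2 * x * poly (chebT (Suc n)) x - poly (chebT n) x"
  by (simp add: mult_ac)

lemma poly_chebU_Suc_Suc:
  "poly (chebU (Suc (Suc n))) x = 2 * x * poly (chebU (Suc n)) x - poly (chebU n) x"
  by (simp add: mult_ac)

declare chebT.simps(3) [simp del] chebU.simps(3) [simp del]

lemma poly_chebT_cos: "poly (chebT n) (cos \<theta>) = cos (real n * \<theta>)"
proof (induction n rule: chebT.induct)
  case (3 n)
  have "cos (real (Suc (Suc n)) * \<theta>) + cos (real n * \<theta>) = 2 * cos \<theta> * cos (real (Suc n) * \<theta>)"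
    using cos_plus_cos[of "real (Suc (Suc n)) * \<theta>" "real n * \<theta>"] by (simp add: algebra_simps add_divide_distrib)
  then show ?case
    using 3 by (simp add: poly_chebT_Suc_Suc)
qed simp_all

lemma abs_poly_chebT_le_1:
  assumes "x \<in> {-1..1}"
  shows "\<bar>poly (chebT n) x\<bar> \<le> 1"
proof -
  have "x = cos (arccos x)" using assms by simp
  then show ?thesis by (metis poly_chebT_cos abs_cos_le_one)
qed

lemma poly_eqI_on_unit_interval:
  fixes p q :: "real poly"
  assumes "\<And>x. x \<in> {-1..1} \<Longrightarrow> poly p x = poly q x"
  shows "p = q"
proof (rule ccontr)
  assume "p \<noteq> q"
  then have "finite {x. poly (p - q) x = 0}"
    by (intro poly_roots_finite) simp
  moreover have "{-1..1} \<subseteq> {x. poly (p - q) x = 0}"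
    using assms by auto
  ultimately have "finite {-1..1::real}" by (rule rev_finite_subset)
  then show False using infinite_Icc[of "-1" "1::real"] by simp
qed

text \<open>The product-to-sum formula of the cosine, read at x = cos \<theta>.\<close>

lemma chebT_mult_chebT:
  assumes "j \<le> m"
  shows "smult 2 (chebT m * chebT j) = chebT (m + j) + chebT (m - j)"
proof (rule poly_eqI_on_unit_interval)
  fix x :: real assume "x \<in> {-1..1}"
  then have x: "x = cos (arccos x)" by simp
  define \<theta> where "\<theta> = arccos x"
  have "cos (real (m + j) * \<theta>) + cos (real (m - j) * \<theta>) = 2 * (cos (real m * \<theta>) * cos (real j * \<theta>))"
    using assms by (simp add: of_nat_diff algebra_simps cos_add cos_diff)
  then show "poly (smult 2 (chebT m * chebT j)) x = poly (chebT (m + j) + chebT (m - j)) x"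
    by (subst (1 2) x) (simp add: poly_chebT_cos \<theta>_def)
qed

text \<open>The leading coefficient of \<open>chebT\<close> is stated at successor indices because
  2^(n-1) does not fit the constant polynomial.\<close>

lemma degree_chebT_aux:
  "degree (chebT n) \<le> n \<and> coeff (chebT (Suc n)) (Suc n) = 2 ^ n \<and> coeff (chebU n) n = 2 ^ n \<and> degree (chebU n) \<le> n"
proof (induction n rule: less_induct)
  case (less n)
  consider "n = 0" | "n = 1" | m where "n = Suc (Suc m)"
    by (metis One_nat_def not0_implies_Suc)
  then show ?case
  proof cases
    case 1
    then show ?thesis by simp
  next
    case 2
    then show ?thesis by (simp add: chebT.simps(3) one_pCons)
  next
    case 3
    have *: "degree (chebT m) \<le> m" "degree (chebT (Suc m)) \<le> Suc m" "degree (chebU m) \<le> m"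
      "degree (chebU (Suc m)) \<le> Suc m" "coeff (chebU (Suc m)) (Suc m) = 2 ^ Suc m"
      "coeff (chebT (Suc (Suc m))) (Suc (Suc m)) = 2 ^ Suc m"
      using less.IH[of m] less.IH[of "Suc m"] 3 by auto
    have d: "degree ([:0, 2:] * p) \<le> Suc (Suc m)" if "degree p \<le> Suc m" for p :: "real poly"
      using degree_mult_le[of "[:0, 2:]" p] that by simp
    have c: "coeff (chebT (Suc m)) (Suc (Suc (Suc m))) = 0" "coeff (chebU m) (Suc (Suc m)) = 0"
      using * by (auto intro!: coeff_eq_0)
    show ?thesis
      unfolding 3
      using * d[OF *(2)] d[OF *(4)] c
      by (auto simp: chebT.simps(3)[of m] chebT.simps(3)[of "Suc m"] chebU.simps(3) intro!: degree_diff_le)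
  qed
qed

lemma coeff_chebT_Suc: "coeff (chebT (Suc n)) (Suc n) = 2 ^ n"
  and coeff_chebU: "coeff (chebU n) n = 2 ^ n"
  using degree_chebT_aux by auto

lemma degree_chebU: "degree (chebU n) = n"
  using degree_chebT_aux[of n] le_degree[of "chebU n" n] by simp

lemma degree_chebT: "degree (chebT n) = n"
proof (cases n)
  case (Suc m)
  then show ?thesis
    using degree_chebT_aux[of n] le_degree[of "chebT n" n] coeff_chebT_Suc[of m] by simp
qed simp

lemma chebT_altdef:
  "poly (chebU (Suc (Suc n))) x - poly (chebU n) x = 2 * poly (chebT (Suc (Suc n))) x"
proof (induction n rule: chebT.induct)
  case 1
  show ?case by (simp add: poly_chebT_Suc_Suc poly_chebU_Suc_Suc)
next
  case 2
  show ?case by (simp add: poly_chebT_Suc_Suc poly_chebU_Suc_Suc algebra_simps)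
next
  case (3 n)
  have "poly (chebU (Suc (Suc (Suc (Suc n))))) x - poly (chebU (Suc (Suc n))) x =
      2 * x * (poly (chebU (Suc (Suc (Suc n)))) x - poly (chebU (Suc n)) x)
      - (poly (chebU (Suc (Suc n))) x - poly (chebU n) x)"
    by (simp add: poly_chebU_Suc_Suc[of "Suc (Suc n)"] poly_chebU_Suc_Suc[of n] algebra_simps)
  also have "\<dots> = 2 * poly (chebT (Suc (Suc (Suc (Suc n))))) x"
    unfolding 3 by (simp add: poly_chebT_Suc_Suc[of "Suc (Suc n)"])
  finally show ?case .
qed

lemma pderiv_chebT: "poly (pderiv (chebT (Suc n))) x = real (Suc n) * poly (chebU n) x"
proof (induction n rule: chebT.induct)
  case 1
  show ?case by (simp add: pderiv_pCons)
next
  case 2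
  show ?case by (simp add: chebT.simps(3) pderiv_diff pderiv_smult pderiv_pCons)
next
  case (3 n)
  have "poly (pderiv (chebT (Suc (Suc (Suc n))))) x =
      2 * poly (chebT (Suc (Suc n))) x + 2 * x * poly (pderiv (chebT (Suc (Suc n)))) x - poly (pderiv (chebT (Suc n))) x"
    by (subst chebT.simps(3)) (simp add: pderiv_diff pderiv_smult pderiv_pCons)
  also have "\<dots> = real (Suc (Suc (Suc n))) * poly (chebU (Suc (Suc n))) x"
    unfolding 3 chebT_altdef[symmetric] by (simp add: poly_chebU_Suc_Suc algebra_simps)
  finally show ?case .
qed

text \<open>At x = cos \<theta> this is the addition formula for cos (n \<theta>) = cos ((n + 1)
  \<theta> - \<theta>). It feeds the recursion for the derivative of \<open>chebU\<close>.\<close>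

lemma chebU_Pell: "(1 - x\<^sup>2) * poly (chebU n) x = poly (chebT n) x - x * poly (chebT (Suc n)) x"
proof (induction n rule: chebT.induct)
  case 1
  show ?case by (simp add: power2_eq_square)
next
  case 2
  show ?case by (simp add: poly_chebT_Suc_Suc power2_eq_square algebra_simps)
next
  case (3 n)
  have "(1 - x\<^sup>2) * poly (chebU (Suc (Suc n))) x =
      2 * x * ((1 - x\<^sup>2) * poly (chebU (Suc n)) x) - (1 - x\<^sup>2) * poly (chebU n) x"
    by (simp add: poly_chebU_Suc_Suc algebra_simps)
  then show ?case
    unfolding 3 by (simp add: poly_chebT_Suc_Suc algebra_simps)
qed

lemma pderiv_chebU:
  "(1 - x\<^sup>2) * poly (pderiv (chebU n)) x = x * poly (chebU n) x - real (Suc n) * poly (chebT (Suc n)) x"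
proof (induction n rule: chebT.induct)
  case 1
  show ?case by simp
next
  case 2
  show ?case by (simp add: pderiv_pCons poly_chebT_Suc_Suc power2_eq_square algebra_simps)
next
  case (3 n)
  have "(1 - x\<^sup>2) * poly (pderiv (chebU (Suc (Suc n)))) x =
      2 * ((1 - x\<^sup>2) * poly (chebU (Suc n)) x) + 2 * x * ((1 - x\<^sup>2) * poly (pderiv (chebU (Suc n))) x)
      - (1 - x\<^sup>2) * poly (pderiv (chebU n)) x"
    by (subst chebU.simps(3)) (simp add: pderiv_diff pderiv_smult pderiv_pCons algebra_simps)
  then show ?case
    unfolding 3 chebU_Pell
    by (simp add: poly_chebT_Suc_Suc poly_chebU_Suc_Suc algebra_simps)
qed

lemma chebT_ode:
  "(1 - x\<^sup>2) * poly (pderiv (pderiv (chebT n))) x - x * poly (pderiv (chebT n)) x + (real n)\<^sup>2 * poly (chebT n) x = 0"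
proof (cases n)
  case (Suc m)
  have "pderiv (chebT (Suc m)) = smult (real (Suc m)) (chebU m)"
    by (rule poly_ext) (simp add: pderiv_chebT)
  then have "poly (pderiv (pderiv (chebT n))) x = real (Suc m) * poly (pderiv (chebU m)) x"
    by (simp add: Suc pderiv_smult)
  then have "(1 - x\<^sup>2) * poly (pderiv (pderiv (chebT n))) x = real (Suc m) * ((1 - x\<^sup>2) * poly (pderiv (chebU m)) x)"
    by simp
  then show ?thesis
    unfolding pderiv_chebU by (simp add: Suc pderiv_chebT power2_eq_square algebra_simps)
qed simp

section \<open>Polynomial bases and the Gegenbauer differential operator\<close>

lemma poly_basis_expansion:
  fixes B :: "nat \<Rightarrow> 'a::field poly"
  assumes B: "\<And>j. degree (B j) = j" "B 0 \<noteq> 0"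
  shows "degree p < N \<Longrightarrow> \<exists>g. p = (\<Sum>j<N. smult (g j) (B j))"
proof (induction N arbitrary: p)
  case 0
  then show ?case by simp
next
  case (Suc N)
  have lead: "coeff (B N) N \<noteq> 0"
    using B by (metis degree_0 leading_coeff_0_iff)
  define q where "q = p - smult (coeff p N / coeff (B N) N) (B N)"
  have c0: "coeff q i = 0" if "i \<ge> N" for i
    using that Suc.prems lead B(1)[of N] by (cases "i = N") (auto simp: q_def coeff_eq_0)
  show ?case
  proof (cases "N = 0")
    case True
    then have "q = 0" using c0 by (intro poly_eqI) simp
    then show ?thesis using True by (intro exI[of _ "\<lambda>_. coeff p N / coeff (B N) N"]) (simp add: q_def)
  next
    case False
    have "degree q < N"
    proof (cases "q = 0")
      case False
      then show ?thesis using c0[of "degree q"] by (metis leading_coeff_0_iff not_le_imp_less)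
    qed (use False in simp)
    then obtain g where g: "q = (\<Sum>j<N. smult (g j) (B j))"
      using Suc.IH by blast
    have "p = (\<Sum>j<Suc N. smult ((g(N := coeff p N / coeff (B N) N)) j) (B j))"
      using g by (simp add: q_def algebra_simps)
    then show ?thesis by blast
  qed
qed

lemma poly_basis_independent:
  fixes B :: "nat \<Rightarrow> 'a::field poly"
  assumes B: "\<And>j. degree (B j) = j" "B 0 \<noteq> 0"
  shows "(\<Sum>j<N. smult (c j) (B j)) = 0 \<Longrightarrow> j < N \<Longrightarrow> c j = 0"
proof (induction N arbitrary: j)
  case 0
  then show ?case by simp
next
  case (Suc N)
  have lead: "coeff (B N) N \<noteq> 0"
    using B by (metis degree_0 leading_coeff_0_iff)
  have "coeff (\<Sum>j<Suc N. smult (c j) (B j)) N = c N * coeff (B N) N"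
    using B by (simp add: coeff_sum coeff_eq_0)
  then have cN: "c N = 0" using Suc.prems(1) lead by (metis coeff_0 mult_eq_0_iff)
  then show ?case using Suc by (cases "j = N") auto
qed

text \<open>The operator in Sturm-Liouville form: its product with the weight (1 - x^2)^\<alpha> is
  the derivative of (1 - x^2)^(\<alpha> + 1) f'.\<close>

definition gegenbauer_op :: "real \<Rightarrow> real poly \<Rightarrow> real poly" where
  "gegenbauer_op \<alpha> f = [:1, 0, -1:] * pderiv (pderiv f) - smult (2 * \<alpha> + 2) ([:0, 1:] * pderiv f)"

lemma poly_gegenbauer_op:
  "poly (gegenbauer_op \<alpha> f) x =
    (1 - x\<^sup>2) * poly (pderiv (pderiv f)) x - (2 * \<alpha> + 2) * (x * poly (pderiv f) x)"
  by (simp add: gegenbauer_op_def power2_eq_square algebra_simps)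

lemma gegenbauer_inner_add_right:
  assumes "\<alpha> > -1"
  shows "gegenbauer_inner \<alpha> r (p + q) = gegenbauer_inner \<alpha> r p + gegenbauer_inner \<alpha> r q"
  using gegenbauer_inner_add[OF assms, of p q r] by (simp add: gegenbauer_inner_commute)

lemma gegenbauer_inner_smult_right:
  "gegenbauer_inner \<alpha> r (smult c p) = c * gegenbauer_inner \<alpha> r p"
  using gegenbauer_inner_smult[of \<alpha> c p r] by (simp add: gegenbauer_inner_commute)

lemma gegenbauer_inner_diff_right:
  assumes "\<alpha> > -1"
  shows "gegenbauer_inner \<alpha> r (p - q) = gegenbauer_inner \<alpha> r p - gegenbauer_inner \<alpha> r q"
  using gegenbauer_inner_diff[OF assms, of p q r] by (simp add: gegenbauer_inner_commute)

lemma gegenbauer_inner_mult_1: "gegenbauer_inner \<alpha> (p * q) 1 = gegenbauer_inner \<alpha> p q"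
  by (simp add: gegenbauer_inner_def)

text \<open>The integrand is the derivative of (1 - x^2)^(\<alpha> + 1) F, which vanishes at both
  endpoints as \<alpha> + 1 > 0. Differentiability is used in the open interval only, since the
  weight may be unbounded at the endpoints.\<close>

lemma gegenbauer_integration_by_parts:
  assumes \<alpha>: "\<alpha> > -1"
  shows "gegenbauer_inner \<alpha> ([:1, 0, -1:] * pderiv F - smult (2 * \<alpha> + 2) ([:0, 1:] * F)) 1 = 0"
proof -
  define G where "G = (\<lambda>x::real. (1 - x\<^sup>2) powr (\<alpha> + 1) * poly F x)"
  define D where "D = (\<lambda>x. poly ([:1, 0, -1:] * pderiv F - smult (2 * \<alpha> + 2) ([:0, 1:] * F)) x * gegenbauer_weight \<alpha> x)"
  have sq: "x\<^sup>2 \<le> 1" if "x \<in> {-1..1}" for x :: real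
    using that by (simp add: abs_square_le_1 abs_le_iff)
  have "(D has_integral G 1 - G (-1)) {-1..1}"
  proof (rule fundamental_theorem_of_calculus_interior)
    show "continuous_on {-1..1} G"
      unfolding G_def using \<alpha> sq by (intro continuous_intros continuous_on_powr') auto
  next
    fix x :: real assume x: "x \<in> {-1<..<1}"
    then have x2: "x\<^sup>2 < 1"
      by (simp add: abs_square_less_1 abs_less_iff)
    have "((\<lambda>x. (1 - x\<^sup>2) powr (\<alpha> + 1)) has_real_derivative ((\<alpha> + 1) * (1 - x\<^sup>2) powr \<alpha> * (- 2 * x))) (at x)"
      using x2 by (auto intro!: derivative_eq_intros simp: powr_diff field_simps)
    then have "(G has_real_derivative ((1 - x\<^sup>2) powr (\<alpha> + 1) * poly (pderiv F) x +
        (\<alpha> + 1) * (1 - x\<^sup>2) powr \<alpha> * (- 2 * x) * poly F x)) (at x)"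
      unfolding G_def by (rule DERIV_cong[OF DERIV_mult[OF _ poly_DERIV]]) (simp add: algebra_simps)
    also have "(1 - x\<^sup>2) powr (\<alpha> + 1) = (1 - x\<^sup>2) * (1 - x\<^sup>2) powr \<alpha>"
      using x2 by (simp add: powr_add)
    also have "(1 - x\<^sup>2) * (1 - x\<^sup>2) powr \<alpha> * poly (pderiv F) x +
        (\<alpha> + 1) * (1 - x\<^sup>2) powr \<alpha> * (- 2 * x) * poly F x = D x"
      by (simp add: D_def gegenbauer_weight_def power2_eq_square algebra_simps)
    finally show "(G has_vector_derivative D x) (at x)"
      by (simp add: has_real_derivative_iff_has_vector_derivative)
  qed simp
  then have "(D has_integral 0) {-1<..<1}"
    by (simp add: G_def has_integral_Icc_iff_Ioo)
  moreover have "set_integrable lborel {-1<..<1} D"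
    unfolding D_def by (rule set_integrable_poly_gegenbauer_weight[OF \<alpha>])
  ultimately have "(LINT x:{-1<..<1}|lborel. D x) = 0"
    using set_borel_integral_eq_integral(2) by (metis integral_unique)
  then show ?thesis
    by (simp add: gegenbauer_inner_def D_def)
qed

text \<open>Integration by parts for the Wronskian f' g - f g'.\<close>

lemma gegenbauer_op_symmetric:
  assumes \<alpha>: "\<alpha> > -1"
  shows "gegenbauer_inner \<alpha> (gegenbauer_op \<alpha> f) g = gegenbauer_inner \<alpha> f (gegenbauer_op \<alpha> g)"
proof -
  define F where "F = pderiv f * g - f * pderiv g"
  have "[:1, 0, -1:] * pderiv F - smult (2 * \<alpha> + 2) ([:0, 1:] * F) =
      gegenbauer_op \<alpha> f * g - f * gegenbauer_op \<alpha> g"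
    by (rule poly_ext) (simp add: F_def poly_gegenbauer_op pderiv_diff pderiv_mult power2_eq_square algebra_simps)
  with gegenbauer_integration_by_parts[OF \<alpha>, of F] show ?thesis
    by (simp only: gegenbauer_inner_diff[OF \<alpha>] gegenbauer_inner_mult_1 right_minus_eq)
qed

lemma gegenbauer_inner_Suc_weight:
  "gegenbauer_inner (\<alpha> + 1) f g = gegenbauer_inner \<alpha> ([:1, 0, -1:] * f) g"
proof -
  have eq: "gegenbauer_weight (\<alpha> + 1) x = (1 - x\<^sup>2) * gegenbauer_weight \<alpha> x" if "x \<in> {-1<..<1}" for x
  proof -
    have "x\<^sup>2 < 1" using that by (simp add: abs_square_less_1 abs_less_iff)
    then show ?thesis by (simp add: gegenbauer_weight_def powr_add)
  qed
  show ?thesis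
    unfolding gegenbauer_inner_def
  proof (intro set_lebesgue_integral_cong allI impI)
    fix x :: real assume x: "x \<in> {-1<..<1}"
    show "poly (f * g) x * gegenbauer_weight (\<alpha> + 1) x =
        poly ([:1, 0, -1:] * f * g) x * gegenbauer_weight \<alpha> x"
      unfolding eq[OF x] by (simp add: power2_eq_square algebra_simps)
  qed simp
qed

text \<open>Integration by parts for F = f' g. It trades derivatives for a weight parameter raised
  by one, the mechanism of the norm computation.\<close>

lemma gegenbauer_inner_pderiv:
  assumes \<alpha>: "\<alpha> > -1"
  shows "gegenbauer_inner (\<alpha> + 1) (pderiv f) (pderiv g) = - gegenbauer_inner \<alpha> (gegenbauer_op \<alpha> f) g"
proof -
  define F where "F = pderiv f * g"
  have "[:1, 0, -1:] * pderiv F - smult (2 * \<alpha> + 2) ([:0, 1:] * F) =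
      gegenbauer_op \<alpha> f * g + ([:1, 0, -1:] * pderiv f) * pderiv g"
    by (rule poly_ext) (simp add: F_def poly_gegenbauer_op pderiv_mult power2_eq_square algebra_simps)
  with gegenbauer_integration_by_parts[OF \<alpha>, of F] show ?thesis
    by (simp only: gegenbauer_inner_add[OF \<alpha>] gegenbauer_inner_mult_1 gegenbauer_inner_Suc_weight add_eq_0_iff)
qed

text \<open>No normalization is imposed, so that the notion passes to nonzero multiples and, with
  parameter \<alpha> + 1, to derivatives.\<close>

definition gegenbauer_orthopoly :: "real \<Rightarrow> nat \<Rightarrow> real poly \<Rightarrow> bool" where
  "gegenbauer_orthopoly \<alpha> n p \<longleftrightarrow> degree p = n \<and> p \<noteq> 0 \<and> (\<forall>q. degree q < n \<longrightarrow> gegenbauer_inner \<alpha> p q = 0)"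

lemma degree_gegenbauer_op_le: "degree (gegenbauer_op \<alpha> f) \<le> degree f"
proof -
  have 1: "degree ([:1, 0, -1:] * pderiv (pderiv f)) \<le> degree f"
  proof (cases "degree f < 2")
    case True
    then have "pderiv (pderiv f) = 0"
      by (simp add: pderiv_eq_0_iff degree_pderiv)
    then show ?thesis by simp
  next
    case False
    then show ?thesis
      using degree_mult_le[of "[:1, 0, -1:]" "pderiv (pderiv f)"] by (simp add: degree_pderiv)
  qed
  have 2: "degree ([:0, 1:] * pderiv f) \<le> degree f"
  proof (cases "degree f = 0")
    case True
    then have "pderiv f = 0" by (simp add: pderiv_eq_0_iff)
    then show ?thesis by simp
  next
    case False
    then show ?thesis
      using degree_mult_le[of "[:0, 1:]" "pderiv f"] by (simp add: degree_pderiv)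
  qed
  show ?thesis
    unfolding gegenbauer_op_def
    by (intro degree_diff_le 1 order.trans[OF degree_smult_le 2])
qed

lemma coeff_gegenbauer_op_degree:
  assumes "degree f \<le> n"
  shows "coeff (gegenbauer_op \<alpha> f) n = - real n * (real n + 2 * \<alpha> + 1) * coeff f n"
proof -
  have z: "coeff f (Suc n) = 0" "coeff f (Suc (Suc n)) = 0"
    using assms by (auto intro!: coeff_eq_0)
  consider "n = 0" | "n = 1" | m where "n = Suc (Suc m)"
    by (metis One_nat_def not0_implies_Suc)
  then show ?thesis
    using z by cases (auto simp: gegenbauer_op_def coeff_pderiv algebra_simps)
qed

text \<open>The eigenvalue is chosen to cancel the leading coefficient, so the residue r has degree
  below n. By symmetry the inner product of r with itself is one of p with polynomials of degree
  below n, hence zero.\<close>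

lemma gegenbauer_orthopoly_eigen:
  assumes \<alpha>: "\<alpha> > -1" and p: "gegenbauer_orthopoly \<alpha> n p" and n: "n \<ge> 1"
  shows "gegenbauer_op \<alpha> p = smult (- real n * (real n + 2 * \<alpha> + 1)) p"
proof -
  define c where "c = real n * (real n + 2 * \<alpha> + 1)"
  define r where "r = gegenbauer_op \<alpha> p + smult c p"
  have deg: "degree p = n" and ort: "\<And>q. degree q < n \<Longrightarrow> gegenbauer_inner \<alpha> p q = 0"
    using p by (auto simp: gegenbauer_orthopoly_def)
  have "coeff r n = 0"
    using coeff_gegenbauer_op_degree[of p n \<alpha>] deg by (simp add: r_def c_def algebra_simps)
  moreover have "degree r \<le> n"
    unfolding r_def using degree_gegenbauer_op_le[of \<alpha> p] deg degree_smult_le[of c p]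
    by (intro degree_add_le) auto
  ultimately have r: "degree r < n"
    using n by (metis degree_0 le_neq_implies_less leading_coeff_0_iff less_le_trans zero_less_one)
  have "gegenbauer_inner \<alpha> r r = gegenbauer_inner \<alpha> p (gegenbauer_op \<alpha> r) + c * gegenbauer_inner \<alpha> p r"
    by (subst (1) r_def) (simp add: gegenbauer_inner_add[OF \<alpha>] gegenbauer_inner_smult gegenbauer_op_symmetric[OF \<alpha>])
  also have "\<dots> = 0"
    using ort[OF r] ort[of "gegenbauer_op \<alpha> r"] degree_gegenbauer_op_le[of \<alpha> r] r by simp
  finally have "r = 0"
    by (rule gegenbauer_inner_self_eq_0[OF \<alpha>])
  then have "gegenbauer_op \<alpha> p = - smult c p"
    by (simp add: r_def eq_neg_iff_add_eq_0)
  then show ?thesis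
    by (simp add: c_def)
qed

subsection \<open>Recursions for Chebyshev coefficients\<close>

lemma gegenbauer_op_chebT:
  "poly (gegenbauer_op \<alpha> (chebT j)) x =
    - (real j)\<^sup>2 * poly (chebT j) x - (2 * \<alpha> + 1) * (x * poly (pderiv (chebT j)) x)"
  using chebT_ode[of x j] by (simp add: poly_gegenbauer_op algebra_simps)

text \<open>In the basis of the second kind both T_m = (U_m - U_(m-2)) / 2 and x T_m' = m (U_m +
  U_(m-2)) / 2 have two terms, whereas x T_m' has a long expansion in the first kind.\<close>

lemma gegenbauer_op_chebT_chebU:
  "2 * (poly (gegenbauer_op \<alpha> (chebT (j + 2))) x + \<nu> * poly (chebT (j + 2)) x) =
    (\<nu> - (real (j + 2))\<^sup>2 - (2 * \<alpha> + 1) * real (j + 2)) * poly (chebU (j + 2)) x -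
    (\<nu> - (real (j + 2))\<^sup>2 + (2 * \<alpha> + 1) * real (j + 2)) * poly (chebU j) x"
proof -
  have T: "2 * poly (chebT (j + 2)) x = poly (chebU (j + 2)) x - poly (chebU j) x"
    using chebT_altdef[of j x] by simp
  have D: "2 * (x * poly (pderiv (chebT (j + 2))) x) = real (j + 2) * (poly (chebU (j + 2)) x + poly (chebU j) x)"
    using pderiv_chebT[of "Suc j" x] poly_chebU_Suc_Suc[of j x] by (simp add: algebra_simps)
  have "2 * (poly (gegenbauer_op \<alpha> (chebT (j + 2))) x + \<nu> * poly (chebT (j + 2)) x) =
      (\<nu> - (real (j + 2))\<^sup>2) * (2 * poly (chebT (j + 2)) x) -
      (2 * \<alpha> + 1) * (2 * (x * poly (pderiv (chebT (j + 2))) x))"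
    unfolding gegenbauer_op_chebT by (simp add: algebra_simps)
  then show ?thesis
    unfolding T D by (simp add: algebra_simps)
qed

lemma gegenbauer_op_linear:
  "poly (gegenbauer_op \<alpha> (smult a f - smult b g)) x =
    a * poly (gegenbauer_op \<alpha> f) x - b * poly (gegenbauer_op \<alpha> g) x"
  by (simp add: poly_gegenbauer_op pderiv_diff pderiv_smult algebra_simps)

lemma gegenbauer_op_sum:
  fixes N :: nat
  shows
  "poly (gegenbauer_op \<alpha> (\<Sum>j<N. smult (g j) (f j))) x = (\<Sum>j<N. g j * poly (gegenbauer_op \<alpha> (f j)) x)"
  unfolding poly_gegenbauer_op
  by (induction N) (simp_all add: pderiv_add pderiv_smult algebra_simps)

lemma chebT_coeff_recursion:
  assumes p: "p = (\<Sum>j<Suc n. smult (g j) (chebT j))" and g0: "\<And>j. j > n \<Longrightarrow> g j = 0"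
    and eig: "gegenbauer_op \<alpha> p = smult (- \<nu>) p" and j: "1 \<le> j" "j \<le> n"
  shows "(\<nu> - (real j)\<^sup>2 - (2 * \<alpha> + 1) * real j) * g j =
    (\<nu> - (real (j + 2))\<^sup>2 + (2 * \<alpha> + 1) * real (j + 2)) * g (j + 2)"
proof -
  define u where "u = (\<lambda>j. \<nu> - (real j)\<^sup>2 - (2 * \<alpha> + 1) * real j)"
  define v where "v = (\<lambda>j. \<nu> - (real j)\<^sup>2 + (2 * \<alpha> + 1) * real j)"
  \<comment> \<open>Low indices are exceptional: T_0 and T_1 have no partner two places below, so
    \<open>B\<close> vanishes there, and 2 T_0 is 2 U_0 instead of U_0.\<close>
  define w where "w = (\<lambda>j. if j = 0 then 2 * \<nu> else u j)"
  define B where "B = (\<lambda>j x. if j < 2 then 0 else v j * poly (chebU (j - 2)) x)"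
  have summand: "2 * (poly (gegenbauer_op \<alpha> (chebT j)) x + \<nu> * poly (chebT j) x) = w j * poly (chebU j) x - B j x" for j x
  proof -
    consider "j = 0" | "j = 1" | k where "j = k + 2"
      by (metis One_nat_def add_2_eq_Suc' not0_implies_Suc)
    then show ?thesis
    proof cases
      case 1
      then show ?thesis by (simp add: w_def B_def poly_gegenbauer_op)
    next
      case 2
      then show ?thesis by (simp add: w_def u_def B_def poly_gegenbauer_op pderiv_pCons algebra_simps)
    next
      case 3
      then show ?thesis
        using gegenbauer_op_chebT_chebU[of \<alpha> k x \<nu>] by (simp add: w_def u_def v_def B_def)
    qed
  qed
  \<comment> \<open>Padding with two zero coefficients makes the sum shifted by two run over all
    indices up to n again.\<close>
  have pN: "p = (\<Sum>j<n + 3. smult (g j) (chebT j))"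
    unfolding p by (rule sum.mono_neutral_left) (auto simp: g0)
  define c where "c = (\<lambda>j. g j * w j - g (j + 2) * v (j + 2))"
  have "(\<Sum>j<Suc n. smult (c j) (chebU j)) = 0"
  proof (rule poly_ext)
    fix x
    have "0 = 2 * (poly (gegenbauer_op \<alpha> p) x + \<nu> * poly p x)"
      by (simp add: eig)
    also have "\<dots> = 2 * ((\<Sum>j<n + 3. g j * poly (gegenbauer_op \<alpha> (chebT j)) x) + \<nu> * (\<Sum>j<n + 3. g j * poly (chebT j) x))"
      by (simp only: pN gegenbauer_op_sum) (simp add: poly_sum)
    also have "\<dots> = (\<Sum>j<n + 3. g j * (2 * (poly (gegenbauer_op \<alpha> (chebT j)) x + \<nu> * poly (chebT j) x)))"
      by (simp add: sum_distrib_left sum.distrib[symmetric] algebra_simps)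
    also have "\<dots> = (\<Sum>j<n + 3. g j * w j * poly (chebU j) x) - (\<Sum>j<n + 3. g j * B j x)"
      unfolding summand by (simp add: sum_subtractf algebra_simps)
    also have "(\<Sum>j<n + 3. g j * w j * poly (chebU j) x) = (\<Sum>j<Suc n. g j * w j * poly (chebU j) x)"
      by (rule sum.mono_neutral_right) (auto simp: g0)
    also have "(\<Sum>j<n + 3. g j * B j x) = (\<Sum>j<Suc n. g (j + 2) * v (j + 2) * poly (chebU j) x)"
    proof -
      have "(\<Sum>j<n + 3. g j * B j x) = (\<Sum>j<Suc n. g (Suc (Suc j)) * B (Suc (Suc j)) x)"
        using sum.lessThan_Suc_shift[of "\<lambda>j. g j * B j x" "Suc (Suc n)"]
          sum.lessThan_Suc_shift[of "\<lambda>j. g (Suc j) * B (Suc j) x" "Suc n"]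
        by (simp add: B_def numeral_3_eq_3)
      then show ?thesis by (simp add: B_def mult.assoc)
    qed
    finally show "poly (\<Sum>j<Suc n. smult (c j) (chebU j)) x = poly 0 x"
      by (simp only: poly_sum poly_smult poly_0 c_def left_diff_distrib sum_subtractf)
  qed
  then have "c j = 0"
    using poly_basis_independent[of chebU c "Suc n" j] j by (simp add: degree_chebU)
  then show ?thesis
    using j by (simp add: c_def w_def u_def v_def mult_ac)
qed

text \<open>
  The test polynomial \<open>T\<^bsub>k+2\<^esub> / (k + 2) - T\<^bsub>k\<^esub> / k\<close> is chosen because the operator maps it
  to a combination of just \<open>T\<^bsub>k+2\<^esub>\<close> and \<open>T\<^bsub>k\<^esub>\<close>.
\<close>

lemma gegenbauer_inner_chebT_recursion:
  assumes \<alpha>: "\<alpha> > -1" and eig: "gegenbauer_op \<alpha> p = smult (- \<nu>) p" and k: "k \<ge> 1"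
  shows "(\<nu> - (real (k + 2))\<^sup>2 - (2 * \<alpha> + 1) * real (k + 2)) / real (k + 2) * gegenbauer_inner \<alpha> p (chebT (k + 2)) =
    (\<nu> - (real k)\<^sup>2 + (2 * \<alpha> + 1) * real k) / real k * gegenbauer_inner \<alpha> p (chebT k)"
proof -
  define f where "f = smult (1 / real (k + 2)) (chebT (k + 2)) - smult (1 / real k) (chebT k)"
  obtain i where i: "k = Suc i" using k by (cases k) auto
  have "gegenbauer_op \<alpha> f + smult \<nu> f =
      smult ((\<nu> - (real (k + 2))\<^sup>2) / real (k + 2) - (2 * \<alpha> + 1)) (chebT (k + 2)) -
      smult ((\<nu> - (real k)\<^sup>2) / real k + (2 * \<alpha> + 1)) (chebT k)"
  proof (rule poly_ext)
    fix x
    define a where "a = inverse (real (k + 2))"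
    define b where "b = inverse (real k)"
    have pf: "poly f x = a * poly (chebT (k + 2)) x - b * poly (chebT k) x"
      by (simp add: f_def a_def b_def inverse_eq_divide)
    have "poly (gegenbauer_op \<alpha> f) x = a * poly (gegenbauer_op \<alpha> (chebT (k + 2))) x - b * poly (gegenbauer_op \<alpha> (chebT k)) x"
      by (simp only: f_def a_def b_def inverse_eq_divide gegenbauer_op_linear)
    also have "\<dots> = - a * (real (k + 2))\<^sup>2 * poly (chebT (k + 2)) x + b * (real k)\<^sup>2 * poly (chebT k) x
        - (2 * \<alpha> + 1) * x * (a * poly (pderiv (chebT (k + 2))) x - b * poly (pderiv (chebT k)) x)"
      unfolding gegenbauer_op_chebT by (simp add: algebra_simps)
    \<comment> \<open>The normalized derivatives are U_(k+1) and U_(k-1), whose difference is 2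
      T_(k+1). Multiplication by x then leads back to T_(k+2) + T_k.\<close>
    also have "a * poly (pderiv (chebT (k + 2))) x - b * poly (pderiv (chebT k)) x = 2 * poly (chebT (Suc k)) x"
    proof -
      have "a * (real (k + 2) * y) = y" "b * (real k * y) = y" for y
        using k by (simp_all add: a_def b_def)
      moreover have "poly (pderiv (chebT (k + 2))) x = real (k + 2) * poly (chebU (Suc (Suc i))) x"
        "poly (pderiv (chebT k)) x = real k * poly (chebU i) x"
        using pderiv_chebT[of "Suc k" x] pderiv_chebT[of i x] by (simp_all add: i)
      ultimately show ?thesis
        using chebT_altdef[of i x] by (simp only: i)
    qed
    also have "(2 * \<alpha> + 1) * x * (2 * poly (chebT (Suc k)) x) = (2 * \<alpha> + 1) * (poly (chebT (k + 2)) x + poly (chebT k) x)"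
      using poly_chebT_Suc_Suc[of k x] by simp
    finally have "poly (gegenbauer_op \<alpha> f + smult \<nu> f) x =
        (\<nu> - (real (k + 2))\<^sup>2) * a * poly (chebT (k + 2)) x - (\<nu> - (real k)\<^sup>2) * b * poly (chebT k) x
        - (2 * \<alpha> + 1) * (poly (chebT (k + 2)) x + poly (chebT k) x)"
      by (simp add: pf algebra_simps)
    then show "poly (gegenbauer_op \<alpha> f + smult \<nu> f) x = poly (smult ((\<nu> - (real (k + 2))\<^sup>2) / real (k + 2) - (2 * \<alpha> + 1)) (chebT (k + 2)) -
      smult ((\<nu> - (real k)\<^sup>2) / real k + (2 * \<alpha> + 1)) (chebT k)) x"
      unfolding divide_inverse a_def[symmetric] b_def[symmetric] by (simp add: algebra_simps)
  qed
  \<comment> \<open>By symmetry the shifted operator moves over to p, which it annihilates.\<close>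
  moreover have "gegenbauer_inner \<alpha> p (gegenbauer_op \<alpha> f + smult \<nu> f) = 0"
    by (simp add: gegenbauer_inner_add_right[OF \<alpha>] gegenbauer_inner_smult_right
        gegenbauer_op_symmetric[OF \<alpha>, symmetric] eig gegenbauer_inner_smult[of _ "- \<nu>" p, simplified])
  ultimately have "((\<nu> - (real (k + 2))\<^sup>2) / real (k + 2) - (2 * \<alpha> + 1)) * gegenbauer_inner \<alpha> p (chebT (k + 2)) =
      ((\<nu> - (real k)\<^sup>2) / real k + (2 * \<alpha> + 1)) * gegenbauer_inner \<alpha> p (chebT k)"
    by (simp add: gegenbauer_inner_diff_right[OF \<alpha>] gegenbauer_inner_smult_right)
  then show ?thesis
    using k by (simp add: diff_divide_distrib add_divide_distrib)
qed

text \<open>The coefficients of the power series \<open>(1 - X\<^sup>2) powr (- s / 2)\<close>.\<close>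

fun cheb_limit_coeff :: "real \<Rightarrow> nat \<Rightarrow> real" where
  "cheb_limit_coeff s 0 = 1"
| "cheb_limit_coeff s (Suc 0) = 0"
| "cheb_limit_coeff s (Suc (Suc l)) = (real l + s) / (real l + 2) * cheb_limit_coeff s l"

lemma cheb_limit_coeff_odd: "odd i \<Longrightarrow> cheb_limit_coeff s i = 0"
  by (induction s i rule: cheb_limit_coeff.induct) auto

lemma cheb_limit_coeff_even: "cheb_limit_coeff s (2 * k) = (-1) ^ k * ((- s / 2) gchoose k)"
proof (induction k)
  case (Suc k)
  have "((- s / 2) gchoose (Suc k)) = ((- s / 2) gchoose k) * ((- s / 2 - real k) / real (Suc k))"
    using gbinomial_mult_1[of "- s / 2" k] by (simp add: field_simps)
  moreover have "(real (2 * k) + s) / (real (2 * k) + 2) = - ((- s / 2 - real k) / real (Suc k))"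
    by (simp add: field_simps)
  ultimately show ?case
    using Suc by (simp add: cheb_limit_coeff.simps(3)[of s "2 * k"])
qed simp

section \<open>The differential equation of the limiting power series\<close>

lemma fps_nth_one_minus_X_sq_mult_deriv:
  fixes F :: "real fps"
  shows "fps_nth ((1 - fps_X\<^sup>2) * fps_deriv F) 0 = fps_nth F 1"
    and "fps_nth ((1 - fps_X\<^sup>2) * fps_deriv F) (Suc l) = (real l + 2) * fps_nth F (l + 2) - real l * fps_nth F l"
  by (simp add: left_diff_distrib fps_X_power_mult_nth)
    (cases l; simp add: left_diff_distrib fps_X_power_mult_nth)

text \<open>This is the equation of (1 - X^2) powr (- s / 2). Its coefficient at X^0 kills the
  linear term of F, and the one at X^(l+1) is the recursion of
  \<open>cheb_limit_coeff\<close>.\<close>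

lemma fps_ode_cheb_limit_coeff:
  fixes F :: "real fps"
  assumes ode: "(1 - fps_X\<^sup>2) * fps_deriv F = fps_const s * (fps_X * F)" and F0: "fps_nth F 0 = 1"
  shows "fps_nth F i = cheb_limit_coeff s i"
proof -
  have F1: "fps_nth F 1 = 0"
    unfolding fps_nth_one_minus_X_sq_mult_deriv(1)[symmetric] ode by simp
  have F2: "(real l + 2) * fps_nth F (l + 2) = (real l + s) * fps_nth F l" for l
  proof -
    have "fps_nth (fps_const s * (fps_X * F)) (Suc l) = s * fps_nth F l"
      by simp
    then show ?thesis
      using fps_nth_one_minus_X_sq_mult_deriv(2)[of F l] unfolding ode by (simp add: algebra_simps)
  qed
  have "fps_nth F i = cheb_limit_coeff s i \<and> fps_nth F (Suc i) = cheb_limit_coeff s (Suc i)"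
  proof (induction i)
    case 0
    then show ?case using F0 F1 by simp
  next
    case (Suc i)
    then show ?case using F2[of i] by (simp add: field_simps)
  qed
  then show ?thesis by simp
qed

lemma cheb_limit_coeff_ode:
  "(1 - fps_X\<^sup>2) * fps_deriv (Abs_fps (cheb_limit_coeff s)) =
    fps_const s * (fps_X * Abs_fps (cheb_limit_coeff s))" (is "?L = ?R")
proof (rule fps_ext)
  fix i
  show "fps_nth ?L i = fps_nth ?R i"
    by (cases i) (simp_all only: fps_nth_one_minus_X_sq_mult_deriv fps_mult_left_const_nth
        fps_X_mult_nth, simp_all add: field_simps)
qed

text \<open>By the product rule the product of the solutions for s and t solves the equation for s +
  t.\<close>

lemma cheb_limit_coeff_convolution:
  "(\<Sum>l\<le>i. cheb_limit_coeff s l * cheb_limit_coeff t (i - l)) = cheb_limit_coeff (s + t) i"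
proof -
  define F G where "F = Abs_fps (cheb_limit_coeff s)" and "G = Abs_fps (cheb_limit_coeff t)"
  have "(1 - fps_X\<^sup>2) * fps_deriv (F * G) = ((1 - fps_X\<^sup>2) * fps_deriv F) * G + F * ((1 - fps_X\<^sup>2) * fps_deriv G)"
    by (simp add: algebra_simps)
  also have "\<dots> = fps_const (s + t) * (fps_X * (F * G))"
    unfolding F_def G_def cheb_limit_coeff_ode by (simp add: algebra_simps fps_const_add[symmetric] del: fps_const_add)
  finally have "fps_nth (F * G) i = cheb_limit_coeff (s + t) i"
    by (rule fps_ode_cheb_limit_coeff) (simp add: F_def G_def)
  then show ?thesis
    by (simp add: fps_mult_nth F_def G_def atLeast0AtMost)
qed

section \<open>The quadrature error of polynomials and the Chebyshev coefficients of the Jacobi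
  polynomial\<close>

definition gauss_error :: "real \<Rightarrow> nat \<Rightarrow> real poly \<Rightarrow> real" where
  "gauss_error \<alpha> n p = gegenbauer_inner \<alpha> p 1 - (\<Sum>x \<in> gauss_nodes \<alpha> n. poly p x * gauss_weight \<alpha> n x)"

lemma gauss_error_add:
  "\<alpha> > -1 \<Longrightarrow> gauss_error \<alpha> n (p + q) = gauss_error \<alpha> n p + gauss_error \<alpha> n q"
  by (simp add: gauss_error_def gegenbauer_inner_add sum.distrib algebra_simps)

lemma gauss_error_smult:
  "gauss_error \<alpha> n (smult c p) = c * gauss_error \<alpha> n p"
  by (simp add: gauss_error_def gegenbauer_inner_smult sum_distrib_left algebra_simps)

lemma gauss_error_sum:
  assumes "\<alpha> > -1"
  shows "gauss_error \<alpha> n (\<Sum>k\<in>A. f k) = (\<Sum>k\<in>A. gauss_error \<alpha> n (f k))"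
proof (induction A rule: infinite_finite_induct)
  case (insert x F)
  then show ?case by (simp add: gauss_error_add[OF assms])
qed (simp_all add: gauss_error_def gegenbauer_inner_def)

lemma gauss_error_eq_0:
  assumes "\<alpha> > -1" "degree p < 2 * n"
  shows "gauss_error \<alpha> n p = 0"
  using gauss_quadrature_exact[OF assms] by (simp add: gauss_error_def gegenbauer_inner_def)

lemma gauss_error_jacobi_mult:
  "gauss_error \<alpha> n (jacobi_poly \<alpha> n * q) = gegenbauer_inner \<alpha> (jacobi_poly \<alpha> n) q"
  by (simp add: gauss_error_def gauss_nodes_def gegenbauer_inner_mult_1)

lemma gegenbauer_orthopoly_jacobi_poly:
  assumes "\<alpha> > -1" "n \<ge> 1"
  shows "gegenbauer_orthopoly \<alpha> n (jacobi_poly \<alpha> n)"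
  using jacobi_poly(1,2)[OF assms(1), of n] jacobi_poly(3)[OF assms(1)] assms(2)
  by (auto simp: gegenbauer_orthopoly_def gegenbauer_orthogonal_iff)

text \<open>The values beyond n are fixed to zero because the recursion at j refers to j + 2, which
  passes n for j = n - 1 and j = n.\<close>

definition jacobi_cheb_coeff :: "real \<Rightarrow> nat \<Rightarrow> nat \<Rightarrow> real" where
  "jacobi_cheb_coeff \<alpha> n = (SOME g. jacobi_poly \<alpha> n = (\<Sum>j<Suc n. smult (g j) (chebT j)) \<and> (\<forall>j>n. g j = 0))"

lemma jacobi_cheb_coeff:
  assumes "\<alpha> > -1"
  shows "jacobi_poly \<alpha> n = (\<Sum>j<Suc n. smult (jacobi_cheb_coeff \<alpha> n j) (chebT j))"
    and "j > n \<Longrightarrow> jacobi_cheb_coeff \<alpha> n j = 0"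
proof -
  obtain g where g: "jacobi_poly \<alpha> n = (\<Sum>j<Suc n. smult (g j) (chebT j))"
    using poly_basis_expansion[of chebT "jacobi_poly \<alpha> n" "Suc n"] jacobi_poly(1)[OF assms, of n]
    by (auto simp: degree_chebT)
  have "(\<Sum>j<Suc n. smult (if j \<le> n then g j else 0) (chebT j)) = (\<Sum>j<Suc n. smult (g j) (chebT j))"
    by (intro sum.cong) auto
  then have "\<exists>g. jacobi_poly \<alpha> n = (\<Sum>j<Suc n. smult (g j) (chebT j)) \<and> (\<forall>j>n. g j = 0)"
    using g by (intro exI[of _ "\<lambda>j. if j \<le> n then g j else 0"]) simp
  from someI_ex[OF this]
  show "jacobi_poly \<alpha> n = (\<Sum>j<Suc n. smult (jacobi_cheb_coeff \<alpha> n j) (chebT j))"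
    and "j > n \<Longrightarrow> jacobi_cheb_coeff \<alpha> n j = 0"
    unfolding jacobi_cheb_coeff_def[symmetric] by auto
qed

lemma lead_coeff_jacobi_poly_cheb:
  assumes "\<alpha> > -1"
  shows "coeff (jacobi_poly \<alpha> (Suc n)) (Suc n) = 2 ^ n * jacobi_cheb_coeff \<alpha> (Suc n) (Suc n)"
  by (subst jacobi_cheb_coeff(1)[OF assms])
    (simp add: coeff_sum coeff_eq_0 degree_chebT coeff_chebT_Suc)

lemma jacobi_cheb_coeff_nonzero:
  assumes "\<alpha> > -1" "n \<ge> 1"
  shows "jacobi_cheb_coeff \<alpha> n n \<noteq> 0"
proof -
  obtain m where m: "n = Suc m" using assms(2) by (cases n) auto
  have "jacobi_poly \<alpha> n \<noteq> 0"
    using jacobi_poly(1)[OF assms(1), of n] assms(2) by auto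
  then have "coeff (jacobi_poly \<alpha> n) n \<noteq> 0"
    using jacobi_poly(1)[OF assms(1), of n] by (metis leading_coeff_0_iff)
  then show ?thesis
    using lead_coeff_jacobi_poly_cheb[OF assms(1), of m] m by auto
qed

text \<open>The offset 2 n is the first degree that exactness does not cover.\<close>

definition cheb_error :: "real \<Rightarrow> nat \<Rightarrow> nat \<Rightarrow> real" where
  "cheb_error \<alpha> n i = gauss_error \<alpha> n (chebT (2 * n + i))"

text \<open>
  Since \<open>J\<^sub>n\<close> vanishes at the nodes, the quadrature error of \<open>J\<^sub>n * T\<^bsub>n+i\<^esub>\<close> is its integral; expanding
  \<open>J\<^sub>n\<close> in Chebyshev polynomials and using exactness leaves a triangular system for the errors.
\<close>

lemma cheb_error_convolution:
  assumes \<alpha>: "\<alpha> > -1" and i: "i < n"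
  shows "2 * gegenbauer_inner \<alpha> (jacobi_poly \<alpha> n) (chebT (n + i)) =
    (\<Sum>l\<le>i. jacobi_cheb_coeff \<alpha> n (n - l) * cheb_error \<alpha> n (i - l))"
proof -
  define g where "g = jacobi_cheb_coeff \<alpha> n"
  have J: "jacobi_poly \<alpha> n = (\<Sum>j<Suc n. smult (g j) (chebT j))"
    unfolding g_def by (rule jacobi_cheb_coeff(1)[OF \<alpha>])
  define e where "e = (\<lambda>m. gauss_error \<alpha> n (chebT m))"
  have e0: "e m = 0" if "m < 2 * n" for m
    using that gauss_error_eq_0[OF \<alpha>] by (simp add: e_def degree_chebT)
  have "smult 2 (jacobi_poly \<alpha> n * chebT (n + i)) =
      (\<Sum>j<Suc n. smult (g j) (smult 2 (chebT (n + i) * chebT j)))"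
    by (subst J, rule poly_ext)
      (simp add: poly_sum sum_distrib_left sum_distrib_right algebra_simps)
  also have "\<dots> = (\<Sum>j<Suc n. smult (g j) (chebT (n + i + j) + chebT (n + i - j)))"
    by (intro sum.cong refl arg_cong2[where f = smult] chebT_mult_chebT) auto
  finally have "2 * gegenbauer_inner \<alpha> (jacobi_poly \<alpha> n) (chebT (n + i)) =
      gauss_error \<alpha> n (\<Sum>j<Suc n. smult (g j) (chebT (n + i + j) + chebT (n + i - j)))"
    by (metis gauss_error_smult gauss_error_jacobi_mult)
  also have "\<dots> = (\<Sum>j<Suc n. g j * (e (n + i + j) + e (n + i - j)))"
    by (simp only: gauss_error_sum[OF \<alpha>] gauss_error_smult gauss_error_add[OF \<alpha>] e_def)
  \<comment> \<open>The degrees n + i - j are below 2 n because i < n, so exactness removes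
    them.\<close>
  also have "\<dots> = (\<Sum>j<Suc n. g j * e (n + i + j))"
    using i by (intro sum.cong refl) (simp add: e0)
  also have "\<dots> = (\<Sum>l<Suc n. g (n - l) * e (n + i + (n - l)))"
    using sum.nat_diff_reindex[of "\<lambda>j. g j * e (n + i + j)" "Suc n"] by simp
  \<comment> \<open>For l > i the degree n + i + (n - l) drops below 2 n, which makes the system
    triangular.\<close>
  also have "\<dots> = (\<Sum>l\<le>i. g (n - l) * e (n + i + (n - l)))"
    using i by (intro sum.mono_neutral_right) (auto simp: e0)
  also have "\<dots> = (\<Sum>l\<le>i. g (n - l) * cheb_error \<alpha> n (i - l))"
  proof (intro sum.cong refl arg_cong2[where f = "(*)"])
    fix l assume "l \<in> {..i}"
    then have "n + i + (n - l) = 2 * n + (i - l)" using i by auto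
    then show "e (n + i + (n - l)) = cheb_error \<alpha> n (i - l)"
      unfolding e_def cheb_error_def by (simp only:)
  qed
  finally show ?thesis by (simp add: g_def)
qed

section \<open>Limits of coefficients and errors for growing degree\<close>

lemma tendsto_rational_ratio:
  fixes a b :: real
  shows "(\<lambda>n. (2 * real n + a) / (2 * real n + b)) \<longlonglongrightarrow> 1"
    and "(\<lambda>n. (real n + a) / (real n + b)) \<longlonglongrightarrow> 1"
  by real_asymp+

context
  fixes \<alpha> :: real
  assumes \<alpha>: "\<alpha> > -1"
begin

lemma jacobi_poly_eigen:
  assumes "n \<ge> 1"
  shows "gegenbauer_op \<alpha> (jacobi_poly \<alpha> n) = smult (- (real n * (real n + (2 * \<alpha> + 1)))) (jacobi_poly \<alpha> n)"
  using gegenbauer_orthopoly_eigen[OF \<alpha> gegenbauer_orthopoly_jacobi_poly[OF \<alpha> assms] assms]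
  by (simp add: add.assoc)

text \<open>The recursion at j = n - l - 2 expresses the ratio at l + 2 through the one at l; its
  factor tends to (l + L) / (l + 2) with L = 2 \<alpha> + 1, the factor of
  \<open>cheb_limit_coeff\<close>.\<close>

lemma tendsto_jacobi_cheb_coeff:
  "(\<lambda>n. jacobi_cheb_coeff \<alpha> n (n - l) / jacobi_cheb_coeff \<alpha> n n) \<longlonglongrightarrow> cheb_limit_coeff (2 * \<alpha> + 1) l"
proof -
  define L where "L = 2 * \<alpha> + 1"
  have L: "L > -1" using \<alpha> by (simp add: L_def)
  let ?a = "\<lambda>n l. jacobi_cheb_coeff \<alpha> n (n - l) / jacobi_cheb_coeff \<alpha> n n"
  have rec: "real (n - j) * (real (n + j) + L) * jacobi_cheb_coeff \<alpha> n j =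
      real (n + j + 2) * (real n - real j - 2 + L) * jacobi_cheb_coeff \<alpha> n (j + 2)"
    if "1 \<le> j" "j \<le> n" for n j
    using chebT_coeff_recursion[OF jacobi_cheb_coeff(1)[OF \<alpha>] jacobi_cheb_coeff(2)[OF \<alpha>] jacobi_poly_eigen, of n j] that
    by (simp add: of_nat_diff L_def power2_eq_square algebra_simps)
  show ?thesis
    unfolding L_def[symmetric]
  proof (induction l rule: induct_nat_012)
    case 0
    have "eventually (\<lambda>n. ?a n 0 = 1) sequentially"
      using eventually_ge_at_top[of 1] by eventually_elim (simp add: jacobi_cheb_coeff_nonzero[OF \<alpha>])
    then show ?case unfolding cheb_limit_coeff.simps by (rule tendsto_eventually)
  next
    case 1
    have "eventually (\<lambda>n. ?a n 1 = 0) sequentially"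
      using eventually_ge_at_top[of 2]
    proof eventually_elim
      case (elim n)
      \<comment> \<open>The index n + 1 lies beyond the degree, so the recursion forces the
        coefficient at n - 1 to vanish.\<close>
      have "jacobi_cheb_coeff \<alpha> n (n - 1 + 2) = 0"
        using elim jacobi_cheb_coeff(2)[OF \<alpha>, of n "n - 1 + 2"] by simp
      then have "real (n - (n - 1)) * (real (n + (n - 1)) + L) * jacobi_cheb_coeff \<alpha> n (n - 1) = 0"
        using rec[of "n - 1" n] elim by simp
      moreover have "real (n + (n - 1)) + L > 0" "real (n - (n - 1)) > 0" using elim L by auto
      ultimately show ?case by simp
    qed
    then show ?case by (simp add: tendsto_eventually)
  next
    case (ge2 l)
    have ev: "eventually (\<lambda>n. (2 * real n + (- real l)) / (2 * real n + (L - real l - 2)) * ((real l + L) / (real l + 2)) * ?a n l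
        = ?a n (Suc (Suc l))) sequentially"
      using eventually_ge_at_top[of "l + 4"]
    proof eventually_elim
      case (elim n)
      define j where "j = n - Suc (Suc l)"
      have j: "n = j + l + 2" "j \<ge> 1" using elim by (auto simp: j_def)
      define A B C where "A = real l + 2" and "B = 2 * real n + (L - real l - 2)"
        and "C = 2 * real n + (- real l)"
      have pos: "A > 0" "B > 0" using elim L by (auto simp: A_def B_def)
      have "A * B * jacobi_cheb_coeff \<alpha> n j = C * (real l + L) * jacobi_cheb_coeff \<alpha> n (j + 2)"
        using rec[of j n] j by (simp add: A_def B_def C_def algebra_simps)
      then have "jacobi_cheb_coeff \<alpha> n j = C / B * ((real l + L) / A) * jacobi_cheb_coeff \<alpha> n (j + 2)"
        using pos by (simp add: field_simps)
      moreover have "n - l = j + 2" using j by simp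
      ultimately show ?case
        unfolding j_def[symmetric] A_def[symmetric] B_def[symmetric] C_def[symmetric] by simp
    qed
    have "(\<lambda>n. (2 * real n + (- real l)) / (2 * real n + (L - real l - 2)) * ((real l + L) / (real l + 2)) * ?a n l)
        \<longlonglongrightarrow> 1 * ((real l + L) / (real l + 2)) * cheb_limit_coeff L l"
      using ge2 by (intro tendsto_intros tendsto_rational_ratio) auto
    then show ?case
      using Lim_transform_eventually[OF _ ev] by simp
  qed
qed

text \<open>The recursion steps from n + i to n + i + 2 with a factor tending to (i - L) / (i + 2).
  The step from n - 2 to n has coefficient zero and carries no information, so the limit \<gamma> at
  n enters as a hypothesis and is computed from the norms.\<close>

lemma tendsto_jacobi_inner_chebT:
  assumes \<gamma>: "(\<lambda>n. 2 * gegenbauer_inner \<alpha> (jacobi_poly \<alpha> n) (chebT n) / jacobi_cheb_coeff \<alpha> n n) \<longlonglongrightarrow> \<gamma>"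
  shows "(\<lambda>n. 2 * gegenbauer_inner \<alpha> (jacobi_poly \<alpha> n) (chebT (n + i)) / jacobi_cheb_coeff \<alpha> n n)
    \<longlonglongrightarrow> \<gamma> * cheb_limit_coeff (- (2 * \<alpha> + 1)) i"
proof -
  define L where "L = 2 * \<alpha> + 1"
  have L: "L > -1" using \<alpha> by (simp add: L_def)
  define r where "r = (\<lambda>n k. gegenbauer_inner \<alpha> (jacobi_poly \<alpha> n) (chebT k))"
  have rec: "(real n - real (k + 2)) * (real n + real (k + 2) + L) / real (k + 2) * r n (k + 2) =
      (real n + real k) * (real n - real k + L) / real k * r n k"
    if "k \<ge> 1" "n \<ge> 1" for k n
  proof -
    have "(real n - real (k + 2)) * (real n + real (k + 2) + L) = real n * (real n + L) - (real (k + 2))\<^sup>2 - L * real (k + 2)"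
      "(real n + real k) * (real n - real k + L) = real n * (real n + L) - (real k)\<^sup>2 + L * real k"
      by (simp_all add: power2_eq_square algebra_simps)
    then show ?thesis
      using gegenbauer_inner_chebT_recursion[OF \<alpha> jacobi_poly_eigen[OF that(2)] that(1)]
      unfolding L_def r_def by simp
  qed
  have "(\<lambda>n. 2 * r n (n + i) / jacobi_cheb_coeff \<alpha> n n) \<longlonglongrightarrow> \<gamma> * cheb_limit_coeff (- L) i"
  proof (induction i rule: induct_nat_012)
    case 0
    then show ?case using \<gamma> by (simp add: r_def)
  next
    case 1
    have "eventually (\<lambda>n. 2 * r n (n + 1) / jacobi_cheb_coeff \<alpha> n n = 0) sequentially"
      using eventually_ge_at_top[of 2]
    proof eventually_elim
      case (elim n)
      \<comment> \<open>Orthogonality gives this zero, and the recursion carries it over to n +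
        1.\<close>
      have "r n (n - 1) = 0"
        using gegenbauer_orthopoly_jacobi_poly[OF \<alpha>, of n] elim
        by (simp add: r_def gegenbauer_orthopoly_def degree_chebT)
      moreover have "n - 1 + 2 = n + 1" using elim by simp
      ultimately have "(real n - real (n + 1)) * (real n + real (n + 1) + L) / real (n + 1) * r n (n + 1) = 0"
        using rec[of "n - 1" n] elim by simp
      moreover have "real n + real (n + 1) + L > 0" using elim L by simp
      ultimately show ?case by simp
    qed
    then show ?case by (simp add: tendsto_eventually)
  next
    case (ge2 i)
    have ev: "eventually (\<lambda>n. (real n + (real i + 2)) / (real n + real i) * ((2 * real n + real i) / (2 * real n + (real i + 2 + L))) *
        ((real i - L) / (real i + 2)) * (2 * r n (n + i) / jacobi_cheb_coeff \<alpha> n n) =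
        2 * r n (n + Suc (Suc i)) / jacobi_cheb_coeff \<alpha> n n) sequentially"
      using eventually_ge_at_top[of 1]
    proof eventually_elim
      case (elim n)
      define A where "A = real i + 2"
      define B where "B = 2 * real n + (real i + 2 + L)"
      define C where "C = real n + (real i + 2)"
      define D where "D = real n + real i"
      have pos: "A > 0" "B > 0" "C > 0" "D > 0"
        using elim L by (auto simp: A_def B_def C_def D_def)
      have "(- A) * B / C * r n (n + i + 2) = (2 * real n + real i) * (L - real i) / D * r n (n + i)"
        using rec[of "n + i" n] elim by (simp add: A_def B_def C_def D_def algebra_simps)
      then have "r n (n + i + 2) = C / D * ((2 * real n + real i) / B) * ((real i - L) / A) * r n (n + i)"
        using pos by (simp add: field_simps)
      then show ?case
        by (simp add: A_def B_def C_def D_def)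
    qed
    have "(\<lambda>n. (real n + (real i + 2)) / (real n + real i) * ((2 * real n + real i) / (2 * real n + (real i + 2 + L))) *
        ((real i - L) / (real i + 2)) * (2 * r n (n + i) / jacobi_cheb_coeff \<alpha> n n))
        \<longlonglongrightarrow> 1 * 1 * ((real i - L) / (real i + 2)) * (\<gamma> * cheb_limit_coeff (- L) i)"
      using ge2 by (intro tendsto_intros tendsto_rational_ratio) auto
    then show ?case
      using Lim_transform_eventually[OF _ ev] by (simp add: mult_ac)
  qed
  then show ?thesis by (simp add: L_def r_def)
qed

text \<open>The triangular system is solved for its newest error and all other terms converge by
  induction. The limits fit since the series for L and - 2 L have the one for - L as their
  product.\<close>

lemma tendsto_cheb_error:
  assumes \<gamma>: "(\<lambda>n. 2 * gegenbauer_inner \<alpha> (jacobi_poly \<alpha> n) (chebT n) / jacobi_cheb_coeff \<alpha> n n) \<longlonglongrightarrow> \<gamma>"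
  shows "(\<lambda>n. cheb_error \<alpha> n i) \<longlonglongrightarrow> \<gamma> * cheb_limit_coeff (- 2 * (2 * \<alpha> + 1)) i"
proof (induction i rule: less_induct)
  case (less i)
  define L where "L = 2 * \<alpha> + 1"
  let ?a = "\<lambda>n l. jacobi_cheb_coeff \<alpha> n (n - l) / jacobi_cheb_coeff \<alpha> n n"
  have ev: "eventually (\<lambda>n. 2 * gegenbauer_inner \<alpha> (jacobi_poly \<alpha> n) (chebT (n + i)) / jacobi_cheb_coeff \<alpha> n n
      - (\<Sum>l\<in>{1..i}. ?a n l * cheb_error \<alpha> n (i - l)) = cheb_error \<alpha> n i) sequentially"
    using eventually_ge_at_top[of "Suc i"]
  proof eventually_elim
    case (elim n)
    have "jacobi_cheb_coeff \<alpha> n n \<noteq> 0" using elim by (intro jacobi_cheb_coeff_nonzero[OF \<alpha>]) auto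
    moreover have "{..i} = insert 0 {1..i}" by auto
    ultimately show ?case
      using cheb_error_convolution[OF \<alpha>, of i n] elim
      by (simp add: add_divide_distrib sum_divide_distrib)
  qed
  have "(\<lambda>n. 2 * gegenbauer_inner \<alpha> (jacobi_poly \<alpha> n) (chebT (n + i)) / jacobi_cheb_coeff \<alpha> n n
      - (\<Sum>l\<in>{1..i}. ?a n l * cheb_error \<alpha> n (i - l))) \<longlonglongrightarrow>
      \<gamma> * cheb_limit_coeff (- L) i - (\<Sum>l\<in>{1..i}. cheb_limit_coeff L l * (\<gamma> * cheb_limit_coeff (- 2 * L) (i - l)))"
    unfolding L_def
    by (intro tendsto_diff tendsto_sum tendsto_mult tendsto_jacobi_inner_chebT[OF \<gamma>] tendsto_jacobi_cheb_coeff less.IH) auto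
  also have "\<gamma> * cheb_limit_coeff (- L) i - (\<Sum>l\<in>{1..i}. cheb_limit_coeff L l * (\<gamma> * cheb_limit_coeff (- 2 * L) (i - l)))
      = \<gamma> * cheb_limit_coeff (- 2 * L) i"
  proof -
    have "{..i} = insert 0 {1..i}" by auto
    then have "cheb_limit_coeff (- L) i = cheb_limit_coeff (- 2 * L) i +
        (\<Sum>l\<in>{1..i}. cheb_limit_coeff L l * cheb_limit_coeff (- 2 * L) (i - l))"
      using cheb_limit_coeff_convolution[of L "- 2 * L" i] by simp
    then show ?thesis by (simp add: sum_distrib_left algebra_simps)
  qed
  finally show ?case
    using Lim_transform_eventually[OF _ ev] by (simp add: L_def)
qed

end

subsection \<open>Norms of the orthogonal polynomials\<close>

text \<open>The substitution x = 2 t - 1 gives a Beta integral, which the duplication formula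
  simplifies.\<close>

lemma gegenbauer_inner_1_1:
  assumes \<alpha>: "\<alpha> > -1"
  shows "gegenbauer_inner \<alpha> 1 1 = sqrt pi * Gamma (\<alpha> + 1) / Gamma (\<alpha> + 3/2)"
proof -
  define f where "f = (\<lambda>t::real. t powr \<alpha> * (1 - t) powr \<alpha>)"
  have "(f has_integral Beta (\<alpha> + 1) (\<alpha> + 1)) (cbox 0 1)"
    using has_integral_Beta_real[of "\<alpha> + 1" "\<alpha> + 1"] \<alpha> by (simp add: f_def)
  then have "((\<lambda>x. f ((1/2) *\<^sub>R x + 1/2)) has_integral 2 * Beta (\<alpha> + 1) (\<alpha> + 1))
      ((\<lambda>x. 2 *\<^sub>R x + - 1) ` cbox 0 1)"
    using has_integral_affinity[of f _ 0 1 "1/2" "1/2"] by simp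
  moreover have "(\<lambda>x. 2 *\<^sub>R x + - 1) ` cbox 0 1 = {-1..1::real}"
    using image_affinity_atLeastAtMost[of 2 "-1" "0::real" 1] by simp
  ultimately have "((\<lambda>x. f (1/2 * x + 1/2)) has_integral 2 * Beta (\<alpha> + 1) (\<alpha> + 1)) {-1<..<1}"
    by (simp add: has_integral_Icc_iff_Ioo)
  then have "((\<lambda>x. 4 powr \<alpha> * f (1/2 * x + 1/2)) has_integral 4 powr \<alpha> * (2 * Beta (\<alpha> + 1) (\<alpha> + 1))) {-1<..<1}"
    by (rule has_integral_mult_right)
  moreover have "4 powr \<alpha> * f (1/2 * x + 1/2) = gegenbauer_weight \<alpha> x" if "x \<in> {-1<..<1}" for x
  proof -
    have "1 - x\<^sup>2 = 4 * ((1/2 * x + 1/2) * (1 - (1/2 * x + 1/2)))"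
      by (simp add: field_simps power2_eq_square)
    then show ?thesis
      using that by (simp only: f_def powr_mult gegenbauer_weight_def)
  qed
  ultimately have "(gegenbauer_weight \<alpha> has_integral 4 powr \<alpha> * (2 * Beta (\<alpha> + 1) (\<alpha> + 1))) {-1<..<1}"
    by (subst has_integral_cong[symmetric]) auto
  then have "gegenbauer_inner \<alpha> 1 1 = 4 powr \<alpha> * (2 * Beta (\<alpha> + 1) (\<alpha> + 1))"
    using set_borel_integral_eq_integral(2)[OF set_integrable_gegenbauer_weight[OF \<alpha>]]
    by (simp add: gegenbauer_inner_def integral_unique)
  also have "\<dots> = sqrt pi * Gamma (\<alpha> + 1) / Gamma (\<alpha> + 3/2)"
  proof -
    define P where "P = (4::real) powr \<alpha>"
    have P: "P > 0" by (simp add: P_def)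
    have "2 powr (1 - 2 * (\<alpha> + 1)) = 1 / (2 * P)"
    proof -
      have "(2::real) powr (1 - 2 * (\<alpha> + 1)) = 2 powr (- 1) * 2 powr (- (2 * \<alpha>))"
      proof -
        have "1 - 2 * (\<alpha> + 1) = - 1 + - (2 * \<alpha>)" by simp
        then show ?thesis by (simp only: powr_add)
      qed
      also have "(2::real) powr (- (2 * \<alpha>)) = 1 / P"
        by (simp add: P_def powr_minus_divide powr_powr[symmetric])
      finally show ?thesis by (simp add: powr_minus)
    qed
    then have dup: "Gamma (\<alpha> + 1) * Gamma (\<alpha> + 3/2) = 1 / (2 * P) * sqrt pi * Gamma (2 * \<alpha> + 2)"
      using Gamma_duplication_real[of "\<alpha> + 1"] \<alpha> by (simp add: algebra_simps)
    have pos: "Gamma (\<alpha> + 1) > 0" "Gamma (\<alpha> + 3/2) > 0" "Gamma (2 * \<alpha> + 2) > 0"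
      using \<alpha> by (auto intro!: Gamma_real_pos)
    have "Beta (\<alpha> + 1) (\<alpha> + 1) = Gamma (\<alpha> + 1) * Gamma (\<alpha> + 1) / Gamma (2 * \<alpha> + 2)"
      by (simp add: Beta_def algebra_simps)
    also have "\<dots> = sqrt pi * Gamma (\<alpha> + 1) / (2 * P * Gamma (\<alpha> + 3/2))"
      using dup pos P by (simp add: field_simps)
    finally show ?thesis using P by (simp add: P_def)
  qed
  finally show ?thesis .
qed

lemma pderiv_sum: "pderiv (sum f A) = (\<Sum>x\<in>A. pderiv (f x))"
  by (induction A rule: infinite_finite_induct) (simp_all add: pderiv_add)

lemma poly_antiderivative:
  fixes q :: "'a::field_char_0 poly"
  shows "\<exists>Q. pderiv Q = q \<and> degree Q \<le> Suc (degree q)"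
proof (intro exI conjI)
  let ?Q = "\<Sum>i\<le>degree q. monom (coeff q i / of_nat (Suc i)) (Suc i)"
  show "pderiv ?Q = q"
    by (subst (3) poly_as_sum_of_monoms[symmetric])
      (simp add: pderiv_sum pderiv_monom del: of_nat_Suc)
  show "degree ?Q \<le> Suc (degree q)"
    by (intro degree_sum_le) (auto intro: order.trans[OF degree_monom_le])
qed

text \<open>A test polynomial q of degree below n is Q' with Q of degree at most n. Integration by
  parts moves the derivatives onto p, where they act as a multiple of p, and p is orthogonal to
  Q.\<close>

lemma gegenbauer_orthopoly_pderiv:
  assumes \<alpha>: "\<alpha> > -1" and p: "gegenbauer_orthopoly \<alpha> (Suc n) p"
  shows "gegenbauer_orthopoly (\<alpha> + 1) n (pderiv p)"
proof -
  have deg: "degree p = Suc n" and ort: "\<And>q. degree q < Suc n \<Longrightarrow> gegenbauer_inner \<alpha> p q = 0"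
    using p by (auto simp: gegenbauer_orthopoly_def)
  have "gegenbauer_inner (\<alpha> + 1) (pderiv p) q = 0" if q: "degree q < n" for q
  proof -
    obtain Q where Q: "pderiv Q = q" "degree Q \<le> Suc (degree q)"
      using poly_antiderivative by blast
    have "gegenbauer_inner (\<alpha> + 1) (pderiv p) q = - gegenbauer_inner \<alpha> (gegenbauer_op \<alpha> p) Q"
      using gegenbauer_inner_pderiv[OF \<alpha>, of p Q] Q by simp
    also have "\<dots> = 0"
      using gegenbauer_orthopoly_eigen[OF \<alpha> p] ort[of Q] Q q by (simp add: gegenbauer_inner_smult del: smult_minus_left of_nat_Suc)
    finally show ?thesis .
  qed
  then show ?thesis
    using deg by (auto simp: gegenbauer_orthopoly_def degree_pderiv pderiv_eq_0_iff)
qed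

text \<open>Each differentiation lowers the degree and raises \<alpha> by one; passing to the monic
  derivative costs a factor (n + 1) / (n + 2 \<alpha> + 2) for degree n + 1. The degree reaches zero
  at parameter \<alpha> + n.\<close>

lemma gegenbauer_orthopoly_norm:
  assumes "\<alpha> > -1" "gegenbauer_orthopoly \<alpha> n p" "lead_coeff p = 1"
  shows "gegenbauer_inner \<alpha> p p = fact n / pochhammer (real n + 2 * \<alpha> + 1) n * gegenbauer_inner (\<alpha> + real n) 1 1"
  using assms
proof (induction n arbitrary: \<alpha> p)
  case 0
  then have "degree p = 0" "lead_coeff p = 1" by (auto simp: gegenbauer_orthopoly_def)
  then have "p = 1" by (metis degree_0_id one_poly_eq_simps(1) lead_coeff_1 coeff_pCons_0 degree_eq_zeroE one_pCons)
  then show ?case by simp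
next
  case (Suc n)
  have deg: "degree p = Suc n" using Suc.prems by (simp add: gegenbauer_orthopoly_def)
  define q where "q = smult (1 / real (Suc n)) (pderiv p)"
  have q: "gegenbauer_orthopoly (\<alpha> + 1) n q"
    using gegenbauer_orthopoly_pderiv[OF Suc.prems(1,2)]
    by (simp add: gegenbauer_orthopoly_def q_def gegenbauer_inner_smult)
  have "lead_coeff q = 1"
    using Suc.prems(3) deg by (simp add: q_def degree_pderiv coeff_pderiv)
  then have IH: "gegenbauer_inner (\<alpha> + 1) q q =
      fact n / pochhammer (real n + 2 * (\<alpha> + 1) + 1) n * gegenbauer_inner (\<alpha> + 1 + real n) 1 1"
    using Suc.IH[of "\<alpha> + 1" q] q Suc.prems(1) by simp
  define b where "b = real n + 2 * \<alpha> + 2"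
  have b: "b > 0" using Suc.prems(1) by (simp add: b_def)
  have "gegenbauer_inner (\<alpha> + 1) q q = 1 / (real (Suc n))\<^sup>2 * gegenbauer_inner (\<alpha> + 1) (pderiv p) (pderiv p)"
    by (simp add: q_def gegenbauer_inner_smult gegenbauer_inner_smult_right power2_eq_square)
  also have "gegenbauer_inner (\<alpha> + 1) (pderiv p) (pderiv p) = real (Suc n) * b * gegenbauer_inner \<alpha> p p"
    using gegenbauer_inner_pderiv[OF Suc.prems(1), of p p] gegenbauer_orthopoly_eigen[OF Suc.prems(1,2)]
    by (simp add: gegenbauer_inner_smult b_def algebra_simps del: smult_minus_left)
  finally have "gegenbauer_inner \<alpha> p p = real (Suc n) / b * gegenbauer_inner (\<alpha> + 1) q q"
    using b by (simp add: power2_eq_square del: of_nat_Suc)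
  also have "\<dots> = fact (Suc n) / (b * pochhammer (b + 1) n) * gegenbauer_inner (\<alpha> + real (Suc n)) 1 1"
    unfolding IH by (simp add: b_def algebra_simps)
  also have "b * pochhammer (b + 1) n = pochhammer b (Suc n)"
    by (simp add: pochhammer_rec)
  finally show ?case
    by (simp add: b_def algebra_simps)
qed

text \<open>With p the monic multiple of the Jacobi polynomial, T_n differs from 2^(n-1) p by a
  polynomial of lower degree, which orthogonality removes. The Jacobi polynomial contributes another
  2^(n-1), hence 4^n / 2.\<close>

lemma jacobi_inner_chebT_eq_norm:
  assumes \<alpha>: "\<alpha> > -1" and n: "n \<ge> 1"
  shows "2 * gegenbauer_inner \<alpha> (jacobi_poly \<alpha> n) (chebT n) / jacobi_cheb_coeff \<alpha> n n =
    4 ^ n / 2 * (fact n / pochhammer (real n + 2 * \<alpha> + 1) n * gegenbauer_inner (\<alpha> + real n) 1 1)"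
proof -
  obtain m where m: "n = Suc m" using n by (cases n) auto
  define c where "c = jacobi_cheb_coeff \<alpha> n n"
  define J where "J = jacobi_poly \<alpha> n"
  have c: "c \<noteq> 0" using jacobi_cheb_coeff_nonzero[OF \<alpha> n] by (simp add: c_def)
  have deg: "degree J = n" using jacobi_poly(1)[OF \<alpha>] by (simp add: J_def)
  have lead: "coeff J n = 2 ^ m * c"
    using lead_coeff_jacobi_poly_cheb[OF \<alpha>, of m] by (simp add: J_def c_def m)
  have oJ: "gegenbauer_orthopoly \<alpha> n J"
    unfolding J_def by (rule gegenbauer_orthopoly_jacobi_poly[OF \<alpha> n])
  define p where "p = smult (1 / (2 ^ m * c)) J"
  have op: "gegenbauer_orthopoly \<alpha> n p"
    using oJ c by (simp add: gegenbauer_orthopoly_def p_def gegenbauer_inner_smult)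
  have lp: "lead_coeff p = 1"
    using lead deg c by (simp add: p_def)
  define d where "d = chebT n - smult (2 ^ m) p"
  have "coeff d n = 0"
    using coeff_chebT_Suc[of m] m lead c by (simp add: d_def p_def)
  moreover have "degree d \<le> n"
    unfolding d_def using degree_chebT[of n] deg by (intro degree_diff_le) (auto simp: p_def)
  ultimately have "degree d < n"
    using n by (metis degree_0 le_neq_implies_less leading_coeff_0_iff less_le_trans zero_less_one)
  then have "gegenbauer_inner \<alpha> J d = 0"
    using oJ by (simp add: gegenbauer_orthopoly_def)
  then have "gegenbauer_inner \<alpha> J (chebT n) = 2 ^ m * gegenbauer_inner \<alpha> J p"
    by (simp add: d_def gegenbauer_inner_diff_right[OF \<alpha>] gegenbauer_inner_smult_right)
  also have "J = smult (2 ^ m * c) p"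
    using c by (simp add: p_def)
  then have "gegenbauer_inner \<alpha> J p = 2 ^ m * c * gegenbauer_inner \<alpha> p p"
    by (metis gegenbauer_inner_smult)
  finally have "2 * gegenbauer_inner \<alpha> J (chebT n) / c = 2 * (2 ^ m * 2 ^ m) * gegenbauer_inner \<alpha> p p"
    using c by simp
  also have "2 * (2 ^ m * 2 ^ m) = (4 ^ n / 2 :: real)"
    by (simp add: m power_mult_distrib[symmetric])
  finally show ?thesis
    using gegenbauer_orthopoly_norm[OF \<alpha> op lp] by (simp add: J_def c_def)
qed

text \<open>Euler's limit for Gamma (z + 1), with the Pochhammer symbol written as a quotient of
  Gamma values.\<close>

lemma tendsto_Gamma_ratio:
  fixes z :: real
  assumes z: "z > -1"
  shows "(\<lambda>n. fact n * real n powr z / Gamma (real n + z + 1)) \<longlonglongrightarrow> 1"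
proof -
  have G: "Gamma (z + 1) > 0" using z by (intro Gamma_real_pos) auto
  have "(\<lambda>n. Gamma_series (z + 1) n / Gamma (z + 1) * ((real n + (z + 1)) / (real n + 0)))
      \<longlonglongrightarrow> Gamma (z + 1) / Gamma (z + 1) * 1"
    using G by (intro tendsto_intros Gamma_series_LIMSEQ tendsto_rational_ratio) auto
  moreover have "eventually (\<lambda>n. Gamma_series (z + 1) n / Gamma (z + 1) * ((real n + (z + 1)) / (real n + 0)) =
      fact n * real n powr z / Gamma (real n + z + 1)) sequentially"
    using eventually_ge_at_top[of 1]
  proof eventually_elim
    case (elim n)
    have ni: "z + 1 \<notin> \<int>\<^sub>\<le>\<^sub>0" "real n + z + 1 \<notin> \<int>\<^sub>\<le>\<^sub>0"
      using z elim by (auto simp: nonpos_Ints_def)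
    have "pochhammer (z + 1) (Suc n) = Gamma (z + 1 + real (Suc n)) / Gamma (z + 1)"
      by (rule pochhammer_Gamma[OF ni(1)])
    also have "z + 1 + real (Suc n) = (real n + z + 1) + 1" by simp
    also have "Gamma \<dots> = (real n + z + 1) * Gamma (real n + z + 1)"
      by (rule Gamma_plus1[OF ni(2)])
    finally have poch: "pochhammer (z + 1) (Suc n) = (real n + z + 1) * Gamma (real n + z + 1) / Gamma (z + 1)" .
    have E: "exp ((z + 1) * of_real (ln (real n))) = real n powr z * real n"
      using elim by (simp add: powr_def algebra_simps exp_add)
    define b g where "b = real n + z + 1" and "g = Gamma b"
    have "b > 0" "g > 0" using z by (auto simp: b_def g_def)
    moreover have "real n + (z + 1) = b" by (simp add: b_def)
    ultimately show ?case
      using G elim unfolding Gamma_series_def E poch[unfolded Suc_eq_plus1] b_def[symmetric] g_def[symmetric]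
      by (simp add: field_simps)
  qed
  ultimately show ?thesis
    using Lim_transform_eventually G by fastforce
qed

text \<open>Duplication cancels 4^n and Gamma (2 z), leaving a quotient of a factorial and Gamma
  values with arguments near n.\<close>

lemma tendsto_jacobi_inner_chebT_lead:
  assumes \<alpha>: "\<alpha> > -1"
  shows "(\<lambda>n. 2 * gegenbauer_inner \<alpha> (jacobi_poly \<alpha> n) (chebT n) / jacobi_cheb_coeff \<alpha> n n)
    \<longlonglongrightarrow> pi / 2 powr (2 * \<alpha> + 1)"
proof -
  define l L where "l = \<alpha> + 1/2" and "L = 2 * \<alpha> + 1"
  have l: "l > -1/2" and L: "L > -1" and Ll: "L = l + l" using \<alpha> by (auto simp: l_def L_def)
  define \<phi> where "\<phi> = (\<lambda>z n. fact n * real n powr z / Gamma (real n + z + 1))"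
  have "(\<lambda>n. pi / 2 powr L * ((real n + l) / (real n + L) * (\<phi> l n * \<phi> l n / \<phi> L n))) \<longlonglongrightarrow> pi / 2 powr L * (1 * (1 * 1 / 1))"
    unfolding \<phi>_def using l L by (intro tendsto_intros tendsto_rational_ratio tendsto_Gamma_ratio) auto
  moreover have "eventually (\<lambda>n. pi / 2 powr L * ((real n + l) / (real n + L) * (\<phi> l n * \<phi> l n / \<phi> L n)) =
      2 * gegenbauer_inner \<alpha> (jacobi_poly \<alpha> n) (chebT n) / jacobi_cheb_coeff \<alpha> n n) sequentially"
    using eventually_ge_at_top[of 1]
  proof eventually_elim
    case (elim n)
    define z where "z = real n + l"
    define y where "y = real n + L"
    have z: "z > 0" "y > 0" using l L elim by (auto simp: z_def y_def)
    have ni: "z \<notin> \<int>\<^sub>\<le>\<^sub>0" "y \<notin> \<int>\<^sub>\<le>\<^sub>0" using z by (auto simp: nonpos_Ints_def)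
    have G1: "Gamma (real n + l + 1) = z * Gamma z" "Gamma (real n + L + 1) = y * Gamma y"
      using Gamma_plus1[OF ni(1)] Gamma_plus1[OF ni(2)] by (simp_all add: z_def y_def)
    have W: "gegenbauer_inner (\<alpha> + real n) 1 1 = sqrt pi * Gamma (z + 1/2) / (z * Gamma z)"
      using gegenbauer_inner_1_1[of "\<alpha> + real n"] \<alpha> Gamma_plus1[OF ni(1)]
      by (simp add: z_def l_def algebra_simps)
    have poch: "pochhammer (real n + 2 * \<alpha> + 1) n = Gamma (2 * z) / Gamma y"
      using pochhammer_Gamma[OF ni(2), of n] by (simp add: y_def z_def l_def L_def algebra_simps)
    have dup: "Gamma z * Gamma (z + 1/2) = 2 / (4 ^ n * 2 powr L) * sqrt pi * Gamma (2 * z)"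
    proof -
      have "1 - 2 * z = 1 - (real (2 * n) + L)" by (simp add: z_def Ll)
      then have "2 powr (1 - 2 * z) = 2 powr 1 / (2 powr real (2 * n) * 2 powr L)"
        by (simp only: powr_diff powr_add)
      also have "(2::real) powr real (2 * n) = 4 ^ n"
        by (subst powr_realpow) (simp_all add: power_mult)
      finally show ?thesis using Gamma_duplication_real[OF z(1)] by simp
    qed
    define g h k d N where "g = Gamma z" and "h = Gamma (z + 1/2)" and "k = Gamma y"
      and "d = Gamma (2 * z)" and "N = real n powr l"
    have pos: "g > 0" "h > 0" "k > 0" "d > 0" using z by (auto simp: g_def h_def k_def d_def)
    have N: "N > 0" "real n powr L = N * N" using elim by (auto simp: N_def Ll powr_add[symmetric])
    have dup': "g * h = 2 / (4 ^ n * 2 powr L) * sqrt pi * d"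
      using dup by (simp add: g_def h_def d_def)
    have "2 * gegenbauer_inner \<alpha> (jacobi_poly \<alpha> n) (chebT n) / jacobi_cheb_coeff \<alpha> n n =
        4 ^ n / 2 * (fact n / (d / k) * (sqrt pi * h / (z * g)))"
      unfolding jacobi_inner_chebT_eq_norm[OF \<alpha> elim] W poch by (simp add: g_def h_def k_def d_def)
    also have "h = 2 / (4 ^ n * 2 powr L) * sqrt pi * d / g"
      using dup' pos by (simp add: field_simps)
    also have "4 ^ n / 2 * (fact n / (d / k) * (sqrt pi * (2 / (4 ^ n * 2 powr L) * sqrt pi * d / g) / (z * g)))
      = pi / 2 powr L * (fact n * k / (z * g * g))"
      using pos z by (simp add: field_simps)
    \<comment> \<open>Inserting factorials and powers of n produces three quotients of the kind in
      \<open>tendsto_Gamma_ratio\<close>; the insertions cancel because L = 2 l.\<close>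
    also have "fact n * k / (z * g * g) = z / y * ((fact n * N / (z * g)) * (fact n * N / (z * g)) / (fact n * (N * N) / (y * k)))"
      using pos z N(1) by (simp add: field_simps)
    also have "\<dots> = (real n + l) / (real n + L) * (\<phi> l n * \<phi> l n / \<phi> L n)"
      unfolding \<phi>_def G1 N(2) by (simp add: g_def k_def N_def z_def y_def)
    finally show ?case by simp
  qed
  ultimately show ?thesis
    using Lim_transform_eventually unfolding L_def by fastforce
qed

subsection \<open>Chebyshev expansion on a Bernstein ellipse\<close>

definition joukowski :: "complex \<Rightarrow> complex" where
  "joukowski w = (w + inverse w) / 2"

lemma joukowski_polar:
  assumes "\<rho> > 0"
  shows "joukowski (of_real \<rho> * exp (\<i> * of_real \<theta>)) =
    Complex ((\<rho> + 1 / \<rho>) / 2 * cos \<theta>) ((\<rho> - 1 / \<rho>) / 2 * sin \<theta>)"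
proof -
  have "inverse (exp (\<i> * of_real \<theta>)) = cis (- \<theta>)"
    by (simp add: exp_minus[symmetric] cis_conv_exp)
  then have "inverse (of_real \<rho> * exp (\<i> * of_real \<theta>)) = of_real (1 / \<rho>) * cis (- \<theta>)"
    by (simp add: divide_inverse)
  then show ?thesis
    by (simp add: joukowski_def complex_eq_iff cis_conv_exp[symmetric] algebra_simps diff_divide_distrib add_divide_distrib)
qed

text \<open>The real-linear map that carries the ellipse to the unit circle; the filled ellipse
  becomes a preimage of the closed disc and is therefore convex.\<close>

definition ellipse_scale :: "real \<Rightarrow> complex \<Rightarrow> complex" where
  "ellipse_scale \<rho> z = Complex (Re z / ((\<rho> + 1 / \<rho>) / 2)) (Im z / ((\<rho> - 1 / \<rho>) / 2))"

context
  fixes \<rho> :: real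
  assumes \<rho>: "\<rho> > 1"
begin

lemma semi_axes: "(\<rho> + 1 / \<rho>) / 2 > 1" "(\<rho> - 1 / \<rho>) / 2 > 0"
proof -
  have "0 < (\<rho> - 1)\<^sup>2" using \<rho> by simp
  then show "(\<rho> + 1 / \<rho>) / 2 > 1" using \<rho> by (simp add: field_simps power2_eq_square)
  have "1 / \<rho> < 1" using \<rho> by simp
  then have "1 / \<rho> < \<rho>" using \<rho> by linarith
  then show "(\<rho> - 1 / \<rho>) / 2 > 0" by simp
qed

lemma bernstein_ellipse_eq: "bernstein_ellipse \<rho> = {z. cmod (ellipse_scale \<rho> z) = 1}"
proof (intro set_eqI iffI)
  fix z assume "z \<in> bernstein_ellipse \<rho>"
  then obtain \<theta> where "z = joukowski (of_real \<rho> * exp (\<i> * of_real \<theta>))"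
    by (auto simp: bernstein_ellipse_def joukowski_def)
  then have "ellipse_scale \<rho> z = cis \<theta>"
    using semi_axes \<rho> by (simp add: joukowski_polar ellipse_scale_def complex_eq_iff)
  then show "z \<in> {z. cmod (ellipse_scale \<rho> z) = 1}" by simp
next
  fix z assume "z \<in> {z. cmod (ellipse_scale \<rho> z) = 1}"
  then have "(Re (ellipse_scale \<rho> z))\<^sup>2 + (Im (ellipse_scale \<rho> z))\<^sup>2 = 1"
    by (simp add: cmod_power2[symmetric])
  then obtain \<theta> where \<theta>: "0 \<le> \<theta>" "\<theta> < 2 * pi" "Re (ellipse_scale \<rho> z) = cos \<theta>" "Im (ellipse_scale \<rho> z) = sin \<theta>"
    using sincos_total_2pi by metis
  then have "z = joukowski (of_real \<rho> * exp (\<i> * of_real \<theta>))"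
    using semi_axes \<rho> by (auto simp: joukowski_polar ellipse_scale_def complex_eq_iff field_simps)
  then show "z \<in> bernstein_ellipse \<rho>"
    using \<theta> unfolding bernstein_ellipse_def joukowski_def by force
qed

lemma linear_ellipse_scale: "linear (ellipse_scale \<rho>)"
  by (rule linearI) (simp_all add: ellipse_scale_def complex_eq_iff add_divide_distrib)

lemma joukowski_circle:
  assumes "cmod w = \<rho>"
  shows "joukowski w \<in> bernstein_ellipse \<rho>"
proof -
  obtain \<theta> where \<theta>: "0 \<le> \<theta>" "\<theta> < 2 * pi" "Re (w / of_real \<rho>) = cos \<theta>" "Im (w / of_real \<rho>) = sin \<theta>"
  proof -
    have "(Re (w / of_real \<rho>))\<^sup>2 + (Im (w / of_real \<rho>))\<^sup>2 = (cmod (w / of_real \<rho>))\<^sup>2"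
      by (rule cmod_power2[symmetric])
    also have "\<dots> = 1" using assms \<rho> by (simp add: norm_divide)
    finally show ?thesis using sincos_total_2pi that by metis
  qed
  then have "w / of_real \<rho> = exp (\<i> * of_real \<theta>)"
    by (simp add: cis_conv_exp[symmetric] complex_eq_iff)
  then have "w = of_real \<rho> * exp (\<i> * of_real \<theta>)"
    using \<rho> by (simp add: field_simps)
  then show ?thesis
    using \<theta> unfolding bernstein_ellipse_def joukowski_def by force
qed

lemma norm_ellipse_scale_real_less:
  assumes "x \<in> {-1<..<1}"
  shows "cmod (ellipse_scale \<rho> (of_real x)) < 1"
proof -
  have "cmod (ellipse_scale \<rho> (of_real x)) = \<bar>x\<bar> / ((\<rho> + 1 / \<rho>) / 2)"
    using semi_axes(1) by (simp add: ellipse_scale_def complex_norm)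
  also have "\<dots> < 1"
    using semi_axes(1) assms by (subst divide_less_eq_1_pos) auto
  finally show ?thesis .
qed

text \<open>
  On the connected component of an interior point off the ellipse, the norm of \<^term>\<open>ellipse_scale \<rho>\<close>
  omits the value 1, hence stays below 1, so the component is bounded.
\<close>

lemma solid_ellipse_subset:
  "{z. cmod (ellipse_scale \<rho> z) \<le> 1} \<subseteq> bernstein_ellipse \<rho> \<union> inside (bernstein_ellipse \<rho>)"
proof
  fix z assume z: "z \<in> {z. cmod (ellipse_scale \<rho> z) \<le> 1}"
  let ?S = "bernstein_ellipse \<rho>"
  let ?q = "\<lambda>z. cmod (ellipse_scale \<rho> z)"
  have cont: "continuous_on A ?q" for A
    using linear_ellipse_scale by (intro continuous_on_norm linear_continuous_on linear_conv_bounded_linear[THEN iffD1])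
  show "z \<in> ?S \<union> inside ?S"
  proof (cases "z \<in> ?S")
    case False
    then have qz: "?q z < 1" using z by (auto simp: bernstein_ellipse_eq)
    define C where "C = connected_component_set (- ?S) z"
    have CS: "C \<subseteq> - ?S" unfolding C_def by (rule connected_component_subset)
    have conn: "connected (?q ` C)"
      unfolding C_def by (intro connected_continuous_image cont connected_connected_component)
    have "?q y < 1" if y: "y \<in> C" for y
    proof (rule ccontr)
      assume "\<not> ?q y < 1"
      have "z \<in> C" using False by (simp add: C_def)
      then have "1 \<in> ?q ` C"
        using connectedD_interval[OF conn, of "?q z" "?q y" 1] y qz \<open>\<not> ?q y < 1\<close> by auto
      then show False using CS by (auto simp: bernstein_ellipse_eq)
    qed
    moreover have "bounded {y. ?q y < 1}"
    proof (rule boundedI)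
      fix y assume "y \<in> {y. ?q y < 1}"
      then have "\<bar>Re (ellipse_scale \<rho> y)\<bar> < 1" "\<bar>Im (ellipse_scale \<rho> y)\<bar> < 1"
        using abs_Re_le_cmod[of "ellipse_scale \<rho> y"] abs_Im_le_cmod[of "ellipse_scale \<rho> y"] by auto
      then have "\<bar>Re y\<bar> < (\<rho> + 1 / \<rho>) / 2" "\<bar>Im y\<bar> < (\<rho> - 1 / \<rho>) / 2"
        using semi_axes by (auto simp: ellipse_scale_def abs_divide)
      then show "norm y \<le> (\<rho> + 1 / \<rho>) / 2 + (\<rho> - 1 / \<rho>) / 2"
        using cmod_le[of y] by linarith
    qed
    ultimately have "bounded C"
      by (meson bounded_subset mem_Collect_eq subsetI)
    then show ?thesis
      using False by (simp add: inside_def C_def)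
  qed simp
qed

section \<open>The Cauchy kernel in the variable w\<close>

lemma joukowski_kernel_partial_fractions:
  assumes x: "x = cos \<phi>" and w: "cmod w > 1"
  shows "(1 - inverse w ^ 2) / 2 / (joukowski w - of_real x) = 1 / (w - cis \<phi>) + 1 / (w - cis (- \<phi>)) - 1 / w"
proof -
  have nz: "w \<noteq> 0" "w \<noteq> cis \<phi>" "w \<noteq> cis (- \<phi>)" using w by auto
  have s: "cis \<phi> + cis (- \<phi>) = of_real (2 * x)" by (simp add: x complex_eq_iff)
  have p: "cis \<phi> * cis (- \<phi>) = 1" by (simp add: cis_mult)
  \<comment> \<open>For x = cos \<phi> the zeros of the quadratic are cis \<phi> and its inverse,
    both on the unit circle and hence inside the contour.\<close>
  have D: "(w - cis \<phi>) * (w - cis (- \<phi>)) = w\<^sup>2 - of_real (2 * x) * w + 1"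
    unfolding s[symmetric] p[symmetric] by (simp add: algebra_simps power2_eq_square)
  have D0: "w\<^sup>2 - of_real (2 * x) * w + 1 \<noteq> 0"
    unfolding D[symmetric] using nz by simp
  have J: "joukowski w - of_real x = (w\<^sup>2 - of_real (2 * x) * w + 1) / (2 * w)"
    using nz by (simp add: joukowski_def field_simps power2_eq_square)
  have "1 / (w - cis \<phi>) + 1 / (w - cis (- \<phi>)) = (2 * w - (cis \<phi> + cis (- \<phi>))) / ((w - cis \<phi>) * (w - cis (- \<phi>)))"
    using nz by (simp add: divide_simps)
  then have "1 / (w - cis \<phi>) + 1 / (w - cis (- \<phi>)) - 1 / w =
      (2 * w - of_real (2 * x)) / (w\<^sup>2 - of_real (2 * x) * w + 1) - 1 / w"
    unfolding D s by simp
  also have "\<dots> = (w\<^sup>2 - 1) / (w * (w\<^sup>2 - of_real (2 * x) * w + 1))"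
    using nz D0 by (simp add: divide_simps) (simp add: algebra_simps power2_eq_square)
  also have "\<dots> = (1 - inverse w ^ 2) / 2 / (joukowski w - of_real x)"
    unfolding J using nz D0 by (simp add: divide_simps) (simp add: algebra_simps power2_eq_square)
  finally show "(1 - inverse w ^ 2) / 2 / (joukowski w - of_real x) = 1 / (w - cis \<phi>) + 1 / (w - cis (- \<phi>)) - 1 / w"
    by simp
qed

text \<open>The generating function (1 - y^2) / (1 - 2 x y + y^2) of the Chebyshev polynomials, cut
  off at N with an exact remainder.\<close>

lemma cheb_generating_identity:
  fixes y :: complex and x :: real
  shows "1 - y\<^sup>2 = (1 - 2 * of_real x * y + y\<^sup>2) * (1 + 2 * (\<Sum>k=1..N. of_real (poly (chebT k) x) * y ^ k))
      + 2 * (of_real (poly (chebT (Suc N)) x) * y ^ Suc N - of_real (poly (chebT N) x) * y ^ (N + 2))"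
proof (induction N)
  case 0
  then show ?case by (simp add: algebra_simps power2_eq_square)
next
  case (Suc N)
  have T: "of_real (poly (chebT (Suc (Suc N))) x) = (2 * of_real x * of_real (poly (chebT (Suc N)) x) - of_real (poly (chebT N) x) :: complex)"
    by (simp add: poly_chebT_Suc_Suc)
  then show ?case
    unfolding Suc by (simp add: T algebra_simps power2_eq_square)
qed

text \<open>With y = 1 / w the kernel is y (1 - y^2) / D, to which the truncated generating function
  applies. Since D factors as (1 - y cis \<phi>) (1 - y cis (- \<phi>)), its modulus is at least (1
  - 1/\<rho>)^2.\<close>

lemma joukowski_kernel_expansion:
  assumes x: "x \<in> {-1<..<1}" and w: "cmod w = \<rho>"
  shows "cmod ((1 - inverse w ^ 2) / 2 / (joukowski w - of_real x) -
      inverse w * (1 + 2 * (\<Sum>k=1..N. of_real (poly (chebT k) x) * inverse w ^ k)))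
    \<le> 4 / (\<rho> * (1 - 1 / \<rho>)\<^sup>2) * (1 / \<rho>) ^ N"
proof -
  define \<phi> where "\<phi> = arccos x"
  have x\<phi>: "x = cos \<phi>" using x by (simp add: \<phi>_def)
  define y where "y = inverse w"
  have w1: "cmod w > 1" "w \<noteq> 0" using w \<rho> by auto
  have ny: "cmod y = 1 / \<rho>" using w by (simp add: y_def norm_inverse divide_inverse)
  have ny1: "1 / \<rho> < 1" "0 < 1 / \<rho>" using \<rho> by auto
  define D where "D = 1 - 2 * of_real x * y + y\<^sup>2"
  have D: "D = (1 - y * cis \<phi>) * (1 - y * cis (- \<phi>))"
  proof -
    have "(1 - y * cis \<phi>) * (1 - y * cis (- \<phi>)) = 1 - (cis \<phi> + cis (- \<phi>)) * y + cis \<phi> * cis (- \<phi>) * y\<^sup>2"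
      by (simp add: algebra_simps power2_eq_square)
    also have "cis \<phi> + cis (- \<phi>) = 2 * of_real x" by (simp add: x\<phi> complex_eq_iff)
    also have "cis \<phi> * cis (- \<phi>) = 1" by (simp add: cis_mult)
    finally show ?thesis by (simp add: D_def)
  qed
  have lb: "1 - 1 / \<rho> \<le> cmod (1 - y * cis t)" for t
    using norm_triangle_ineq2[of 1 "y * cis t"] ny by (simp add: norm_mult)
  have Dlb: "(1 - 1 / \<rho>)\<^sup>2 \<le> cmod D"
    unfolding D norm_mult power2_eq_square using ny1 lb by (intro mult_mono) auto
  have D0: "D \<noteq> 0"
  proof
    assume "D = 0"
    then show False using Dlb ny1 by (simp add: power2_eq_square mult_le_0_iff)
  qed
  define P where "P = 1 + 2 * (\<Sum>k=1..N. of_real (poly (chebT k) x) * y ^ k)"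
  define R where "R = of_real (poly (chebT (Suc N)) x) * y ^ Suc N - of_real (poly (chebT N) x) * y ^ (N + 2)"
  have J: "joukowski w - of_real x = D / (2 * y)"
    using w1(2) by (simp add: joukowski_def D_def y_def field_simps power2_eq_square)
  have y0: "y \<noteq> 0" using w1(2) by (simp add: y_def)
  have id: "1 - y\<^sup>2 = D * P + 2 * R"
    unfolding D_def P_def R_def by (rule cheb_generating_identity)
  have "(1 - inverse w ^ 2) / 2 / (joukowski w - of_real x) = y * (1 - y\<^sup>2) / D"
    unfolding J y_def[symmetric] using y0 D0 by (simp add: field_simps)
  also have "\<dots> - y * P = 2 * y * R / D"
    unfolding id using D0 by (simp add: field_simps)
  finally have eq: "(1 - inverse w ^ 2) / 2 / (joukowski w - of_real x) - inverse w * P = 2 * y * R / D"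
    by (simp add: y_def)
  have T1: "cmod (of_real (poly (chebT k) x)) \<le> 1" for k
    using abs_poly_chebT_le_1[of x k] x by simp
  have "cmod R \<le> cmod (of_real (poly (chebT (Suc N)) x) * y ^ Suc N) + cmod (of_real (poly (chebT N) x) * y ^ (N + 2))"
    unfolding R_def by (rule norm_triangle_ineq4)
  also have "\<dots> \<le> 1 * (1 / \<rho>) ^ N + 1 * (1 / \<rho>) ^ N"
    unfolding norm_mult norm_power ny using ny1 T1
    by (intro add_mono mult_mono power_decreasing) auto
  finally have R: "cmod R \<le> 2 * (1 / \<rho>) ^ N" by simp
  have "cmod (2 * y * R / D) = 2 / \<rho> * cmod R / cmod D"
    by (simp add: norm_mult norm_divide ny)
  also have "\<dots> \<le> 2 / \<rho> * (2 * (1 / \<rho>) ^ N) / (1 - 1 / \<rho>)\<^sup>2"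
    using R Dlb ny1 \<rho> by (intro frac_le mult_left_mono) auto
  also have "\<dots> = 4 / (\<rho> * (1 - 1 / \<rho>)\<^sup>2) * (1 / \<rho>) ^ N"
    using \<rho> by simp
  finally have "cmod ((1 - inverse w ^ 2) / 2 / (joukowski w - of_real x) - inverse w * P) \<le> 4 / (\<rho> * (1 - 1 / \<rho>)\<^sup>2) * (1 / \<rho>) ^ N"
    unfolding eq .
  then show ?thesis
    unfolding P_def y_def .
qed

text \<open>
  This integral is the winding number of the ellipse about \<open>x\<close>: the poles at \<open>cis (\<plusminus> \<phi>)\<close> and \<open>0\<close>
  contribute \<open>1 + 1 - 1\<close>.
\<close>

lemma joukowski_kernel_integral:
  assumes x: "x \<in> {-1<..<1}"
  shows "((\<lambda>w. (1 - inverse w ^ 2) / 2 / (joukowski w - of_real x)) has_contour_integral (2 * pi * \<i>)) (circlepath 0 \<rho>)"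
proof -
  define \<phi> where "\<phi> = arccos x"
  have x\<phi>: "x = cos \<phi>" using x by (simp add: \<phi>_def)
  have *: "((\<lambda>w. 1 / (w - e)) has_contour_integral (2 * pi * \<i>)) (circlepath 0 \<rho>)" if "cmod e \<le> 1" for e
    using Cauchy_integral_circlepath_simple[of "\<lambda>_. 1" 0 \<rho> e] that \<rho> by simp
  have "((\<lambda>w. 1 / (w - cis \<phi>) + 1 / (w - cis (- \<phi>)) - 1 / (w - 0)) has_contour_integral (2 * pi * \<i> + 2 * pi * \<i> - 2 * pi * \<i>)) (circlepath 0 \<rho>)"
    by (intro has_contour_integral_add has_contour_integral_diff *) auto
  then have "((\<lambda>w. 1 / (w - cis \<phi>) + 1 / (w - cis (- \<phi>)) - 1 / w) has_contour_integral (2 * pi * \<i>)) (circlepath 0 \<rho>)"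
    by (simp add: mult_ac)
  then show ?thesis
  proof (rule has_contour_integral_eq)
    fix w assume "w \<in> path_image (circlepath 0 \<rho>)"
    then have "cmod w > 1" using \<rho> by simp
    then show "1 / (w - cis \<phi>) + 1 / (w - cis (- \<phi>)) - 1 / w =
        (1 - inverse w ^ 2) / 2 / (joukowski w - of_real x)"
      by (rule joukowski_kernel_partial_fractions[OF x\<phi>, symmetric])
  qed
qed

text \<open>Cauchy's formula is applied in the convex filled ellipse to the image of the circle and
  pulled back along \<open>joukowski\<close>, whose derivative is (1 - w^-2) / 2. The winding number
  comes from the same substitution for u = 1.\<close>

lemma cauchy_formula_ellipse:
  assumes u: "u \<in> analytic_in_ellipse \<rho>" and x: "x \<in> {-1<..<1}"
  shows "((\<lambda>w. (1 - inverse w ^ 2) / 2 * (u (joukowski w) / (joukowski w - of_real x)))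
    has_contour_integral (2 * pi * \<i> * u (of_real x))) (circlepath 0 \<rho>)"
proof -
  define S where "S = {z. cmod (ellipse_scale \<rho> z) \<le> 1}"
  define g where "g = circlepath 0 \<rho>"
  have cont: "continuous_on A (ellipse_scale \<rho>)" for A
    using linear_ellipse_scale by (intro linear_continuous_on linear_conv_bounded_linear[THEN iffD1])
  have anS: "u analytic_on S"
    using u solid_ellipse_subset unfolding S_def analytic_in_ellipse_def by (auto elim: analytic_on_subset)
  have convex: "convex S"
  proof -
    have "S = ellipse_scale \<rho> -` cball 0 1" by (auto simp: S_def)
    then show ?thesis using convex_linear_vimage[OF linear_ellipse_scale] convex_cball by metis
  qed
  have "open {z. cmod (ellipse_scale \<rho> z) < 1}"
    by (intro open_Collect_less continuous_intros cont)
  then have int: "{z. cmod (ellipse_scale \<rho> z) < 1} \<subseteq> interior S"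
    by (intro interior_maximal) (auto simp: S_def)
  have xS: "of_real x \<in> interior S"
    using int norm_ellipse_scale_real_less[OF x] by auto
  have anJ: "joukowski analytic_on - {0}"
    unfolding joukowski_def[abs_def] by (intro analytic_intros) auto
  have pig: "path_image g \<subseteq> - {0}" using \<rho> by (auto simp: g_def)
  have vg: "valid_path g" by (simp add: g_def)
  have vJ: "valid_path (joukowski \<circ> g)"
    using valid_path_compose_analytic[OF vg anJ pig] .
  have piJ: "path_image (joukowski \<circ> g) \<subseteq> S - {of_real x}"
  proof -
    have "joukowski w \<in> S - {of_real x}" if "cmod w = \<rho>" for w
      using joukowski_circle[OF that] norm_ellipse_scale_real_less[OF x]
      by (auto simp: bernstein_ellipse_eq S_def)
    then show ?thesis using \<rho> by (auto simp: path_image_compose g_def)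
  qed
  have dJ: "deriv joukowski w = (1 - inverse w ^ 2) / 2" if "w \<noteq> 0" for w
  proof -
    have "(joukowski has_field_derivative (1 - inverse w ^ 2) / 2) (at w)"
      unfolding joukowski_def[abs_def] using that
      by (auto intro!: derivative_eq_intros simp: power2_eq_square)
    then show ?thesis by (rule DERIV_imp_deriv)
  qed
  have subst: "contour_integral (joukowski \<circ> g) f = contour_integral g (\<lambda>w. (1 - inverse w ^ 2) / 2 * f (joukowski w))" for f
  proof -
    have "contour_integral (joukowski \<circ> g) f = contour_integral g (\<lambda>w. deriv joukowski w * f (joukowski w))"
      by (rule contour_integral_comp_analyticW[OF anJ vg pig])
    also have "\<dots> = contour_integral g (\<lambda>w. (1 - inverse w ^ 2) / 2 * f (joukowski w))"
    proof (rule contour_integral_eq)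
      fix w assume "w \<in> path_image g"
      then have w0: "w \<noteq> 0" using pig by auto
      show "deriv joukowski w * f (joukowski w) = (1 - inverse w ^ 2) / 2 * f (joukowski w)"
        by (simp only: dJ[OF w0])
    qed
    finally show ?thesis .
  qed
  have wn: "winding_number (joukowski \<circ> g) (of_real x) = 1"
  proof -
    have "contour_integral (joukowski \<circ> g) (\<lambda>w. 1 / (w - of_real x)) = 2 * pi * \<i>"
      unfolding subst using contour_integral_unique[OF joukowski_kernel_integral[OF x]] by (simp add: g_def)
    then show ?thesis
      using winding_number_valid_path[OF vJ, of "of_real x"] piJ by auto
  qed
  have "((\<lambda>w. u w / (w - of_real x)) has_contour_integral (2 * pi * \<i> * winding_number (joukowski \<circ> g) (of_real x) * u (of_real x))) (joukowski \<circ> g)"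
  proof (rule Cauchy_integral_formula_weak[OF convex finite.emptyI])
    show "continuous_on S u"
      using anS by (intro holomorphic_on_imp_continuous_on analytic_imp_holomorphic)
    show "u field_differentiable at z" if "z \<in> interior S - {}" for z
      using anS that interior_subset analytic_on_imp_differentiable_at by blast
    show "pathfinish (joukowski \<circ> g) = pathstart (joukowski \<circ> g)"
      by (simp add: g_def pathfinish_compose pathstart_compose)
  qed (use xS vJ piJ in auto)
  then have "contour_integral (joukowski \<circ> g) (\<lambda>w. u w / (w - of_real x)) = 2 * pi * \<i> * u (of_real x)"
    unfolding wn by (simp add: contour_integral_unique)
  then have I: "contour_integral g (\<lambda>w. (1 - inverse w ^ 2) / 2 * (u (joukowski w) / (joukowski w - of_real x))) = 2 * pi * \<i> * u (of_real x)"
    unfolding subst .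
  have "(\<lambda>w. (1 - inverse w ^ 2) / 2 * (u (joukowski w) / (joukowski w - of_real x))) contour_integrable_on g"
  proof -
    have "continuous_on (path_image g) (\<lambda>w. u (joukowski w))"
    proof (rule continuous_on_compose2[of S u])
      show "continuous_on S u"
        using anS by (intro holomorphic_on_imp_continuous_on analytic_imp_holomorphic)
      show "continuous_on (path_image g) joukowski"
        using anJ pig by (meson analytic_imp_holomorphic holomorphic_on_imp_continuous_on continuous_on_subset)
      show "joukowski ` path_image g \<subseteq> S" using piJ by (auto simp: path_image_compose)
    qed
    moreover have "continuous_on (path_image g) joukowski"
      using anJ pig by (meson analytic_imp_holomorphic holomorphic_on_imp_continuous_on continuous_on_subset)
    moreover have "\<forall>w\<in>path_image g. joukowski w - of_real x \<noteq> 0" using piJ by (auto simp: path_image_compose)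
    moreover have "\<forall>w\<in>path_image g. w \<noteq> 0" using pig by auto
    ultimately have "continuous_on (path_image g) (\<lambda>w. (1 - inverse w ^ 2) / 2 * (u (joukowski w) / (joukowski w - of_real x)))"
      by (intro continuous_intros) auto
    then show ?thesis
      unfolding g_def using \<rho> by (intro contour_integrable_continuous_circlepath) simp
  qed
  from has_contour_integral_integral[OF this] show ?thesis
    unfolding I by (simp only: g_def)
qed

section \<open>Chebyshev coefficients as contour integrals\<close>

lemma continuous_on_unit_interval:
  assumes u: "u \<in> analytic_in_ellipse \<rho>"
  shows "continuous_on {-1<..<1} (\<lambda>x. u (of_real x))"
proof -
  have "u analytic_on {z. cmod (ellipse_scale \<rho> z) \<le> 1}"
    using u solid_ellipse_subset unfolding analytic_in_ellipse_def by (auto elim: analytic_on_subset)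
  then have "continuous_on {z. cmod (ellipse_scale \<rho> z) \<le> 1} u"
    by (intro holomorphic_on_imp_continuous_on analytic_imp_holomorphic)
  then show ?thesis
    by (rule continuous_on_compose2)
      (auto intro!: continuous_intros less_imp_le[OF norm_ellipse_scale_real_less])
qed

text \<open>The factor 1 at k = 0 and 2 elsewhere reflects the form 1 + 2 sum T_k y^k of the
  generating function.\<close>

definition ellipse_cheb_coeff :: "(complex \<Rightarrow> complex) \<Rightarrow> nat \<Rightarrow> complex" where
  "ellipse_cheb_coeff u k = (if k = 0 then 1 else 2) / (2 * pi * \<i>) *
     contour_integral (circlepath 0 \<rho>) (\<lambda>w. u (joukowski w) * inverse w ^ Suc k)"

text \<open>The coefficient bound is the length estimate on the circle. For the approximation,
  Cauchy's formula and the partial sum are integrals of the same function against the kernel and its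
  truncation, so the kernel remainder bounds the difference uniformly in x.\<close>

lemma ellipse_cheb_coeff:
  assumes u: "u \<in> analytic_in_ellipse \<rho>"
  shows "cmod (ellipse_cheb_coeff u k) \<le> 2 * ellipse_max \<rho> u * (1 / \<rho>) ^ k"
    and "x \<in> {-1<..<1} \<Longrightarrow>
      cmod (u (of_real x) - (\<Sum>k\<le>N. ellipse_cheb_coeff u k * of_real (poly (chebT k) x)))
      \<le> ellipse_max \<rho> u * (4 / (1 - 1 / \<rho>)\<^sup>2) * (1 / \<rho>) ^ N"
proof -
  define M where "M = ellipse_max \<rho> u"
  define F where "F = (\<lambda>w. u (joukowski w))"
  have FM: "cmod (F w) \<le> M" if "cmod w = \<rho>" for w
    unfolding F_def M_def using ellipse_max_attained(2)[OF \<rho> u joukowski_circle[OF that]] .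
  have M0: "M \<ge> 0"
    using order_trans[OF norm_ge_zero FM[of "of_real \<rho>"]] \<rho> by simp
  have contF: "continuous_on (sphere 0 \<rho>) F"
  proof -
    have "u analytic_on bernstein_ellipse \<rho>"
      using u by (auto simp: analytic_in_ellipse_def elim: analytic_on_subset)
    then have "continuous_on (bernstein_ellipse \<rho>) u"
      by (intro holomorphic_on_imp_continuous_on analytic_imp_holomorphic)
    moreover have "continuous_on (sphere 0 \<rho>) joukowski"
      unfolding joukowski_def[abs_def] using \<rho> by (intro continuous_intros) auto
    ultimately show ?thesis
      unfolding F_def by (rule continuous_on_compose2) (auto intro: joukowski_circle)
  qed
  have int: "((\<lambda>w. F w * inverse w ^ Suc k) has_contour_integral
      contour_integral (circlepath 0 \<rho>) (\<lambda>w. F w * inverse w ^ Suc k)) (circlepath 0 \<rho>)" for k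
  proof (rule has_contour_integral_integral, rule contour_integrable_continuous_circlepath)
    show "continuous_on (path_image (circlepath 0 \<rho>)) (\<lambda>w. F w * inverse w ^ Suc k)"
      using \<rho> contF by (intro continuous_intros) auto
  qed
  define a where "a = ellipse_cheb_coeff u"
  have int': "((\<lambda>w. F w * inverse w * ((if k = 0 then 1 else 2) * inverse w ^ k)) has_contour_integral (2 * pi * \<i> * a k)) (circlepath 0 \<rho>)" for k
    using has_contour_integral_lmul[OF int[of k], of "if k = 0 then 1 else 2"]
    by (simp add: a_def ellipse_cheb_coeff_def F_def mult_ac)
  have "cmod (contour_integral (circlepath 0 \<rho>) (\<lambda>w. F w * inverse w ^ Suc k)) \<le> M * (1 / \<rho>) ^ Suc k * (2 * pi * \<rho>)"
  proof (rule has_contour_integral_bound_circlepath[OF int])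
    fix w assume "cmod (w - 0) = \<rho>"
    then show "cmod (F w * inverse w ^ Suc k) \<le> M * (1 / \<rho>) ^ Suc k"
      using FM[of w] \<rho> M0 unfolding norm_mult norm_power norm_inverse
      by (intro mult_mono) (auto simp: divide_inverse)
  qed (use M0 \<rho> in auto)
  \<comment> \<open>The length 2 pi \<rho> of the circle cancels one of the k + 1 factors
    1/\<rho>.\<close>
  then have b: "cmod (contour_integral (circlepath 0 \<rho>) (\<lambda>w. F w * inverse w ^ Suc k)) \<le> M * (1 / \<rho>) ^ k * (2 * pi)"
    using \<rho> by (simp add: field_simps)
  have "cmod (ellipse_cheb_coeff u k) = (if k = 0 then 1 else 2) / (2 * pi) * cmod (contour_integral (circlepath 0 \<rho>) (\<lambda>w. F w * inverse w ^ Suc k))"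
    by (simp add: ellipse_cheb_coeff_def F_def norm_mult norm_divide)
  also have "\<dots> \<le> 2 / (2 * pi) * (M * (1 / \<rho>) ^ k * (2 * pi))"
    using b by (intro mult_mono divide_right_mono) auto
  finally show "cmod (ellipse_cheb_coeff u k) \<le> 2 * ellipse_max \<rho> u * (1 / \<rho>) ^ k"
    by (simp add: M_def)
  show "cmod (u (of_real x) - (\<Sum>k\<le>N. ellipse_cheb_coeff u k * of_real (poly (chebT k) x)))
      \<le> ellipse_max \<rho> u * (4 / (1 - 1 / \<rho>)\<^sup>2) * (1 / \<rho>) ^ N" if x: "x \<in> {-1<..<1}"
  proof -
    define T where "T = (\<lambda>k. complex_of_real (poly (chebT k) x))"
    define K where "K = (\<lambda>w. (1 - inverse w ^ 2) / 2 / (joukowski w - of_real x))"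
    define P where "P = (\<lambda>w. 1 + 2 * (\<Sum>k=1..N. T k * inverse w ^ k))"
    have "((\<lambda>w. \<Sum>k\<le>N. F w * inverse w * ((if k = 0 then 1 else 2) * inverse w ^ k) * T k) has_contour_integral
        (\<Sum>k\<le>N. 2 * pi * \<i> * a k * T k)) (circlepath 0 \<rho>)"
      by (intro has_contour_integral_sum has_contour_integral_rmul int') auto
    moreover have "(\<Sum>k\<le>N. F w * inverse w * ((if k = 0 then 1 else 2) * inverse w ^ k) * T k) = F w * (inverse w * P w)" for w
    proof -
      have "{..N} = insert 0 {1..N}" by auto
      then show ?thesis
        by (simp add: P_def T_def sum_distrib_left algebra_simps)
    qed
    ultimately have 1: "((\<lambda>w. F w * (inverse w * P w)) has_contour_integral (\<Sum>k\<le>N. 2 * pi * \<i> * a k * T k)) (circlepath 0 \<rho>)"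
      by simp
    have 2: "((\<lambda>w. F w * K w) has_contour_integral (2 * pi * \<i> * u (of_real x))) (circlepath 0 \<rho>)"
      using cauchy_formula_ellipse[OF u x] by (simp add: F_def K_def mult_ac)
    have "cmod (2 * pi * \<i> * u (of_real x) - (\<Sum>k\<le>N. 2 * pi * \<i> * a k * T k))
        \<le> M * (4 / (\<rho> * (1 - 1 / \<rho>)\<^sup>2) * (1 / \<rho>) ^ N) * (2 * pi * \<rho>)"
    proof (rule has_contour_integral_bound_circlepath[OF has_contour_integral_diff[OF 2 1]])
      fix w assume w: "cmod (w - 0) = \<rho>"
      have "F w * K w - F w * (inverse w * P w) = F w * (K w - inverse w * P w)"
        by (simp add: algebra_simps)
      then show "cmod (F w * K w - F w * (inverse w * P w)) \<le> M * (4 / (\<rho> * (1 - 1 / \<rho>)\<^sup>2) * (1 / \<rho>) ^ N)"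
        using FM[of w] w M0 joukowski_kernel_expansion[OF x, of w N] unfolding K_def P_def T_def
        by (simp only: norm_mult) (intro mult_mono, auto)
    qed (use M0 \<rho> in auto)
    also have "2 * pi * \<i> * u (of_real x) - (\<Sum>k\<le>N. 2 * pi * \<i> * a k * T k) = 2 * pi * \<i> * (u (of_real x) - (\<Sum>k\<le>N. a k * T k))"
      by (simp add: sum_distrib_left right_diff_distrib mult.assoc)
    also have "cmod \<dots> = 2 * pi * cmod (u (of_real x) - (\<Sum>k\<le>N. a k * T k))"
      unfolding norm_mult by simp
    also have "M * (4 / (\<rho> * (1 - 1 / \<rho>)\<^sup>2) * (1 / \<rho>) ^ N) * (2 * pi * \<rho>) =
        2 * pi * (M * (4 / (1 - 1 / \<rho>)\<^sup>2) * (1 / \<rho>) ^ N)"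
      using \<rho> by simp
    finally have "cmod (u (of_real x) - (\<Sum>k\<le>N. a k * T k)) \<le> M * (4 / (1 - 1 / \<rho>)\<^sup>2) * (1 / \<rho>) ^ N"
      by (rule mult_left_le_imp_le) simp
    then show ?thesis
      by (simp add: a_def T_def M_def)
  qed
qed

end

subsection \<open>Bounding the remainder\<close>

lemma set_integral_sum:
  fixes f :: "'k \<Rightarrow> 'a \<Rightarrow> 'b::{banach, second_countable_topology}"
  assumes "\<And>k. k \<in> I \<Longrightarrow> set_integrable M A (f k)"
  shows "set_integrable M A (\<lambda>x. \<Sum>k\<in>I. f k x)"
    and "(LINT x:A|M. (\<Sum>k\<in>I. f k x)) = (\<Sum>k\<in>I. LINT x:A|M. f k x)"
  using assms unfolding set_integrable_def set_lebesgue_integral_def scaleR_sum_right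
  by (auto intro!: Bochner_Integration.integrable_sum Bochner_Integration.integral_sum)

text \<open>The rule is exact for the square of the Lagrange cardinal polynomial.\<close>

lemma gauss_weight_nonneg:
  assumes \<alpha>: "\<alpha> > -1" and x: "x \<in> gauss_nodes \<alpha> n"
  shows "gauss_weight \<alpha> n x \<ge> 0"
proof -
  define N where "N = gauss_nodes \<alpha> n"
  have N: "finite N" "card N = n" using gauss_nodes[OF \<alpha>, of n] by (auto simp: N_def)
  then have n: "n > 0" using x by (metis N_def card_gt_0_iff empty_iff)
  define L where "L = (\<Prod>y \<in> N - {x}. smult (1 / (x - y)) [:-y, 1:])"
  have Lval: "poly L t = (\<Prod>y \<in> N - {x}. (t - y) / (x - y))" for t
    by (simp add: L_def poly_prod diff_divide_distrib)
  have "degree L \<le> (\<Sum>y\<in>N - {x}. degree (smult (1 / (x - y)) [:-y, 1:]))"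
    unfolding L_def by (rule degree_prod_sum_le[unfolded o_def]) (use N in blast)
  also have "\<dots> \<le> (\<Sum>y\<in>N - {x}. 1)" by (intro sum_mono) auto
  also have "\<dots> = n - 1" using N x by (simp add: N_def)
  finally have degL: "degree L < n" using n by simp
  have degLL: "degree (L * L) < 2 * n"
    using degree_mult_le[of L L] degL by simp
  have Lnode: "poly L y = (if y = x then 1 else 0)" if "y \<in> N" for y
    using that N by (auto simp: Lval intro!: prod.neutral)
  have Lx: "poly L y * c = (if y = x then c else 0)" "poly (L * L) y * c = (if y = x then c else 0)"
    if "y \<in> N" for y c using that by (simp_all add: Lnode)
  have "gauss_weight \<alpha> n x = (\<Sum>y\<in>N. poly (L * L) y * gauss_weight \<alpha> n y)"
    using N x by (simp add: Lx N_def[symmetric] del: poly_mult)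
  also have "\<dots> = (LINT t:{-1<..<1}|lborel. poly (L * L) t * gegenbauer_weight \<alpha> t)"
    unfolding N_def by (rule gauss_quadrature_exact[OF \<alpha> degLL, symmetric])
  also have "\<dots> \<ge> 0"
    unfolding set_lebesgue_integral_def
    by (intro integral_nonneg_AE) (auto simp: gegenbauer_weight_def)
  finally show ?thesis .
qed

lemma sum_gauss_weight:
  assumes \<alpha>: "\<alpha> > -1" and n: "n \<ge> 1"
  shows "(\<Sum>x \<in> gauss_nodes \<alpha> n. gauss_weight \<alpha> n x) = gegenbauer_inner \<alpha> 1 1"
  using gauss_quadrature_exact[OF \<alpha>, of 1 n] n by (simp add: gegenbauer_inner_def)

text \<open>Integral and quadrature rule are both positive functionals of the same total mass, so
  each contributes at most B times that mass. The bound is free of n, as the dominated limit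
  requires.\<close>

lemma gauss_error_functional_bound:
  fixes f :: "real \<Rightarrow> complex"
  assumes \<alpha>: "\<alpha> > -1" and n: "n \<ge> 1"
    and cont: "continuous_on {-1<..<1} f" and B: "\<And>x. x \<in> {-1<..<1} \<Longrightarrow> cmod (f x) \<le> B"
  shows "set_integrable lborel {-1<..<1} (\<lambda>x. f x * of_real (gegenbauer_weight \<alpha> x))"
    and "cmod ((LINT x:{-1<..<1}|lborel. f x * of_real (gegenbauer_weight \<alpha> x)) -
      (\<Sum>x \<in> gauss_nodes \<alpha> n. f x * of_real (gauss_weight \<alpha> n x))) \<le> 2 * B * gegenbauer_inner \<alpha> 1 1"
proof -
  have B0: "B \<ge> 0" using order_trans[OF norm_ge_zero B[of 0]] by simp
  have int: "set_integrable lborel {-1<..<1} (\<lambda>x. B * gegenbauer_weight \<alpha> x)"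
    using set_integrable_gegenbauer_weight[OF \<alpha>] by (rule set_integrable_mult_right)
  have le: "norm (f x * of_real (gegenbauer_weight \<alpha> x)) \<le> B * gegenbauer_weight \<alpha> x" if "x \<in> {-1<..<1}" for x
    using B[OF that] by (auto simp: norm_mult gegenbauer_weight_def intro!: mult_right_mono)
  show int2: "set_integrable lborel {-1<..<1} (\<lambda>x. f x * of_real (gegenbauer_weight \<alpha> x))"
  proof (rule set_integrable_bound[OF int])
    have "(\<lambda>x. indicator {-1<..<1} x *\<^sub>R f x) \<in> borel_measurable borel"
      by (intro borel_measurable_continuous_on_indicator cont) auto
    moreover have "(\<lambda>x. complex_of_real (gegenbauer_weight \<alpha> x)) \<in> borel_measurable borel"
      unfolding gegenbauer_weight_def by measurable
    ultimately have "(\<lambda>x. (indicator {-1<..<1} x *\<^sub>R f x) * complex_of_real (gegenbauer_weight \<alpha> x)) \<in> borel_measurable borel"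
      by (rule borel_measurable_times)
    then show "set_borel_measurable lborel {-1<..<1} (\<lambda>x. f x * of_real (gegenbauer_weight \<alpha> x))"
      by (simp add: set_borel_measurable_def)
    show "AE x in lborel. x \<in> {-1<..<1} \<longrightarrow>
        norm (f x * of_real (gegenbauer_weight \<alpha> x)) \<le> norm (B * gegenbauer_weight \<alpha> x)"
    proof (intro AE_I2 impI)
      fix x :: real assume "x \<in> {-1<..<1}"
      from order_trans[OF le[OF this] abs_ge_self]
      show "norm (f x * of_real (gegenbauer_weight \<alpha> x)) \<le> norm (B * gegenbauer_weight \<alpha> x)"
        by simp
    qed
  qed
  have "cmod (LINT x:{-1<..<1}|lborel. f x * of_real (gegenbauer_weight \<alpha> x)) \<le>
      (LINT x:{-1<..<1}|lborel. cmod (f x * of_real (gegenbauer_weight \<alpha> x)))"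
    by (rule set_integral_norm_bound[OF int2])
  also have "\<dots> \<le> (LINT x:{-1<..<1}|lborel. B * gegenbauer_weight \<alpha> x)"
    by (intro set_integral_mono set_integrable_norm int2 int le)
  also have "\<dots> = B * gegenbauer_inner \<alpha> 1 1"
    by (simp add: gegenbauer_inner_def)
  finally have 1: "cmod (LINT x:{-1<..<1}|lborel. f x * of_real (gegenbauer_weight \<alpha> x)) \<le> B * gegenbauer_inner \<alpha> 1 1" .
  have "cmod (\<Sum>x \<in> gauss_nodes \<alpha> n. f x * of_real (gauss_weight \<alpha> n x)) \<le> (\<Sum>x \<in> gauss_nodes \<alpha> n. B * gauss_weight \<alpha> n x)"
  proof (rule sum_norm_le)
    fix x assume x: "x \<in> gauss_nodes \<alpha> n"
    then have "x \<in> {-1<..<1}" using gauss_nodes(3)[OF \<alpha>] by blast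
    then show "cmod (f x * of_real (gauss_weight \<alpha> n x)) \<le> B * gauss_weight \<alpha> n x"
      using B gauss_weight_nonneg[OF \<alpha> x] by (auto simp: norm_mult intro!: mult_right_mono)
  qed
  also have "\<dots> = B * gegenbauer_inner \<alpha> 1 1"
    by (simp add: sum_distrib_left[symmetric] sum_gauss_weight[OF \<alpha> n])
  finally have 2: "cmod (\<Sum>x \<in> gauss_nodes \<alpha> n. f x * of_real (gauss_weight \<alpha> n x)) \<le> B * gegenbauer_inner \<alpha> 1 1" .
  show "cmod ((LINT x:{-1<..<1}|lborel. f x * of_real (gegenbauer_weight \<alpha> x)) -
      (\<Sum>x \<in> gauss_nodes \<alpha> n. f x * of_real (gauss_weight \<alpha> n x))) \<le> 2 * B * gegenbauer_inner \<alpha> 1 1"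
    by (rule order_trans[OF norm_triangle_ineq4]) (use add_mono[OF 1 2] in simp)
qed

lemma of_real_gauss_error:
  assumes \<alpha>: "\<alpha> > -1"
  shows "of_real (gauss_error \<alpha> n p) =
    (LINT x:{-1<..<1}|lborel. of_real (poly p x) * of_real (gegenbauer_weight \<alpha> x)) -
    (\<Sum>x \<in> gauss_nodes \<alpha> n. (of_real (poly p x) :: complex) * of_real (gauss_weight \<alpha> n x))"
proof -
  have "(LINT x:{-1<..<1}|lborel. (of_real (poly p x) :: complex) * of_real (gegenbauer_weight \<alpha> x)) =
      of_real (gegenbauer_inner \<alpha> p 1)"
    using set_integral_complex_of_real[of lborel "{-1<..<1}" "\<lambda>x. poly p x * gegenbauer_weight \<alpha> x"]
    by (simp add: gegenbauer_inner_def)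
  then show ?thesis by (simp add: gauss_error_def)
qed

lemma abs_gauss_error_chebT_le:
  assumes \<alpha>: "\<alpha> > -1" and n: "n \<ge> 1"
  shows "\<bar>gauss_error \<alpha> n (chebT k)\<bar> \<le> 2 * gegenbauer_inner \<alpha> 1 1"
proof -
  have "cmod (of_real (gauss_error \<alpha> n (chebT k))) \<le> 2 * 1 * gegenbauer_inner \<alpha> 1 1"
    unfolding of_real_gauss_error[OF \<alpha>]
  proof (rule gauss_error_functional_bound(2)[OF \<alpha> n])
    show "continuous_on {-1<..<1} (\<lambda>x. complex_of_real (poly (chebT k) x))"
      by (intro continuous_intros)
    show "cmod (of_real (poly (chebT k) x)) \<le> 1" if "x \<in> {-1<..<1}" for x
      using abs_poly_chebT_le_1[of x k] that by simp
  qed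
  then show ?thesis by simp
qed

section \<open>The remainder bound and its limit\<close>

definition cheb_error_series :: "real \<Rightarrow> real \<Rightarrow> nat \<Rightarrow> real" where
  "cheb_error_series \<alpha> \<rho> n = (\<Sum>i. (1 / \<rho>) ^ i * \<bar>cheb_error \<alpha> n i\<bar>)"

lemma summable_cheb_error_series:
  assumes "\<alpha> > -1" "n \<ge> 1" "\<rho> > 1"
  shows "summable (\<lambda>i. (1 / \<rho>) ^ i * \<bar>cheb_error \<alpha> n i\<bar>)"
proof (rule summable_comparison_test'[of "\<lambda>i. (1 / \<rho>) ^ i * (2 * gegenbauer_inner \<alpha> 1 1)" 0])
  show "summable (\<lambda>i. (1 / \<rho>) ^ i * (2 * gegenbauer_inner \<alpha> 1 1))"
    using assms by (intro summable_mult2 summable_geometric) auto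
  show "norm ((1 / \<rho>) ^ i * \<bar>cheb_error \<alpha> n i\<bar>) \<le> (1 / \<rho>) ^ i * (2 * gegenbauer_inner \<alpha> 1 1)" for i
    using assms abs_gauss_error_chebT_le[OF assms(1,2)]
    by (auto simp: cheb_error_def abs_mult intro!: mult_left_mono divide_right_mono)
qed

lemma sum_atMost_offset:
  fixes f :: "nat \<Rightarrow> 'a::comm_monoid_add"
  shows "(\<Sum>k\<le>m + N. f k) = (\<Sum>k<m. f k) + (\<Sum>i\<le>N. f (m + i))"
  by (induction N) (simp_all add: lessThan_Suc_atMost[symmetric] add.assoc)

text \<open>Working with partial sums and the uniform approximation error avoids exchanging the
  Chebyshev series with the integral.\<close>

lemma gegenbauer_gauss_remainder_le:
  assumes \<alpha>: "\<alpha> > -1" and n: "n \<ge> 1" and \<rho>: "\<rho> > 1" and u: "u \<in> analytic_in_ellipse \<rho>"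
  shows "cmod (gegenbauer_gauss_remainder \<alpha> n u) \<le> 2 * ellipse_max \<rho> u / \<rho> ^ (2 * n) * cheb_error_series \<alpha> \<rho> n"
proof -
  define M where "M = ellipse_max \<rho> u"
  define a where "a = ellipse_cheb_coeff \<rho> u"
  define e where "e = (\<lambda>k. gauss_error \<alpha> n (chebT k))"
  define \<mu> where "\<mu> = gegenbauer_inner \<alpha> 1 1"
  define C where "C = M * (4 / (1 - 1 / \<rho>)\<^sup>2)"
  define T where "T = (\<lambda>k x. complex_of_real (poly (chebT k) x))"
  have a: "cmod (a k) \<le> 2 * M * (1 / \<rho>) ^ k" for k
    unfolding a_def M_def by (rule ellipse_cheb_coeff(1)[OF \<rho> u])
  have M0: "M \<ge> 0" using order_trans[OF norm_ge_zero a[of 0]] by simp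
  have approx: "cmod (u (of_real x) - (\<Sum>k\<le>N. a k * T k x)) \<le> C * (1 / \<rho>) ^ N" if "x \<in> {-1<..<1}" for x N
    unfolding a_def T_def C_def M_def using ellipse_cheb_coeff(2)[OF \<rho> u that] .
  have contu: "continuous_on {-1<..<1} (\<lambda>x. u (of_real x))"
    by (rule continuous_on_unit_interval[OF \<rho> u])
  have contT: "continuous_on {-1<..<1} (\<lambda>x. \<Sum>k\<le>N. a k * T k x)" for N
    unfolding T_def by (intro continuous_intros)
  have intT: "set_integrable lborel {-1<..<1} (\<lambda>x. a k * (T k x * of_real (gegenbauer_weight \<alpha> x)))" for k
  proof (rule set_integrable_mult_right, rule gauss_error_functional_bound(1)[OF \<alpha> n])
    show "continuous_on {-1<..<1} (T k)" unfolding T_def by (intro continuous_intros)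
    show "cmod (T k x) \<le> 1" if "x \<in> {-1<..<1}" for x
      using abs_poly_chebT_le_1[of x k] that by (simp add: T_def)
  qed
  have step: "cmod (gegenbauer_gauss_remainder \<alpha> n u - (\<Sum>k\<le>N. a k * of_real (e k))) \<le> 2 * (C * (1 / \<rho>) ^ N) * \<mu>" for N
  proof -
    define S where "S = (\<lambda>x. \<Sum>k\<le>N. a k * T k x)"
    have contS: "continuous_on {-1<..<1} (\<lambda>x. u (of_real x) - S x)"
      unfolding S_def by (intro continuous_on_diff contu contT)
    have approxS: "cmod (u (of_real x) - S x) \<le> C * (1 / \<rho>) ^ N" if "x \<in> {-1<..<1}" for x
      unfolding S_def by (rule approx[OF that])
    have intd: "set_integrable lborel {-1<..<1} (\<lambda>x. (u (of_real x) - S x) * of_real (gegenbauer_weight \<alpha> x))"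
      by (rule gauss_error_functional_bound(1)[OF \<alpha> n contS approxS])
    have S: "S x * of_real c = (\<Sum>k\<le>N. a k * (T k x * of_real c))" for x c
      by (simp add: S_def sum_distrib_right mult.assoc)
    have intS: "set_integrable lborel {-1<..<1} (\<lambda>x. S x * of_real (gegenbauer_weight \<alpha> x))"
      unfolding S by (intro set_integral_sum(1) intT)
    have "(LINT x:{-1<..<1}|lborel. S x * of_real (gegenbauer_weight \<alpha> x)) =
        (\<Sum>k\<le>N. a k * (LINT x:{-1<..<1}|lborel. T k x * of_real (gegenbauer_weight \<alpha> x)))"
      unfolding S by (subst set_integral_sum(2)) (simp_all only: intT set_integral_mult_right)
    moreover have "(\<Sum>x \<in> gauss_nodes \<alpha> n. S x * of_real (gauss_weight \<alpha> n x)) =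
        (\<Sum>k\<le>N. a k * (\<Sum>x \<in> gauss_nodes \<alpha> n. T k x * of_real (gauss_weight \<alpha> n x)))"
      unfolding S by (subst sum.swap) (simp add: sum_distrib_left)
    ultimately have eS: "(\<Sum>k\<le>N. a k * of_real (e k)) = (LINT x:{-1<..<1}|lborel. S x * of_real (gegenbauer_weight \<alpha> x)) -
        (\<Sum>x \<in> gauss_nodes \<alpha> n. S x * of_real (gauss_weight \<alpha> n x))"
      by (simp add: e_def of_real_gauss_error[OF \<alpha>] T_def sum_subtractf right_diff_distrib)
    have "(LINT x:{-1<..<1}|lborel. u (of_real x) * of_real (gegenbauer_weight \<alpha> x)) =
        (LINT x:{-1<..<1}|lborel. (u (of_real x) - S x) * of_real (gegenbauer_weight \<alpha> x)) +
        (LINT x:{-1<..<1}|lborel. S x * of_real (gegenbauer_weight \<alpha> x))"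
      by (subst set_integral_add(2)[OF intd intS, symmetric]) (simp add: algebra_simps)
    then have "gegenbauer_gauss_remainder \<alpha> n u - (\<Sum>k\<le>N. a k * of_real (e k)) =
        (LINT x:{-1<..<1}|lborel. (u (of_real x) - S x) * of_real (gegenbauer_weight \<alpha> x)) -
        (\<Sum>x \<in> gauss_nodes \<alpha> n. (u (of_real x) - S x) * of_real (gauss_weight \<alpha> n x))"
      by (simp add: gegenbauer_gauss_remainder_def eS sum_subtractf left_diff_distrib)
    also have "cmod \<dots> \<le> 2 * (C * (1 / \<rho>) ^ N) * \<mu>"
      unfolding \<mu>_def by (rule gauss_error_functional_bound(2)[OF \<alpha> n contS approxS])
    finally show ?thesis .
  qed
  define \<Phi> where "\<Phi> = cheb_error_series \<alpha> \<rho> n"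
  have partial: "cmod (\<Sum>k\<le>2 * n + N. a k * of_real (e k)) \<le> 2 * M / \<rho> ^ (2 * n) * \<Phi>" for N
  proof -
    have "(\<Sum>k\<le>2 * n + N. a k * of_real (e k)) = (\<Sum>i\<le>N. a (2 * n + i) * of_real (cheb_error \<alpha> n i))"
      unfolding sum_atMost_offset
      by (simp add: e_def gauss_error_eq_0[OF \<alpha>] degree_chebT cheb_error_def)
    also have "cmod \<dots> \<le> (\<Sum>i\<le>N. 2 * M / \<rho> ^ (2 * n) * ((1 / \<rho>) ^ i * \<bar>cheb_error \<alpha> n i\<bar>))"
    proof (rule sum_norm_le)
      fix i
      have "cmod (a (2 * n + i) * of_real (cheb_error \<alpha> n i)) \<le> (2 * M * (1 / \<rho>) ^ (2 * n + i)) * \<bar>cheb_error \<alpha> n i\<bar>"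
        unfolding norm_mult norm_of_real by (intro mult_right_mono a) auto
      also have "\<dots> = 2 * M / \<rho> ^ (2 * n) * ((1 / \<rho>) ^ i * \<bar>cheb_error \<alpha> n i\<bar>)"
        using \<rho> by (simp add: power_add power_divide)
      finally show "cmod (a (2 * n + i) * of_real (cheb_error \<alpha> n i)) \<le> 2 * M / \<rho> ^ (2 * n) * ((1 / \<rho>) ^ i * \<bar>cheb_error \<alpha> n i\<bar>)" .
    qed
    also have "\<dots> = 2 * M / \<rho> ^ (2 * n) * (\<Sum>i\<le>N. (1 / \<rho>) ^ i * \<bar>cheb_error \<alpha> n i\<bar>)"
      by (simp add: sum_distrib_left)
    also have "\<dots> \<le> 2 * M / \<rho> ^ (2 * n) * \<Phi>"
      unfolding \<Phi>_def cheb_error_series_def using M0 \<rho>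
      by (intro mult_left_mono sum_le_suminf summable_cheb_error_series[OF \<alpha> n \<rho>]) auto
    finally show ?thesis .
  qed
  have bound: "cmod (gegenbauer_gauss_remainder \<alpha> n u) \<le> 2 * M / \<rho> ^ (2 * n) * \<Phi> + 2 * (C * (1 / \<rho>) ^ (2 * n + N)) * \<mu>" for N
    using norm_triangle_sub[of "gegenbauer_gauss_remainder \<alpha> n u" "\<Sum>k\<le>2 * n + N. a k * of_real (e k)"]
      partial[of N] step[of "2 * n + N"] by linarith
  \<comment> \<open>The left side of \<open>bound\<close> is independent of N, so letting N grow
    removes the truncation term.\<close>
  have "(\<lambda>N. (1 / \<rho>) ^ N) \<longlonglongrightarrow> 0"
    using \<rho> by (intro LIMSEQ_realpow_zero) auto
  then have "(\<lambda>N. (1 / \<rho>) ^ (N + 2 * n)) \<longlonglongrightarrow> 0"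
    by (rule LIMSEQ_ignore_initial_segment)
  then have "(\<lambda>N. 2 * M / \<rho> ^ (2 * n) * \<Phi> + 2 * (C * (1 / \<rho>) ^ (N + 2 * n)) * \<mu>) \<longlonglongrightarrow> 2 * M / \<rho> ^ (2 * n) * \<Phi> + 2 * (C * 0) * \<mu>"
    by (intro tendsto_intros)
  then show ?thesis
    using LIMSEQ_le_const[of _ _ "cmod (gegenbauer_gauss_remainder \<alpha> n u)"] bound
    by (fastforce simp: M_def \<Phi>_def add.commute)
qed

text \<open>Tannery's theorem with the geometric majorant (1/\<rho>)^i B. The factor 2 of the
  coefficient bound turns pi / 2 powr (2 \<alpha> + 1) into the prefactor of
  \<open>gegenbauer_series\<close>.\<close>

lemma tendsto_cheb_error_series:
  assumes \<alpha>: "\<alpha> > -1" and \<rho>: "\<rho> > 1"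
  shows "(\<lambda>n. 2 * cheb_error_series \<alpha> \<rho> n) \<longlonglongrightarrow> gegenbauer_series \<alpha> (1 / \<rho>\<^sup>2)"
proof -
  define L where "L = 2 * \<alpha> + 1"
  define \<gamma> where "\<gamma> = pi / 2 powr L"
  define c where "c = cheb_limit_coeff (- 2 * L)"
  define B where "B = 2 * gegenbauer_inner \<alpha> 1 1"
  have lim: "(\<lambda>n. (1 / \<rho>) ^ i * \<bar>cheb_error \<alpha> n i\<bar>) \<longlonglongrightarrow> (1 / \<rho>) ^ i * \<bar>\<gamma> * c i\<bar>" for i
    unfolding \<gamma>_def c_def L_def
    by (intro tendsto_intros tendsto_cheb_error[OF \<alpha>] tendsto_jacobi_inner_chebT_lead[OF \<alpha>])
  have ev: "eventually (\<lambda>(i, n). norm ((1 / \<rho>) ^ i * \<bar>cheb_error \<alpha> n i\<bar>) \<le> (1 / \<rho>) ^ i * B) (at_top \<times>\<^sub>F sequentially)"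
  proof -
    have "eventually (\<lambda>x. True \<and> snd x \<ge> 1) (at_top \<times>\<^sub>F sequentially :: (nat \<times> nat) filter)"
      by (intro eventually_prodI eventually_ge_at_top) auto
    then show ?thesis
    proof eventually_elim
      case (elim x)
      then show ?case
        using \<rho> abs_gauss_error_chebT_le[OF \<alpha>, of "snd x"]
        by (auto simp: cheb_error_def abs_mult B_def split_def intro!: mult_left_mono divide_right_mono)
    qed
  qed
  have "summable (\<lambda>i. (1 / \<rho>) ^ i * B)"
    using \<rho> by (intro summable_mult2 summable_geometric) auto
  from tannerys_theorem[OF lim ev this]
  have tan: "summable (\<lambda>i. norm ((1 / \<rho>) ^ i * \<bar>\<gamma> * c i\<bar>))"
    "(\<lambda>n. cheb_error_series \<alpha> \<rho> n) \<longlonglongrightarrow> (\<Sum>i. (1 / \<rho>) ^ i * \<bar>\<gamma> * c i\<bar>)"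
    by (simp_all add: cheb_error_series_def)
  have "summable (\<lambda>i. (1 / \<rho>) ^ i * \<bar>\<gamma> * c i\<bar>)"
    using summable_norm_cancel[OF tan(1)] .
  then have "(\<lambda>i. (1 / \<rho>) ^ i * \<bar>\<gamma> * c i\<bar>) sums (\<Sum>i. (1 / \<rho>) ^ i * \<bar>\<gamma> * c i\<bar>)"
    by (rule summable_sums)
  \<comment> \<open>Odd terms vanish in the limit, and at 2 k the coefficient is a binomial
    coefficient of L up to sign; hence the series in 1/\<rho>^2.\<close>
  then have "(\<lambda>k. (1 / \<rho>) ^ (2 * k) * \<bar>\<gamma> * c (2 * k)\<bar>) sums (\<Sum>i. (1 / \<rho>) ^ i * \<bar>\<gamma> * c i\<bar>)"
    by (subst sums_mono_reindex[of "\<lambda>k. 2 * k"])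
      (auto simp: strict_mono_def c_def intro!: cheb_limit_coeff_odd elim: evenE)
  moreover have "(1 / \<rho>) ^ (2 * k) * \<bar>\<gamma> * c (2 * k)\<bar> = \<gamma> * (\<bar>L gchoose k\<bar> * (1 / \<rho>\<^sup>2) ^ k)" for k
    by (simp add: c_def cheb_limit_coeff_even abs_mult \<gamma>_def power_mult power_divide)
  ultimately have s: "(\<lambda>k. \<gamma> * (\<bar>L gchoose k\<bar> * (1 / \<rho>\<^sup>2) ^ k)) sums (\<Sum>i. (1 / \<rho>) ^ i * \<bar>\<gamma> * c i\<bar>)"
    by simp
  have "\<gamma> > 0" by (simp add: \<gamma>_def)
  then have "(\<lambda>k. \<bar>L gchoose k\<bar> * (1 / \<rho>\<^sup>2) ^ k) sums ((\<Sum>i. (1 / \<rho>) ^ i * \<bar>\<gamma> * c i\<bar>) / \<gamma>)"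
    using sums_divide[OF s, of \<gamma>] by simp
  then have "gegenbauer_series \<alpha> (1 / \<rho>\<^sup>2) = pi / 2 powr (2 * \<alpha>) * ((\<Sum>i. (1 / \<rho>) ^ i * \<bar>\<gamma> * c i\<bar>) / \<gamma>)"
    by (simp add: gegenbauer_series_def L_def sums_iff)
  also have "\<dots> = 2 * (\<Sum>i. (1 / \<rho>) ^ i * \<bar>\<gamma> * c i\<bar>)"
    by (simp add: \<gamma>_def L_def powr_add)
  finally show ?thesis
    using tendsto_mult_left[OF tan(2), of 2] by simp
qed

text \<open>\<open>R\<close> is kept abstract so that both the Gegenbauer and the Legendre constant
  can be inserted.\<close>

lemma gegenbauer_gauss_remainder_const:
  assumes \<alpha>: "\<alpha> > -1" and \<rho>: "\<rho> > 1" and R: "gegenbauer_series \<alpha> (1 / \<rho>\<^sup>2) < R"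
  shows "\<exists>C :: nat \<Rightarrow> real. (\<forall>n\<ge>1. C n > 0) \<and> (\<lambda>n. C n - 1) \<in> O(\<lambda>n. 1 / real n) \<and>
    (\<forall>u \<in> analytic_in_ellipse \<rho>. \<forall>n\<ge>1.
       cmod (gegenbauer_gauss_remainder \<alpha> n u) \<le> C n * (ellipse_max \<rho> u / \<rho> ^ (2 * n) * R))"
proof -
  define \<Phi> where "\<Phi> = cheb_error_series \<alpha> \<rho>"
  \<comment> \<open>The quotient is the constant that the bound yields at this n, free of u. The
    maximum makes it positive throughout and equal to 1 as soon as 2 \<Phi> n is at most R.\<close>
  define C where "C = (\<lambda>n. max 1 (2 * \<Phi> n / R))"
  have lim: "(\<lambda>n. 2 * \<Phi> n) \<longlonglongrightarrow> gegenbauer_series \<alpha> (1 / \<rho>\<^sup>2)"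
    unfolding \<Phi>_def by (rule tendsto_cheb_error_series[OF \<alpha> \<rho>])
  have "eventually (\<lambda>n. 0 \<le> 2 * \<Phi> n) sequentially"
    using eventually_ge_at_top[of 1]
  proof eventually_elim
    case (elim n)
    show ?case
      unfolding \<Phi>_def cheb_error_series_def using \<rho>
      by (auto intro!: suminf_nonneg summable_cheb_error_series[OF \<alpha> elim \<rho>])
  qed
  then have "0 \<le> gegenbauer_series \<alpha> (1 / \<rho>\<^sup>2)"
    using tendsto_lowerbound[OF lim] by simp
  then have R0: "R > 0" using R by simp
  have "eventually (\<lambda>n. C n - 1 = 0) sequentially"
    using order_tendstoD(2)[OF lim R]
  proof eventually_elim
    case (elim n)
    then show ?case using R0 by (simp add: C_def)
  qed
  then have O: "(\<lambda>n. C n - 1) \<in> O(\<lambda>n. 1 / real n)"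
    by (intro bigoI[of _ 1]) (auto elim!: eventually_mono)
  have "cmod (gegenbauer_gauss_remainder \<alpha> n u) \<le> C n * (ellipse_max \<rho> u / \<rho> ^ (2 * n) * R)"
    if u: "u \<in> analytic_in_ellipse \<rho>" and n: "n \<ge> 1" for u n
  proof -
    have M: "0 \<le> ellipse_max \<rho> u / \<rho> ^ (2 * n)"
      using ellipse_max_attained(1)[OF \<rho> u] \<rho> by (metis divide_nonneg_nonneg less_eq_real_def less_trans norm_ge_zero zero_le_power zero_less_one)
    have "cmod (gegenbauer_gauss_remainder \<alpha> n u) \<le> (2 * \<Phi> n / R) * (ellipse_max \<rho> u / \<rho> ^ (2 * n) * R)"
      using gegenbauer_gauss_remainder_le[OF \<alpha> n \<rho> u] R0 by (simp add: \<Phi>_def mult_ac)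
    also have "\<dots> \<le> C n * (ellipse_max \<rho> u / \<rho> ^ (2 * n) * R)"
      using M R0 by (intro mult_right_mono mult_nonneg_nonneg) (auto simp: C_def)
    finally show ?thesis .
  qed
  moreover have "\<forall>n\<ge>1. C n > 0" by (auto simp: C_def less_max_iff_disj)
  ultimately show ?thesis using O by blast
qed

theorem theorem3p2:
  fixes \<rho> :: real
  assumes "\<rho> > 1"
  shows
    "(\<forall>\<alpha>::real. \<alpha> > -1 \<and> \<alpha> \<noteq> -1/2 \<longrightarrow>
       (\<exists>C :: nat \<Rightarrow> real.
          (\<forall>n\<ge>1. C n > 0) \<and>
          (\<lambda>n. C n - 1) \<in> O(\<lambda>n. 1 / real n) \<and>
          (\<forall>u \<in> analytic_in_ellipse \<rho>. \<forall>n\<ge>1.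
             cmod (gegenbauer_gauss_remainder \<alpha> n u) \<le>
               C n * ellipse_max \<rho> u * sqrt pi / \<rho> ^ (2 * n) *
               (sqrt pi / 2 powr (2 * \<alpha>) +
                Gamma (\<alpha> + 1) / sqrt (Gamma (2 * \<alpha> + 2)) * (2 * sqrt 2 / (\<rho>\<^sup>2 - 1))) *
               (if \<alpha> > -1/2 then (1 + 1 / \<rho>\<^sup>2) powr (\<alpha> + 1/2)
                else (1 - 1 / \<rho>\<^sup>2) powr (\<alpha> + 1/2))))) \<and>
     (\<exists>C :: nat \<Rightarrow> real.
        (\<forall>n\<ge>1. C n > 0) \<and>
        (\<lambda>n. C n - 1) \<in> O(\<lambda>n. 1 / real n) \<and>
        (\<forall>u \<in> analytic_in_ellipse \<rho>. \<forall>n\<ge>1.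
           cmod (legendre_gauss_remainder n u) \<le>
             C n * ellipse_max \<rho> u * pi * sqrt (1 + 1 / \<rho>\<^sup>2) / \<rho> ^ (2 * n) *
             (1 + 1 / (2 * (\<rho>\<^sup>2 - 1)))))"
proof (intro conjI allI impI)
  \<comment> \<open>Brings the stated product into the form C n times M / \<rho>^(2 n) times
    R.\<close>
  have rearrange: "c * m * s / r * k * w = c * (m / r * (s * k * w))" for c m s r k w :: real
    by simp
  fix \<alpha> :: real
  assume "\<alpha> > -1 \<and> \<alpha> \<noteq> -1/2"
  then show "\<exists>C :: nat \<Rightarrow> real.
          (\<forall>n\<ge>1. C n > 0) \<and>
          (\<lambda>n. C n - 1) \<in> O(\<lambda>n. 1 / real n) \<and>
          (\<forall>u \<in> analytic_in_ellipse \<rho>. \<forall>n\<ge>1.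
             cmod (gegenbauer_gauss_remainder \<alpha> n u) \<le>
               C n * ellipse_max \<rho> u * sqrt pi / \<rho> ^ (2 * n) *
               (sqrt pi / 2 powr (2 * \<alpha>) +
                Gamma (\<alpha> + 1) / sqrt (Gamma (2 * \<alpha> + 2)) * (2 * sqrt 2 / (\<rho>\<^sup>2 - 1))) *
               (if \<alpha> > -1/2 then (1 + 1 / \<rho>\<^sup>2) powr (\<alpha> + 1/2)
                else (1 - 1 / \<rho>\<^sup>2) powr (\<alpha> + 1/2)))"
    unfolding rearrange
    by (intro gegenbauer_gauss_remainder_const gegenbauer_series_less assms) auto
next
  have rearrange: "c * m * pi * s / r * k = c * (m / r * (pi * s * k))" for c m s r k :: real
    by simp
  show "\<exists>C :: nat \<Rightarrow> real.
        (\<forall>n\<ge>1. C n > 0) \<and>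
        (\<lambda>n. C n - 1) \<in> O(\<lambda>n. 1 / real n) \<and>
        (\<forall>u \<in> analytic_in_ellipse \<rho>. \<forall>n\<ge>1.
           cmod (legendre_gauss_remainder n u) \<le>
             C n * ellipse_max \<rho> u * pi * sqrt (1 + 1 / \<rho>\<^sup>2) / \<rho> ^ (2 * n) *
             (1 + 1 / (2 * (\<rho>\<^sup>2 - 1))))"
    unfolding rearrange legendre_gauss_remainder_def
    by (intro gegenbauer_gauss_remainder_const legendre_series_less assms) auto
qed

end
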